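(* Let $y=\varphi(x,u)$ be an $(x,u)$-flat output of the system $\dot x=f(x,u)$ with $n$-dimensional state $x$ and $m$-dimensional input $u$, and let $R$ be the associated minimal multi-index. Apply to $\varphi$ the input-replacement procedure described in the context, let $s$ be the number of steps, and let $\kappa_1,\dots,\kappa_s$ be the multi-indices constructed by it. Then the multi-index $\kappa=(\kappa_1,\dots,\kappa_s)$ satisfies $|\kappa|=n$ and $\kappa\le R$. Furthermore, the differentials $\mathrm{d}x,\mathrm{d}\varphi_{[\kappa]},\mathrm{d}\varphi_{[\kappa+1]},\dots,\mathrm{d}\varphi_{[R-1]}$ are linearly independent.
   Context: Setting. $\mathcal X$ is an $n$-dimensional smooth manifold with local coordinates $x=(x^1,\dots,x^n)$, and $\dot x=f(x,u)$ is a smooth control system with $m$ inputs $u=(u^1,\dots,u^m)$. On the manifold $\mathcal X\times\mathcal U_{[0,l_u]}$ with coordinates $(x,u,u_{[1]},\dots,u_{[l_u]})$, where $u_{[\alpha]}$ denotes the $\alpha$-th time derivative of $u$ and $l_u$ is a sufficiently large finite integer, consider the vector field $$f_u=\sum_{i=1}^n f^i(x,u)\,\partial_{x^i}+\sum_{j=1}^m\sum_{\alpha=0}^{l_u-1}u^j_{[\alpha+1]}\,\partial_{u^j_{[\alpha]}}.$$ The Lie derivative $\mathrm L_{f_u}h$ is the time derivative of a function $h$ along trajectories, and $h_{[\alpha]}=\mathrm L_{f_u}^\alpha h$. All results are generically local (they hold locally on open dense subsets), and all Jacobian matrices and codistributions considered are assumed to have locally constant rank. Linear independence of differentials is over smooth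 functions. Multi-index notation. A multi-index $A=(a^1,\dots,a^m)$ consists of nonnegative integers; $|A|=\sum_j a^j$; addition, subtraction, and $A\le B$ are meant componentwise, and $A\pm c$ for an integer $c$ adds/subtracts $c$ in every component; $h_{[A]}=(h^1_{[a^1]},\dots,h^m_{[a^m]})$; $h_{[0,B]}$ is the collection of all $h^j_{[\beta]}$ with $0\le\beta\le b^j$. The list $\mathrm{d}\varphi_{[\kappa]},\mathrm{d}\varphi_{[\kappa+1]},\dots,\mathrm{d}\varphi_{[R-1]}$ means all $\mathrm{d}\varphi^j_{[\beta]}$ with $\kappa^j\le\beta\le r^j-1$, $j=1,\dots,m$. Flatness. An $m$-tuple of smooth functions $y^j=\varphi^j(x,u)$, $j=1,\dots,m$, is an $(x,u)$-flat output if there are smooth functions $F_x,F_u$ and a multi-index $R=(r^1,\dots,r^m)$ such that locally $x=F_x(\varphi_{[0,R-1]})$ and $u=F_u(\varphi_{[0,R]})$. There is a unique minimal such multi-index, and $R$ always denotes this minimal one. The procedure. Put $\varphi_{\mathrm{rest}_0}=\varphi$, $u_{\mathrm{rest}_0}=u$. At the beginning of step $i\ge1$ one has local coordinates consisting of $x$, of $v_1,v_{1,[1]},\dots,v_{i-1},v_{i-1,[1]},\dots$, and of $u_{\mathrm{rest}_{i-1}}$ and its time derivatives, where $u_{\mathrm{rest}_{i-1}}$ and $\varphi_{\mathrm{rest}_{i-1}}$ both have $m-m_1-\dots-m_{i-1}$ components; all functions are expressed in these coordinates. Step $i$: (1) For each component $\varphi^j_{\mathrm{rest}_{i-1}}$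 let $k_i^j\ge0$ be the smallest integer such that $\mathrm L_{f_u}^{k_i^j}\varphi^j_{\mathrm{rest}_{i-1}}$ depends explicitly on (at least one component of) $u_{\mathrm{rest}_{i-1}}$; thus $\mathrm L_{f_u}^{k}\varphi^j_{\mathrm{rest}_{i-1}}$ for $k<k_i^j$ depends only on $x$ and $v_1,v_{1,[1]},\dots,v_{i-1},v_{i-1,[1]},\dots$. Let $K_i$ be the multi-index with entries $k_i^j$. (2) Let $m_i=\operatorname{rank}\bigl(\partial_{u_{\mathrm{rest}_{i-1}}}\varphi_{\mathrm{rest}_{i-1},[K_i]}\bigr)$. (3) Reorder the components of $\varphi_{\mathrm{rest}_{i-1}}$ so that, with $\varphi_i$ denoting its first $m_i$ components and $\kappa_i=(k_i^1,\dots,k_i^{m_i})$ the corresponding entries of $K_i$, one has $\operatorname{rank}\bigl(\partial_{u_{\mathrm{rest}_{i-1}}}\varphi_{i,[\kappa_i]}\bigr)=m_i$. Let $\varphi_{\mathrm{rest}_i}$ be the remaining components. (4) After possibly renumbering the components of $u_{\mathrm{rest}_{i-1}}$, replace its first $m_i$ components and their time derivatives by the new coordinates $v_i=\varphi_{i,[\kappa_i]}$ and $v_{i,[\alpha]}=\varphi_{i,[\kappa_i+\alpha]}$, $\alpha\ge1$; the remaining components form $u_{\mathrm{rest}_i}$. The procedure terminates in the step $i=:s$ in which the (square) matrix $\partial_{u_{\mathrm{rest}_{s-1}}}\varphi_{\mathrm{rest}_{s-1},[K_s]}$ has full rank, so that $m_1+\dots+m_s=m$, $\varphi_s=\varphi_{\mathrm{rest}_{s-1}}$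 and $\kappa_s=K_s$. The components of the flat output (and correspondingly the entries of $R$) are ordered as $\varphi=(\varphi_1,\dots,\varphi_s)$, matching $\kappa=(\kappa_1,\dots,\kappa_s)$. *)

theory Defs
  imports "HOL-Analysis.Analysis"
begin

section \<open>Smooth functions of coordinates\<close>

text \<open>
  A point is a family of real coordinates indexed by a type \<open>'c\<close>, possibly infinite, with the
  product topology. Smooth functions depend, locally, on finitely many coordinates only,
  and have continuous iterated partial derivatives of all orders.
\<close>

definition partial :: "'c \<Rightarrow> (('c \<Rightarrow> real) \<Rightarrow> real) \<Rightarrow> ('c \<Rightarrow> real) \<Rightarrow> real" where
  "partial c h p = deriv (\<lambda>t. h (p(c := t))) (p c)"

definition depends_only :: "'c set \<Rightarrow> ('c \<Rightarrow> real) set \<Rightarrow> (('c \<Rightarrow> real) \<Rightarrow> 'b) \<Rightarrow> bool" where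
  "depends_only S W h \<longleftrightarrow> (\<forall>p\<in>W. \<forall>q\<in>W. (\<forall>c\<in>S. p c = q c) \<longrightarrow> h p = h q)"

definition smooth_on :: "('c \<Rightarrow> real) set \<Rightarrow> (('c \<Rightarrow> real) \<Rightarrow> real) \<Rightarrow> bool" where
  "smooth_on W h \<longleftrightarrow>
     (\<forall>p\<in>W. \<exists>V S. open V \<and> p \<in> V \<and> V \<subseteq> W \<and> finite S \<and> depends_only S V h) \<and>
     (\<forall>cs. continuous_on W (foldr partial cs h) \<and>
           (\<forall>c. \<forall>p\<in>W. (\<lambda>t. foldr partial cs h (p(c := t))) differentiable (at (p c))))"

definition coord_chart :: "('c \<Rightarrow> real) set \<Rightarrow> (('c \<Rightarrow> real) \<Rightarrow> ('c \<Rightarrow> real)) \<Rightarrow> bool" where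
  "coord_chart W \<Psi> \<longleftrightarrow> open W \<and> inj_on \<Psi> W \<and> open (\<Psi> ` W) \<and>
     (\<forall>c. smooth_on W (\<lambda>p. \<Psi> p c)) \<and> (\<forall>c. smooth_on (\<Psi> ` W) (\<lambda>z. inv_into W \<Psi> z c))"

text \<open>
  Linear independence over smooth functions of a finite family of one-forms
  \<open>\<omega> i = (\<Sum>c. \<omega> i p c * dc)\<close> on \<open>W\<close>; coefficients defined on an
  open subset of \<open>W\<close> are allowed too, so that a relation holding on a part of \<open>W\<close> is excluded.
\<close>

definition differential :: "(('c \<Rightarrow> real) \<Rightarrow> real) \<Rightarrow> ('c \<Rightarrow> real) \<Rightarrow> 'c \<Rightarrow> real" where
  "differential h p = (\<lambda>c. partial c h p)"

definition forms_independent ::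
  "('c \<Rightarrow> real) set \<Rightarrow> 'i set \<Rightarrow> ('i \<Rightarrow> ('c \<Rightarrow> real) \<Rightarrow> 'c \<Rightarrow> real) \<Rightarrow> bool" where
  "forms_independent W I \<omega> \<longleftrightarrow> finite I \<and>
     (\<forall>V a. open V \<and> V \<subseteq> W \<and> (\<forall>i\<in>I. smooth_on V (a i)) \<and>
            (\<forall>p\<in>V. \<forall>c. (\<Sum>i\<in>I. a i p * \<omega> i p c) = 0)
        \<longrightarrow> (\<forall>i\<in>I. \<forall>p\<in>V. a i p = 0))"


section \<open>The control system and its Lie derivative\<close>

text \<open>
  Coordinate \<open>Inl i\<close> is the state component \<open>x\<^sup>i\<close>; coordinate \<open>Inr (j, \<alpha>)\<close> is the
  \<open>\<alpha>\<close>-th time derivative of the input component \<open>u\<^sup>j\<close>. All orders \<open>\<alpha>\<close> are present, and a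
  function on the manifold truncated at order \<open>l\<close> is one that ignores the orders above \<open>l\<close>.
\<close>

type_synonym ('n, 'm) jet = "'n + 'm \<times> nat \<Rightarrow> real"

definition state :: "('n::finite, 'm::finite) jet \<Rightarrow> real ^ 'n" where
  "state p = (\<chi> i. p (Inl i))"

definition input :: "('n::finite, 'm::finite) jet \<Rightarrow> real ^ 'm" where
  "input p = (\<chi> j. p (Inr (j, 0)))"

definition jets_over ::
  "(real ^ 'n) set \<Rightarrow> (real ^ 'm) set \<Rightarrow> ('n::finite, 'm::finite) jet set" where
  "jets_over X U = {p. state p \<in> X \<and> input p \<in> U}"

definition smooth_xu ::
  "(real ^ 'n::finite) set \<Rightarrow> (real ^ 'm::finite) set \<Rightarrow> (real ^ 'n \<Rightarrow> real ^ 'm \<Rightarrow> real ^ 'k) \<Rightarrow> bool" where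
  "smooth_xu X U g \<longleftrightarrow> (\<forall>k. smooth_on (jets_over X U) (\<lambda>p. g (state p) (input p) $ k))"

definition lie_upto ::
  "(real ^ 'n \<Rightarrow> real ^ 'm \<Rightarrow> real ^ 'n) \<Rightarrow> nat \<Rightarrow>
   (('n::finite, 'm::finite) jet \<Rightarrow> real) \<Rightarrow> ('n, 'm) jet \<Rightarrow> real" where
  "lie_upto f l h p =
     (\<Sum>i\<in>UNIV. f (state p) (input p) $ i * partial (Inl i) h p) +
     (\<Sum>j\<in>UNIV. \<Sum>\<alpha><l. p (Inr (j, Suc \<alpha>)) * partial (Inr (j, \<alpha>)) h p)"

text \<open>
  The field \<open>f\<^sub>u\<close> with \<open>l\<^sub>u = l\<close> acts by \<open>lie_upto f l\<close>. On a function of finite order its value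
  is the same for all sufficiently large \<open>l\<close>, and that value is taken here
  (\<open>lie_eq_lie_upto\<close> and \<open>output_deriv_eq_lie_upto\<close> below).
\<close>

definition lie ::
  "(real ^ 'n \<Rightarrow> real ^ 'm \<Rightarrow> real ^ 'n) \<Rightarrow>
   (('n::finite, 'm::finite) jet \<Rightarrow> real) \<Rightarrow> ('n, 'm) jet \<Rightarrow> real" where
  "lie f h p = lim (\<lambda>l. lie_upto f l h p)"

definition output_deriv ::
  "(real ^ 'n \<Rightarrow> real ^ 'm \<Rightarrow> real ^ 'n) \<Rightarrow> (real ^ 'n \<Rightarrow> real ^ 'm \<Rightarrow> real ^ 'm) \<Rightarrow>
   'm \<Rightarrow> nat \<Rightarrow> ('n::finite, 'm::finite) jet \<Rightarrow> real" where
  "output_deriv f \<phi> j \<beta> = (lie f ^^ \<beta>) (\<lambda>p. \<phi> (state p) (input p) $ j)"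

definition upto_order :: "nat \<Rightarrow> ('n + 'm \<times> nat) set" where
  "upto_order k = range Inl \<union> {Inr (j, \<alpha>) | j \<alpha>. \<alpha> \<le> k}"

lemma partial_eq_0:
  assumes "depends_only S UNIV h" "c \<notin> S"
  shows "partial c h p = 0"
proof -
  have "(\<lambda>t. h (p(c := t))) = (\<lambda>t. h p)"
    using assms unfolding depends_only_def by (metis UNIV_I fun_upd_other)
  then show ?thesis by (simp add: partial_def)
qed

lemma lie_eq_lie_upto:
  assumes "depends_only (upto_order k) UNIV h" "k < l"
  shows "lie f h p = lie_upto f l h p"
proof -
  have 0: "partial (Inr (j, \<alpha>)) h p = 0" if "k < \<alpha>" for j \<alpha>
    by (rule partial_eq_0[OF assms(1)]) (use that in \<open>auto simp: upto_order_def\<close>)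
  have *: "lie_upto f l' h p = lie_upto f (Suc k) h p" if "k < l'" for l'
  proof -
    have "(\<Sum>\<alpha><l'. p (Inr (j, Suc \<alpha>)) * partial (Inr (j, \<alpha>)) h p) =
          (\<Sum>\<alpha><Suc k. p (Inr (j, Suc \<alpha>)) * partial (Inr (j, \<alpha>)) h p)" for j
    proof (rule sum.mono_neutral_right)
      show "{..<Suc k} \<subseteq> {..<l'}" using that by auto
      show "\<forall>\<alpha>\<in>{..<l'} - {..<Suc k}. p (Inr (j, Suc \<alpha>)) * partial (Inr (j, \<alpha>)) h p = 0"
        using 0 by auto
    qed simp
    then show ?thesis unfolding lie_upto_def by presburger
  qed
  have "eventually (\<lambda>l. lie_upto f l h p = lie_upto f (Suc k) h p) sequentially"
    using eventually_gt_at_top[of k] by (rule eventually_mono) (rule *)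
  then have "(\<lambda>l. lie_upto f l h p) \<longlonglongrightarrow> lie_upto f (Suc k) h p"
    by (rule tendsto_eventually)
  then have "lie f h p = lie_upto f (Suc k) h p" unfolding lie_def by (rule limI)
  then show ?thesis using *[OF assms(2)] by simp
qed

lemma depends_only_lie_upto:
  fixes h :: "('n::finite, 'm::finite) jet \<Rightarrow> real"
  assumes "depends_only (upto_order k) UNIV h"
  shows "depends_only (upto_order (Suc k)) UNIV (lie_upto f l h)"
  unfolding depends_only_def
proof (intro ballI impI)
  fix p q :: "('n, 'm) jet"
  assume "\<forall>c\<in>upto_order (Suc k). p c = q c"
  then have x: "p (Inl i) = q (Inl i)" and u: "\<alpha> \<le> Suc k \<Longrightarrow> p (Inr (j, \<alpha>)) = q (Inr (j, \<alpha>))" for i j \<alpha>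
    by (auto simp: upto_order_def)
  have pq: "p c = q c" if "c \<in> upto_order k" for c
    using that x u by (auto simp: upto_order_def)
  then have "\<forall>c'\<in>upto_order k. (p(c := t)) c' = (q(c := t)) c'" for c t by simp
  then have "h (p(c := t)) = h (q(c := t))" for c t
    using assms unfolding depends_only_def by blast
  then have d: "partial c h p = partial c h q" if "c \<in> upto_order k" for c
    using pq[OF that] by (simp add: partial_def)
  have "p (Inr (j, Suc \<alpha>)) * partial (Inr (j, \<alpha>)) h p = q (Inr (j, Suc \<alpha>)) * partial (Inr (j, \<alpha>)) h q" for j \<alpha>
  proof (cases "\<alpha> \<le> k")
    case True
    then show ?thesis using u[of "Suc \<alpha>" j] d[of "Inr (j, \<alpha>)"] by (simp add: upto_order_def)
  next
    case False
    then have "partial (Inr (j, \<alpha>)) h r = 0" for r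
      by (intro partial_eq_0[OF assms]) (auto simp: upto_order_def)
    then show ?thesis by simp
  qed
  moreover have "state p = state q" "input p = input q"
    using x u by (auto simp: state_def input_def)
  moreover have "partial (Inl i) h p = partial (Inl i) h q" for i
    by (rule d) (simp add: upto_order_def)
  ultimately show "lie_upto f l h p = lie_upto f l h q"
    by (simp add: lie_upto_def)
qed

lemma output_deriv_eq_lie_upto:
  assumes "\<beta> \<le> l"
  shows "output_deriv f \<phi> j \<beta> = (lie_upto f l ^^ \<beta>) (\<lambda>p. \<phi> (state p) (input p) $ j)"
proof -
  let ?h = "\<lambda>p. \<phi> (state p) (input p) $ j"
  have "\<beta> \<le> l \<Longrightarrow> (lie f ^^ \<beta>) ?h = (lie_upto f l ^^ \<beta>) ?h \<and>
        depends_only (upto_order \<beta>) UNIV ((lie_upto f l ^^ \<beta>) ?h)"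
  proof (induction \<beta>)
    case 0
    have "state p = state q \<and> input p = input q" if "\<forall>c\<in>upto_order 0. p c = q c"
      for p q :: "('a, 'b) jet"
      using that by (auto simp: state_def input_def upto_order_def)
    then have "depends_only (upto_order 0) UNIV ?h"
      unfolding depends_only_def by metis
    then show ?case by simp
  next
    case (Suc \<beta>)
    then show ?case
      using depends_only_lie_upto by (auto intro!: lie_eq_lie_upto)
  qed
  with assms show ?thesis by (simp add: output_deriv_def)
qed


section \<open>Flat outputs\<close>

text \<open>
  Multi-indices are functions \<open>'m \<Rightarrow> nat\<close> with the pointwise order. The arguments of \<open>F\<^sub>x\<close> and
  \<open>F\<^sub>u\<close> are written as families indexed by pairs \<open>(j, \<beta>)\<close>, of which only the components
  belonging to \<open>\<phi>\<^bsub>[0,R-1]\<^esub>\<close> and \<open>\<phi>\<^bsub>[0,R]\<^esub>\<close>, respectively, matter.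
\<close>

definition flat_index ::
  "(real ^ 'n \<Rightarrow> real ^ 'm \<Rightarrow> real ^ 'n) \<Rightarrow> (real ^ 'n \<Rightarrow> real ^ 'm \<Rightarrow> real ^ 'm) \<Rightarrow>
   ('n::finite, 'm::finite) jet set \<Rightarrow> ('m \<Rightarrow> nat) \<Rightarrow> bool" where
  "flat_index f \<phi> W R \<longleftrightarrow>
     (\<forall>p\<^sub>0\<in>W. \<exists>V Y (Fx :: ('m \<times> nat \<Rightarrow> real) \<Rightarrow> real ^ 'n) (Fu :: ('m \<times> nat \<Rightarrow> real) \<Rightarrow> real ^ 'm).
        open V \<and> p\<^sub>0 \<in> V \<and> V \<subseteq> W \<and> open Y \<and>
        (\<forall>p\<in>V. (\<lambda>(j, \<beta>). output_deriv f \<phi> j \<beta> p) \<in> Y) \<and>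
        (\<forall>i. smooth_on Y (\<lambda>y. Fx y $ i)) \<and> depends_only {(j, \<beta>). \<beta> < R j} Y Fx \<and>
        (\<forall>i. smooth_on Y (\<lambda>y. Fu y $ i)) \<and> depends_only {(j, \<beta>). \<beta> \<le> R j} Y Fu \<and>
        (\<forall>p\<in>V. state p = Fx (\<lambda>(j, \<beta>). output_deriv f \<phi> j \<beta> p) \<and>
               input p = Fu (\<lambda>(j, \<beta>). output_deriv f \<phi> j \<beta> p)))"

definition flat_output ::
  "(real ^ 'n \<Rightarrow> real ^ 'm \<Rightarrow> real ^ 'n) \<Rightarrow> (real ^ 'n \<Rightarrow> real ^ 'm \<Rightarrow> real ^ 'm) \<Rightarrow>
   ('n::finite, 'm::finite) jet set \<Rightarrow> ('m \<Rightarrow> nat) \<Rightarrow> bool" where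
  "flat_output f \<phi> W R \<longleftrightarrow>
     flat_index f \<phi> W R \<and> (\<forall>R'. flat_index f \<phi> W R' \<and> R' \<le> R \<longrightarrow> R' = R)"


section \<open>The input-replacement procedure\<close>

text \<open>
  Replaced input coordinates are recorded in \<open>\<tau> :: 'm \<Rightarrow> ('m \<times> nat) option\<close>. The value
  \<open>\<tau> j = Some (c, k)\<close> says that \<open>u\<^sup>j\<close> and its time derivatives have been replaced by
  \<open>\<phi>\<^sup>c\<^bsub>[k]\<^esub>, \<phi>\<^sup>c\<^bsub>[k+1]\<^esub>, \<dots>\<close>, while \<open>\<tau> j = None\<close> says that \<open>u\<^sup>j\<close> belongs to \<open>u\<^bsub>rest\<^esub>\<close>. Components
  are never renumbered; \<open>u\<^bsub>rest\<^esub>\<close>, \<open>\<phi>\<^bsub>rest\<^esub>\<close> and \<open>\<phi>\<^sub>i\<close> are given by sets of indices.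
\<close>

definition rest_inputs :: "('m \<Rightarrow> ('m \<times> nat) option) \<Rightarrow> 'm set" where
  "rest_inputs \<tau> = - dom \<tau>"

definition rest_outputs :: "('m \<Rightarrow> ('m \<times> nat) option) \<Rightarrow> 'm set" where
  "rest_outputs \<tau> = - fst ` ran \<tau>"

definition step_coords ::
  "(real ^ 'n \<Rightarrow> real ^ 'm \<Rightarrow> real ^ 'n) \<Rightarrow> (real ^ 'n \<Rightarrow> real ^ 'm \<Rightarrow> real ^ 'm) \<Rightarrow>
   ('m \<Rightarrow> ('m \<times> nat) option) \<Rightarrow> ('n::finite, 'm::finite) jet \<Rightarrow> ('n, 'm) jet" where
  "step_coords f \<phi> \<tau> p = (\<lambda>z. case z of
      Inl i \<Rightarrow> p (Inl i)
    | Inr (j, \<alpha>) \<Rightarrow> (case \<tau> j of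
        None \<Rightarrow> p (Inr (j, \<alpha>))
      | Some (c, k) \<Rightarrow> output_deriv f \<phi> c (k + \<alpha>) p))"

text \<open>
  \<open>\<partial>g/\<partial>u\<^sup>j\<close> at \<open>p\<close>, for \<open>g\<close> expressed in the coordinates \<open>step_coords f \<phi> \<tau>\<close> on \<open>W\<close>.
\<close>

definition input_partial ::
  "(real ^ 'n \<Rightarrow> real ^ 'm \<Rightarrow> real ^ 'n) \<Rightarrow> (real ^ 'n \<Rightarrow> real ^ 'm \<Rightarrow> real ^ 'm) \<Rightarrow>
   ('n::finite, 'm::finite) jet set \<Rightarrow> ('m \<Rightarrow> ('m \<times> nat) option) \<Rightarrow>
   (('n, 'm) jet \<Rightarrow> real) \<Rightarrow> 'm \<Rightarrow> ('n, 'm) jet \<Rightarrow> real" where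
  "input_partial f \<phi> W \<tau> g j p =
     partial (Inr (j, 0)) (g \<circ> inv_into W (step_coords f \<phi> \<tau>)) (step_coords f \<phi> \<tau> p)"

definition depends_on_rest_inputs ::
  "(real ^ 'n \<Rightarrow> real ^ 'm \<Rightarrow> real ^ 'n) \<Rightarrow> (real ^ 'n \<Rightarrow> real ^ 'm \<Rightarrow> real ^ 'm) \<Rightarrow>
   ('n::finite, 'm::finite) jet set \<Rightarrow> ('m \<Rightarrow> ('m \<times> nat) option) \<Rightarrow>
   (('n, 'm) jet \<Rightarrow> real) \<Rightarrow> bool" where
  "depends_on_rest_inputs f \<phi> W \<tau> g \<longleftrightarrow>
     (\<exists>j\<in>rest_inputs \<tau>. \<exists>p\<in>W. input_partial f \<phi> W \<tau> g j p \<noteq> 0)"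

text \<open>
  The matrix with rows \<open>c \<in> C\<close> and columns \<open>j \<in> rest_inputs \<tau>\<close>, padded with zeros to size
  \<open>'m \<times> 'm\<close>, which does not affect its rank.
\<close>

definition rest_jacobian ::
  "(real ^ 'n \<Rightarrow> real ^ 'm \<Rightarrow> real ^ 'n) \<Rightarrow> (real ^ 'n \<Rightarrow> real ^ 'm \<Rightarrow> real ^ 'm) \<Rightarrow>
   ('n::finite, 'm::finite) jet set \<Rightarrow> ('m \<Rightarrow> ('m \<times> nat) option) \<Rightarrow>
   ('m \<Rightarrow> nat) \<Rightarrow> 'm set \<Rightarrow> ('n, 'm) jet \<Rightarrow> real ^ 'm ^ 'm" where
  "rest_jacobian f \<phi> W \<tau> K C p =
     (\<chi> c j. if c \<in> C \<and> j \<in> rest_inputs \<tau>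
             then input_partial f \<phi> W \<tau> (output_deriv f \<phi> c (K c)) j p else 0)"

text \<open>
  One step on \<open>W\<close>: from \<open>\<tau>\<close> to \<open>\<tau>'\<close>, with the multi-index \<open>K\<close>, the rank \<open>m\<close> and the chosen
  components \<open>C\<close>. The ranks are constant on \<open>W\<close>, and the new functions are coordinates on \<open>W\<close>;
  \<open>\<sigma>\<close> tells which component of \<open>u\<^bsub>rest\<^esub>\<close> is replaced by which component of \<open>\<phi>\<^bsub>[K]\<^esub>\<close>.
\<close>

definition procedure_step ::
  "(real ^ 'n \<Rightarrow> real ^ 'm \<Rightarrow> real ^ 'n) \<Rightarrow> (real ^ 'n \<Rightarrow> real ^ 'm \<Rightarrow> real ^ 'm) \<Rightarrow>
   ('n::finite, 'm::finite) jet set \<Rightarrow> ('m \<Rightarrow> ('m \<times> nat) option) \<Rightarrow>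
   ('m \<Rightarrow> nat) \<Rightarrow> nat \<Rightarrow> 'm set \<Rightarrow> ('m \<Rightarrow> ('m \<times> nat) option) \<Rightarrow> bool" where
  "procedure_step f \<phi> W \<tau> K m C \<tau>' \<longleftrightarrow>
     (\<forall>c\<in>rest_outputs \<tau>.
        depends_on_rest_inputs f \<phi> W \<tau> (output_deriv f \<phi> c (K c)) \<and>
        (\<forall>k<K c. \<not> depends_on_rest_inputs f \<phi> W \<tau> (output_deriv f \<phi> c k))) \<and>
     (\<forall>p\<in>W. rank (rest_jacobian f \<phi> W \<tau> K (rest_outputs \<tau>) p) = m) \<and>
     C \<subseteq> rest_outputs \<tau> \<and> card C = m \<and>
     (\<forall>p\<in>W. rank (rest_jacobian f \<phi> W \<tau> K C p) = m) \<and>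
     (\<exists>B \<sigma>. B \<subseteq> rest_inputs \<tau> \<and> bij_betw \<sigma> B C \<and>
        \<tau>' = (\<lambda>j. if j \<in> B then Some (\<sigma> j, K (\<sigma> j)) else \<tau> j)) \<and>
     coord_chart W (step_coords f \<phi> \<tau>')"

text \<open>
  A complete run of \<open>s\<close> steps on \<open>W\<close>. The \<open>i\<close>-th step leads from \<open>\<tau> (i - 1)\<close> to \<open>\<tau> i\<close>, and
  step \<open>s\<close> is the one in which the square Jacobian matrix has full rank.
\<close>

definition procedure_run ::
  "(real ^ 'n \<Rightarrow> real ^ 'm \<Rightarrow> real ^ 'n) \<Rightarrow> (real ^ 'n \<Rightarrow> real ^ 'm \<Rightarrow> real ^ 'm) \<Rightarrow>
   ('n::finite, 'm::finite) jet set \<Rightarrow> nat \<Rightarrow> (nat \<Rightarrow> 'm \<Rightarrow> ('m \<times> nat) option) \<Rightarrow>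
   (nat \<Rightarrow> 'm \<Rightarrow> nat) \<Rightarrow> (nat \<Rightarrow> nat) \<Rightarrow> (nat \<Rightarrow> 'm set) \<Rightarrow> bool" where
  "procedure_run f \<phi> W s \<tau> K m C \<longleftrightarrow>
     1 \<le> s \<and> \<tau> 0 = (\<lambda>_. None) \<and>
     (\<forall>i\<in>{1..s}. procedure_step f \<phi> W (\<tau> (i - 1)) (K i) (m i) (C i) (\<tau> i)) \<and>
     (\<forall>i\<in>{1..s}. m i = card (rest_outputs (\<tau> (i - 1))) \<longleftrightarrow> i = s)"

end

theory Submission
  imports Defs
begin

text \<open>
  After the last step all inputs have been replaced, and \<open>x\<close> together with all
  \<open>\<phi>\<^sup>c\<^bsub>[\<beta>]\<^esub>\<close>, \<open>\<beta> \<ge> \<kappa>\<^sup>c\<close>, form a coordinate system.  Everything follows from comparing it with the family of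
  all \<open>\<phi>\<^sup>c\<^bsub>[\<beta>]\<^esub>\<close>, \<open>\<beta> \<ge> 0\<close>.

  The differentials \<open>d x, d \<phi>\<^bsub>[\<kappa>]\<^esub>, d \<phi>\<^bsub>[\<kappa>+1]\<^esub>, \<dots>\<close> are independent because they belong to the coframe of a
  chart (\<open>differentials_independent\<close>).  For \<open>\<bar>\<kappa>\<bar> = n\<close>, consider the \<open>\<bar>\<kappa>\<bar> \<times> n\<close> matrix that expresses the
  \<open>d \<phi>\<^sup>c\<^bsub>[\<beta>]\<^esub>\<close> with \<open>\<beta> < \<kappa>\<^sup>c\<close> by \<open>d x\<close>, modulo the \<open>d \<phi>\<^sup>c\<^bsub>[\<beta>]\<^esub>\<close> with \<open>\<beta> \<ge> \<kappa>\<^sup>c\<close>.  Since \<open>x = F\<^sub>x(\<phi>\<^bsub>[0,R-1]\<^esub>)\<close>, its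
  rows span \<open>\<real>\<^sup>n\<close>, whence \<open>n \<le> \<bar>\<kappa>\<bar>\<close> (\<open>CARD_le_sum_\<kappa>\<close>).  If \<open>\<bar>\<kappa>\<bar>\<close> were larger, the rows would be
  dependent, and there would be a nontrivial relation with smooth coefficients between differentials of outputs on an open
  set.  Differentiating it along \<open>f\<^sub>u\<close> again and again gives relations of unbounded order.
  But the coefficients at \<open>d \<phi>\<^bsub>[\<beta>]\<^esub>\<close>, \<open>\<beta> \<ge> \<kappa>\<close>, of a relation are determined by the others through the expansions of
  finitely many differentials in the final chart, so their order is bounded
  (\<open>sum_\<kappa>_le_CARD\<close>).  In particular the square matrix is invertible.

  For \<open>\<kappa> \<le> R\<close>, the point is that an output derivative \<open>\<phi>\<^sup>c\<^bsub>[\<beta>]\<^esub>\<close> with \<open>\<beta> < \<kappa>\<^sup>c\<close> depends, in the coordinates of the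
  step in which \<open>c\<close> is chosen, only on \<open>x\<close> and the \<open>v\<close> of earlier steps (\<open>output_before_K\<close>).
  The definition of the procedure says this for \<open>u\<^bsub>rest\<^esub>\<close> but not for its time derivatives;
  that these do not occur either is an invariant of the procedure
  (\<open>inputs_undifferentiated\<close>), proved from the fact that the old and the new functions are both
  coordinates.  If now \<open>r\<^sup>c < \<kappa>\<^sup>c\<close>, then \<open>d \<phi>\<^sup>c\<^bsub>[r\<^sup>c]\<^esub>\<close> is, modulo the final \<open>d v\<close>, a combination of \<open>d x\<close>, hence of rows
  other than its own, and the matrix is singular: a contradiction (\<open>\<kappa>_le_R\<close>).

  Both the expansions and the differentiation of relations need calculus for functions of infinitely many
  coordinates that depend locally on finitely many of them: the chain rule, stability of
  smoothness under composition, and symmetry of second derivatives.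
\<close>

section \<open>Smooth functions on product spaces\<close>

lemma open_contains_box:
  fixes O' :: "('c \<Rightarrow> real) set"
  assumes "open O'" "p \<in> O'"
  shows "\<exists>T e. finite T \<and> e > 0 \<and> (\<forall>q. (\<forall>b\<in>T. \<bar>q b - p b\<bar> < e) \<longrightarrow> q \<in> O')"
proof -
  have "openin (product_topology (\<lambda>_. euclidean) UNIV) O'"
    using assms(1) by (simp add: euclidean_product_topology)
  from product_topology_open_contains_basis[OF this assms(2)]
  obtain X where X: "p \<in> (\<Pi>\<^sub>E i\<in>UNIV. X i)" "\<And>i. open (X i)" "finite {i. X i \<noteq> UNIV}"
      "(\<Pi>\<^sub>E i\<in>UNIV. X i) \<subseteq> O'"
    by (auto simp: open_openin[symmetric])
  have pX: "p i \<in> X i" for i using X(1) by auto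
  have "\<exists>e>0. \<forall>x. \<bar>x - p i\<bar> < e \<longrightarrow> x \<in> X i" for i
    using X(2)[of i] pX[of i] unfolding open_dist dist_real_def by blast
  then obtain e where e: "\<And>i. e i > 0" "\<And>i x. \<bar>x - p i\<bar> < e i \<Longrightarrow> x \<in> X i" by metis
  let ?T = "{i. X i \<noteq> UNIV}"
  show ?thesis
  proof (intro exI[of _ ?T] exI[of _ "Min (insert 1 (e ` ?T))"] conjI allI impI)
    show "0 < Min (insert 1 (e ` ?T))" using X(3) e(1) by (subst Min_gr_iff) auto
    fix q assume q: "\<forall>b\<in>?T. \<bar>q b - p b\<bar> < Min (insert 1 (e ` ?T))"
    have "q i \<in> X i" for i
    proof (cases "i \<in> ?T")
      case True
      then have "\<bar>q i - p i\<bar> < e i" using bspec[OF q True] X(3) by (subst (asm) Min_gr_iff) auto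
      then show ?thesis by (rule e(2))
    qed auto
    then show "q \<in> O'" using X(4) by (auto simp: PiE_iff)
  qed (use X in auto)
qed

lemma tendsto_coordinatewise:
  fixes \<gamma> :: "'a \<Rightarrow> 'c \<Rightarrow> real"
  assumes "\<And>c. ((\<lambda>t. \<gamma> t c) \<longlongrightarrow> p c) F"
  shows "(\<gamma> \<longlongrightarrow> p) F"
proof (rule topological_tendstoI)
  fix O' assume "open O'" "p \<in> O'"
  then obtain T e where T: "finite T" "e > 0" "\<forall>q. (\<forall>b\<in>T. \<bar>q b - p b\<bar> < e) \<longrightarrow> q \<in> O'"
    using open_contains_box[of O' p] by metis
  have "\<forall>\<^sub>F t in F. \<forall>b\<in>T. \<bar>\<gamma> t b - p b\<bar> < e"
    using tendstoD[OF assms T(2)] T(1) by (intro eventually_ball_finite) (auto simp: dist_real_def)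
  then show "\<forall>\<^sub>F t in F. \<gamma> t \<in> O'" by (rule eventually_mono) (rule T(3)[THEN spec, THEN mp])
qed

lemma tendsto_fun_upd:
  fixes p :: "'c \<Rightarrow> real"
  shows "((\<lambda>t. p(c := t)) \<longlongrightarrow> p(c := s)) (nhds s)"
proof (rule tendsto_coordinatewise)
  fix b show "((\<lambda>t. (p(c := t)) b) \<longlongrightarrow> (p(c := s)) b) (nhds s)"
    by (cases "b = c") (simp_all add: filterlim_ident)
qed

lemma eventually_fun_upd_in:
  fixes p :: "'c \<Rightarrow> real"
  assumes "open W" "p(c := s) \<in> W"
  shows "\<forall>\<^sub>F t in nhds s. p(c := t) \<in> W"
  using topological_tendstoD[OF tendsto_fun_upd assms] .

lemma eventually_eq_fun_upd:
  fixes g h :: "('c \<Rightarrow> real) \<Rightarrow> 'b"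
  assumes "open W" "p \<in> W" "\<And>q. q \<in> W \<Longrightarrow> g q = h q"
  shows "\<forall>\<^sub>F t in nhds (p c). g (p(c := t)) = h (p(c := t))"
  using assms by (intro eventually_mono[OF eventually_fun_upd_in[OF assms(1), of p c "p c"]]) auto

lemma has_derivative_transfer_coord:
  fixes g h :: "('c \<Rightarrow> real) \<Rightarrow> real"
  assumes "open W" "p \<in> W" "\<And>q. q \<in> W \<Longrightarrow> g q = h q"
    and "((\<lambda>t. g (p(c := t))) has_real_derivative d) (at (p c))"
  shows "((\<lambda>t. h (p(c := t))) has_real_derivative d) (at (p c))"
proof -
  have "\<forall>\<^sub>F t in nhds (p c). g (p(c := t)) = h (p(c := t))"
    by (rule eventually_eq_fun_upd[OF assms(1-3)])
  from DERIV_cong_ev[OF refl this refl] assms(4) show ?thesis by simp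
qed

lemma partial_cong:
  fixes g h :: "('c \<Rightarrow> real) \<Rightarrow> real"
  assumes "open W" "p \<in> W" "\<And>q. q \<in> W \<Longrightarrow> g q = h q"
  shows "partial c g p = partial c h p"
  unfolding partial_def by (rule deriv_cong_ev[OF eventually_eq_fun_upd[OF assms] refl])

lemma depends_only_mono: "depends_only S V h \<Longrightarrow> S \<subseteq> T \<Longrightarrow> V' \<subseteq> V \<Longrightarrow> depends_only T V' h"
  unfolding depends_only_def by blast

lemma depends_only_binop:
  assumes "depends_only T1 V1 g" "depends_only T2 V2 k"
  shows "depends_only (T1 \<union> T2) (V1 \<inter> V2) (\<lambda>p. f (g p) (k p))"
  unfolding depends_only_def
proof (intro ballI impI)
  fix p q assume pq: "p \<in> V1 \<inter> V2" "q \<in> V1 \<inter> V2" "\<forall>c\<in>T1 \<union> T2. p c = q c"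
  then have "g p = g q" "k p = k q" using assms unfolding depends_only_def by auto
  then show "f (g p) (k p) = f (g q) (k q)" by simp
qed

lemma partial_eq_0_on:
  assumes "depends_only S W h" "open W" "p \<in> W" "c \<notin> S"
  shows "partial c h p = 0"
proof -
  have "\<forall>\<^sub>F t in nhds (p c). h (p(c := t)) = h p"
  proof (rule eventually_mono[OF eventually_fun_upd_in[OF assms(2), of p c "p c"]])
    show "p(c := p c) \<in> W" using assms(3) by simp
    fix t assume "p(c := t) \<in> W"
    moreover have "\<forall>b\<in>S. (p(c := t)) b = p b" using assms(4) by auto
    ultimately show "h (p(c := t)) = h p" using assms(1,3) unfolding depends_only_def by blast
  qed
  then have "partial c h p = deriv (\<lambda>t. h p) (p c)"
    unfolding partial_def by (rule deriv_cong_ev) simp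
  then show ?thesis by simp
qed

lemma depends_only_partial:
  fixes h :: "('c \<Rightarrow> real) \<Rightarrow> real"
  assumes "depends_only S W h" "open W"
  shows "depends_only S W (partial c h)"
  unfolding depends_only_def
proof (intro ballI impI)
  fix p q assume pq: "p \<in> W" "q \<in> W" "\<forall>c\<in>S. p c = q c"
  show "partial c h p = partial c h q"
  proof (cases "c \<in> S")
    case True
    then have "p c = q c" using pq by simp
    have "p(c := p c) \<in> W" "q(c := p c) \<in> W" using pq \<open>p c = q c\<close> by (metis fun_upd_triv)+
    then have "\<forall>\<^sub>F t in nhds (p c). p(c := t) \<in> W" "\<forall>\<^sub>F t in nhds (p c). q(c := t) \<in> W"
      using eventually_fun_upd_in[OF assms(2)] by blast+
    then have "\<forall>\<^sub>F t in nhds (p c). h (p(c := t)) = h (q(c := t))"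
    proof eventually_elim
      case (elim t)
      have "\<forall>b\<in>S. (p(c := t)) b = (q(c := t)) b" using pq(3) by simp
      then show ?case using elim assms(1) unfolding depends_only_def by blast
    qed
    then show ?thesis unfolding partial_def using \<open>p c = q c\<close> by (auto intro: deriv_cong_ev)
  next
    case False
    then show ?thesis using partial_eq_0_on[OF assms] pq by metis
  qed
qed

lemma smooth_on_local_support:
  assumes "smooth_on W h" "p \<in> W"
  shows "\<exists>V S. open V \<and> p \<in> V \<and> V \<subseteq> W \<and> finite S \<and> depends_only S V h"
  using assms unfolding smooth_on_def by blast

lemma smooth_on_continuous: "smooth_on W h \<Longrightarrow> continuous_on W h"
  unfolding smooth_on_def by (metis foldr.simps(1) id_apply)

lemma smooth_on_DERIV:
  assumes "smooth_on W h" "p \<in> W"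
  shows "((\<lambda>t. h (p(c := t))) has_real_derivative partial c h p) (at (p c))"
proof -
  have "(\<lambda>t. foldr partial [] h (p(c := t))) differentiable (at (p c))"
    using assms unfolding smooth_on_def by blast
  then show ?thesis unfolding partial_def by (simp add: DERIV_deriv_iff_real_differentiable)
qed

lemma smooth_on_DERIV_upd:
  assumes "smooth_on W h" "p(c := s) \<in> W"
  shows "((\<lambda>t. h (p(c := t))) has_real_derivative partial c h (p(c := s))) (at s)"
  using smooth_on_DERIV[OF assms, of c] by simp

lemma smooth_on_partial:
  assumes "smooth_on W h" "open W"
  shows "smooth_on W (partial c h)"
proof -
  have "foldr partial cs (partial c h) = foldr partial (cs @ [c]) h" for cs by simp
  then show ?thesis
    using assms depends_only_partial[where c = c and h = h] unfolding smooth_on_def by metis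
qed

lemma smooth_on_subset:
  assumes "smooth_on W h" "open V" "V \<subseteq> W"
  shows "smooth_on V h"
  unfolding smooth_on_def
proof (intro conjI allI ballI)
  fix p assume p: "p \<in> V"
  with assms(3) have "p \<in> W" by blast
  from smooth_on_local_support[OF assms(1) this]
  obtain V' S where "open V'" "p \<in> V'" "V' \<subseteq> W" "finite S" "depends_only S V' h" by blast
  moreover from this have "depends_only S (V' \<inter> V) h" by (simp add: depends_only_mono[of S V' h S "V' \<inter> V"])
  ultimately show "\<exists>V' S. open V' \<and> p \<in> V' \<and> V' \<subseteq> V \<and> finite S \<and> depends_only S V' h"
    using assms(2) p by (intro exI[of _ "V' \<inter> V"] exI[of _ S]) auto
next
  fix cs show "continuous_on V (foldr partial cs h)"
    using assms continuous_on_subset unfolding smooth_on_def by blast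
next
  fix cs c p assume "p \<in> V"
  then show "(\<lambda>t. foldr partial cs h (p(c := t))) differentiable at (p c)"
    using assms unfolding smooth_on_def by blast
qed

lemma smooth_on_local:
  assumes "\<And>p. p \<in> W \<Longrightarrow> \<exists>V. open V \<and> p \<in> V \<and> V \<subseteq> W \<and> smooth_on V h"
  shows "smooth_on W h"
  unfolding smooth_on_def
proof (intro conjI allI ballI)
  fix p assume p: "p \<in> W"
  then obtain V where V: "open V" "p \<in> V" "V \<subseteq> W" "smooth_on V h" using assms by blast
  then obtain V' S where "open V'" "p \<in> V'" "V' \<subseteq> V" "finite S" "depends_only S V' h"
    using smooth_on_local_support[OF V(4,2)] by blast
  then show "\<exists>V S. open V \<and> p \<in> V \<and> V \<subseteq> W \<and> finite S \<and> depends_only S V h"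
    using V by blast
next
  fix cs
  have "continuous_on (\<Union>{V. open V \<and> V \<subseteq> W \<and> smooth_on V h}) (foldr partial cs h)"
    by (rule continuous_on_open_Union) (auto simp: smooth_on_def)
  moreover have "\<Union>{V. open V \<and> V \<subseteq> W \<and> smooth_on V h} = W" using assms by blast
  ultimately show "continuous_on W (foldr partial cs h)" by simp
next
  fix cs c p assume "p \<in> W"
  then show "(\<lambda>t. foldr partial cs h (p(c := t))) differentiable at (p c)"
    using assms unfolding smooth_on_def by blast
qed

text \<open>
  Smoothness is a greatest fixed point: if a family of continuous functions is closed under
  partial differentiation, its members that depend locally on finitely many coordinates are smooth.
  The basic closure properties are obtained by exhibiting such a family.
\<close>

lemma smooth_on_coinduct:
  assumes W: "open W" and h: "h \<in> F"
    and fin: "\<And>p. p \<in> W \<Longrightarrow> \<exists>V S. open V \<and> p \<in> V \<and> V \<subseteq> W \<and> finite S \<and> depends_only S V h"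
    and cont: "\<And>g. g \<in> F \<Longrightarrow> continuous_on W g"
    and deriv: "\<And>g c. g \<in> F \<Longrightarrow> \<exists>g'\<in>F. \<forall>p\<in>W. ((\<lambda>t. g (p(c := t))) has_real_derivative g' p) (at (p c))"
  shows "smooth_on W h"
proof -
  have *: "\<exists>g\<in>F. \<forall>p\<in>W. foldr partial cs h p = g p" for cs
  proof (induction cs)
    case Nil
    then show ?case using h by auto
  next
    case (Cons c cs)
    then obtain g where g: "g \<in> F" "\<forall>p\<in>W. foldr partial cs h p = g p" by blast
    obtain g' where g': "g' \<in> F" "\<forall>p\<in>W. ((\<lambda>t. g (p(c := t))) has_real_derivative g' p) (at (p c))"
      using deriv[OF g(1)] by blast
    have "foldr partial (c # cs) h p = g' p" if p: "p \<in> W" for p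
    proof -
      have "foldr partial (c # cs) h p = partial c (foldr partial cs h) p" by simp
      also have "\<dots> = partial c g p" using partial_cong[OF W p] g(2) by blast
      also have "\<dots> = g' p" using g'(2) p unfolding partial_def by (blast intro: DERIV_imp_deriv)
      finally show ?thesis .
    qed
    then show ?case using g'(1) by blast
  qed
  show ?thesis
    unfolding smooth_on_def
  proof (intro conjI allI ballI)
    fix cs
    show "continuous_on W (foldr partial cs h)"
      using *[of cs] cont continuous_on_cong[OF refl, of W "foldr partial cs h"] by (metis (no_types, lifting))
    fix c p assume p: "p \<in> W"
    obtain g where g: "g \<in> F" "\<forall>p\<in>W. foldr partial cs h p = g p" using * by blast
    obtain d where "((\<lambda>t. g (p(c := t))) has_real_derivative d) (at (p c))"
      using deriv[OF g(1)] p by blast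
    then have "((\<lambda>t. foldr partial cs h (p(c := t))) has_real_derivative d) (at (p c))"
      using has_derivative_transfer_coord[OF W p] g(2) by metis
    then show "(\<lambda>t. foldr partial cs h (p(c := t))) differentiable at (p c)"
      using real_differentiable_def by blast
  next
    fix p assume "p \<in> W"
    then show "\<exists>V S. open V \<and> p \<in> V \<and> V \<subseteq> W \<and> finite S \<and> depends_only S V h" by (rule fin)
  qed
qed

lemma smooth_on_const [simp]:
  fixes W :: "('c \<Rightarrow> real) set"
  assumes "open W"
  shows "smooth_on W (\<lambda>p. r)"
proof (rule smooth_on_coinduct[where F = "range (\<lambda>r p. r)"])
  fix g :: "('c \<Rightarrow> real) \<Rightarrow> real" and c
  assume g: "g \<in> range (\<lambda>r p. r)"
  then show "continuous_on W g" by auto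
  show "\<exists>g'\<in>range (\<lambda>r p. r). \<forall>p\<in>W. ((\<lambda>t. g (p(c := t))) has_real_derivative g' p) (at (p c))"
    using g by (intro bexI[of _ "\<lambda>p. 0"]) auto
next
  fix p assume "p \<in> W"
  then show "\<exists>V S. open V \<and> p \<in> V \<and> V \<subseteq> W \<and> finite S \<and> depends_only S V (\<lambda>p. r)"
    using assms by (intro exI[of _ W] exI[of _ "{}"]) (auto simp: depends_only_def)
qed (use assms in auto)

lemma smooth_on_coordinate [simp]:
  fixes W :: "('c \<Rightarrow> real) set" and c :: 'c
  assumes "open W"
  shows "smooth_on W (\<lambda>p. p c)"
proof (rule smooth_on_coinduct[where F = "range (\<lambda>r p. r) \<union> range (\<lambda>c p. p c)"])
  fix g :: "('c \<Rightarrow> real) \<Rightarrow> real" and c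
  assume g: "g \<in> range (\<lambda>r p. r) \<union> range (\<lambda>c p. p c)"
  then show "continuous_on W g" by (auto intro: continuous_on_product_coordinates continuous_on_subset)
  have "((\<lambda>t. (p(c := t)) b) has_real_derivative (if b = c then 1 else 0)) (at (p c))" for p :: "'c \<Rightarrow> real" and b by auto
  then have *: "\<forall>p\<in>W. ((\<lambda>t. (p(c := t)) b) has_real_derivative (\<lambda>p. if b = c then 1 else 0) p) (at (p c))" for b
    by blast
  from g show "\<exists>g'\<in>range (\<lambda>r p. r) \<union> range (\<lambda>c p. p c).
      \<forall>p\<in>W. ((\<lambda>t. g (p(c := t))) has_real_derivative g' p) (at (p c))"
  proof
    assume "g \<in> range (\<lambda>r p. r)"
    then show ?thesis by (intro bexI[of _ "\<lambda>p. 0"]) auto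
  next
    assume "g \<in> range (\<lambda>c p. p c)"
    then obtain b where "g = (\<lambda>p. p b)" by blast
    then show ?thesis using *[of b] by (intro bexI[of _ "\<lambda>p. if b = c then 1 else 0"]) auto
  qed
next
  fix p assume "p \<in> W"
  then show "\<exists>V S. open V \<and> p \<in> V \<and> V \<subseteq> W \<and> finite S \<and> depends_only S V (\<lambda>p. p c)"
    using assms by (intro exI[of _ W] exI[of _ "{c}"]) (auto simp: depends_only_def)
qed (use assms in auto)

lemma smooth_on_cong:
  assumes "smooth_on W g" "open W" "\<And>p. p \<in> W \<Longrightarrow> g p = h p"
  shows "smooth_on W h"
proof (rule smooth_on_coinduct[where F = "{k. \<exists>g. smooth_on W g \<and> (\<forall>p\<in>W. g p = k p)}"])
  show "h \<in> {k. \<exists>g. smooth_on W g \<and> (\<forall>p\<in>W. g p = k p)}" using assms by blast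
  show "\<exists>V S. open V \<and> p \<in> V \<and> V \<subseteq> W \<and> finite S \<and> depends_only S V h" if p: "p \<in> W" for p
  proof -
    obtain V S where VS: "open V" "p \<in> V" "V \<subseteq> W" "finite S" "depends_only S V g"
      using smooth_on_local_support[OF assms(1) p] by blast
    have "depends_only S V h"
      unfolding depends_only_def
    proof (intro ballI impI)
      fix q r assume qr: "q \<in> V" "r \<in> V" "\<forall>c\<in>S. q c = r c"
      then have "g q = g r" using VS(5) unfolding depends_only_def by blast
      moreover have "g q = h q" "g r = h r" using assms(3) qr VS(3) by auto
      ultimately show "h q = h r" by simp
    qed
    with VS show ?thesis by blast
  qed
  fix k c assume "k \<in> {k. \<exists>g. smooth_on W g \<and> (\<forall>p\<in>W. g p = k p)}"
  then obtain g where g: "smooth_on W g" "\<forall>p\<in>W. g p = k p" by blast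
  show "continuous_on W k"
    using smooth_on_continuous[OF g(1)] g(2) continuous_on_cong[OF refl, of W g k] by simp
  have "((\<lambda>t. k (p(c := t))) has_real_derivative partial c g p) (at (p c))" if "p \<in> W" for p
    by (rule has_derivative_transfer_coord[OF assms(2) that _ smooth_on_DERIV[OF g(1) that]]) (use g(2) in simp)
  moreover have "partial c g \<in> {k. \<exists>g. smooth_on W g \<and> (\<forall>p\<in>W. g p = k p)}"
    using smooth_on_partial[OF g(1) assms(2)] by blast
  ultimately show "\<exists>g'\<in>{k. \<exists>g. smooth_on W g \<and> (\<forall>p\<in>W. g p = k p)}.
      \<forall>p\<in>W. ((\<lambda>t. k (p(c := t))) has_real_derivative g' p) (at (p c))"
    by (intro bexI[of _ "partial c g"] ballI)
qed (rule assms(2))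

section \<open>Chain rule and symmetry of second derivatives\<close>

text \<open>
  The coordinates are moved one after the other; each single move is controlled by the mean
  value theorem, and continuity of the partial derivative at the base point gives the limit.
\<close>

lemma chain_rule_curve:
  fixes g :: "('c \<Rightarrow> real) \<Rightarrow> real" and \<gamma> :: "real \<Rightarrow> 'c \<Rightarrow> real"
  assumes O: "open O'" and g: "smooth_on O' g" and S: "finite S" and dep: "depends_only S O' g"
    and ev: "\<forall>\<^sub>F t in nhds t0. \<gamma> t \<in> O'"
    and der: "\<And>b. b \<in> S \<Longrightarrow> ((\<lambda>t. \<gamma> t b) has_real_derivative d b) (at t0)"
  shows "((\<lambda>t. g (\<gamma> t)) has_real_derivative (\<Sum>b\<in>S. partial b g (\<gamma> t0) * d b)) (at t0)"
proof -
  let ?q = "\<gamma> t0"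
  have q: "?q \<in> O'" using ev eventually_nhds_x_imp_x by blast
  obtain T e where T: "finite T" "e > 0" "\<forall>r. (\<forall>b\<in>T. \<bar>r b - ?q b\<bar> < e) \<longrightarrow> r \<in> O'"
    using open_contains_box[OF O q] by blast
  \<comment> \<open>\<open>G A t\<close> has moved only the coordinates in \<open>A\<close>.\<close>
  define G where "G A t = (\<lambda>b. if b \<in> A then \<gamma> t b else ?q b)" for A t
  have lim: "((\<lambda>t. \<gamma> t b) \<longlongrightarrow> ?q b) (nhds t0)" if "b \<in> S" for b
    using DERIV_isCont[OF der[OF that]] tendsto_at_iff_tendsto_nhds[of "\<lambda>t. \<gamma> t b" t0]
    by (simp add: continuous_at)
  have near: "\<forall>\<^sub>F t in nhds t0. \<forall>b\<in>S. \<bar>\<gamma> t b - ?q b\<bar> < e"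
  proof (intro eventually_ball_finite S ballI)
    fix b assume "b \<in> S"
    from tendstoD[OF lim[OF this] T(2)] show "\<forall>\<^sub>F t in nhds t0. \<bar>\<gamma> t b - ?q b\<bar> < e"
      by (simp add: dist_real_def)
  qed
  have inO: "r \<in> O'" if "\<forall>b. r b = ?q b \<or> \<bar>r b - ?q b\<bar> < e" for r
    using T(2) that by (intro T(3)[rule_format]) (metis abs_zero diff_self)
  have "((\<lambda>t. g (G A t)) has_real_derivative (\<Sum>b\<in>A. partial b g ?q * d b)) (at t0)" if "A \<subseteq> S" for A
    using finite_subset[OF that S] that
  proof (induction A rule: finite_induct)
    case empty
    then show ?case by (simp add: G_def)
  next
    case (insert a A)
    have a: "a \<in> S" "A \<subseteq> S" using insert by auto
    have upd: "G (insert a A) t = (G A t)(a := \<gamma> t a)" "(G A t)(a := ?q a) = G A t" for t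
      using insert.hyps by (auto simp: G_def)
    have "\<forall>t. \<exists>s. (\<forall>b\<in>S. \<bar>\<gamma> t b - ?q b\<bar> < e) \<longrightarrow> \<bar>s - ?q a\<bar> \<le> \<bar>\<gamma> t a - ?q a\<bar> \<and>
        g (G (insert a A) t) - g (G A t) = (\<gamma> t a - ?q a) * partial a g ((G A t)(a := s))"
    proof (intro allI)
      fix t
      let ?H = "\<lambda>x. g ((G A t)(a := x))"
      show "\<exists>s. (\<forall>b\<in>S. \<bar>\<gamma> t b - ?q b\<bar> < e) \<longrightarrow> \<bar>s - ?q a\<bar> \<le> \<bar>\<gamma> t a - ?q a\<bar> \<and>
        g (G (insert a A) t) - g (G A t) = (\<gamma> t a - ?q a) * partial a g ((G A t)(a := s))"
      proof (cases "\<forall>b\<in>S. \<bar>\<gamma> t b - ?q b\<bar> < e")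
        case True
        have D: "(?H has_real_derivative partial a g ((G A t)(a := x))) (at x)"
          if "\<bar>x - ?q a\<bar> \<le> \<bar>\<gamma> t a - ?q a\<bar>" for x
        proof (rule smooth_on_DERIV_upd[OF g], rule inO, intro allI)
          fix b show "((G A t)(a := x)) b = ?q b \<or> \<bar>((G A t)(a := x)) b - ?q b\<bar> < e"
            using True that a by (force simp: G_def)
        qed
        consider "\<gamma> t a < ?q a" | "\<gamma> t a = ?q a" | "?q a < \<gamma> t a" by linarith
        then show ?thesis
        proof cases
          case 1
          obtain s where "\<gamma> t a < s" "s < ?q a"
            "?H (?q a) - ?H (\<gamma> t a) = (?q a - \<gamma> t a) * partial a g ((G A t)(a := s))"
            using MVT2[OF 1, of ?H "\<lambda>x. partial a g ((G A t)(a := x))"] D by auto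
          then show ?thesis by (intro exI[of _ s]) (auto simp: upd algebra_simps)
        next
          case 2
          then show ?thesis by (intro exI[of _ "?q a"]) (simp add: upd)
        next
          case 3
          obtain s where "?q a < s" "s < \<gamma> t a"
            "?H (\<gamma> t a) - ?H (?q a) = (\<gamma> t a - ?q a) * partial a g ((G A t)(a := s))"
            using MVT2[OF 3, of ?H "\<lambda>x. partial a g ((G A t)(a := x))"] D by auto
          then show ?thesis by (intro exI[of _ s]) (auto simp: upd algebra_simps)
        qed
      qed auto
    qed
    then obtain \<sigma> where \<sigma>: "\<And>t. \<forall>b\<in>S. \<bar>\<gamma> t b - ?q b\<bar> < e \<Longrightarrow> \<bar>\<sigma> t - ?q a\<bar> \<le> \<bar>\<gamma> t a - ?q a\<bar> \<and>
        g (G (insert a A) t) - g (G A t) = (\<gamma> t a - ?q a) * partial a g ((G A t)(a := \<sigma> t))"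
      by metis
    have lim\<sigma>: "(\<sigma> \<longlongrightarrow> ?q a) (at t0)"
    proof (rule Lim_null_comparison[of "\<lambda>t. \<sigma> t - ?q a" "\<lambda>t. \<bar>\<gamma> t a - ?q a\<bar>", THEN LIM_zero_cancel])
      show "\<forall>\<^sub>F t in at t0. norm (\<sigma> t - ?q a) \<le> \<bar>\<gamma> t a - ?q a\<bar>"
        using near \<sigma> by (auto simp: eventually_at_filter elim!: eventually_mono)
      show "((\<lambda>t. \<bar>\<gamma> t a - ?q a\<bar>) \<longlongrightarrow> 0) (at t0)"
        using lim[OF a(1)] by (intro tendsto_rabs_zero LIM_zero) (rule tendsto_mono[OF at_within_le_nhds])
    qed
    have lim_pt: "((\<lambda>t. (G A t)(a := \<sigma> t)) \<longlongrightarrow> ?q) (at t0)"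
    proof (rule tendsto_coordinatewise)
      fix b
      have "((\<lambda>t. \<gamma> t b) \<longlongrightarrow> ?q b) (at t0)" if "b \<in> S"
        using lim[OF that] tendsto_mono[OF at_within_le_nhds] by blast
      then show "((\<lambda>t. ((G A t)(a := \<sigma> t)) b) \<longlongrightarrow> ?q b) (at t0)"
        using a lim\<sigma> by (cases "b = a"; cases "b \<in> A") (auto simp: G_def)
    qed
    from continuous_on_tendsto_compose[OF smooth_on_continuous[OF smooth_on_partial[OF g O]] lim_pt q]
    have limp: "((\<lambda>t. partial a g ((G A t)(a := \<sigma> t))) \<longlongrightarrow> partial a g ?q) (at t0)"
      using topological_tendstoD[OF lim_pt O q] by simp
    have "((\<lambda>t. (\<gamma> t a - ?q a) / (t - t0) * partial a g ((G A t)(a := \<sigma> t))) \<longlongrightarrow> d a * partial a g ?q) (at t0)"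
      using der[OF a(1)] by (intro tendsto_mult limp) (simp add: has_field_derivative_iff)
    then have "((\<lambda>t. (g (G (insert a A) t) - g (G A t)) / (t - t0)) \<longlongrightarrow> d a * partial a g ?q) (at t0)"
    proof (rule tendsto_cong[THEN iffD1, rotated])
      show "\<forall>\<^sub>F t in at t0. (\<gamma> t a - ?q a) / (t - t0) * partial a g ((G A t)(a := \<sigma> t)) =
          (g (G (insert a A) t) - g (G A t)) / (t - t0)"
        using near \<sigma> by (auto simp: eventually_at_filter elim!: eventually_mono)
    qed
    moreover have "((\<lambda>t. (g (G A t) - g (G A t0)) / (t - t0)) \<longlongrightarrow> (\<Sum>b\<in>A. partial b g ?q * d b)) (at t0)"
      using insert.IH[OF a(2)] by (simp add: has_field_derivative_iff)
    ultimately have "((\<lambda>t. (g (G (insert a A) t) - g (G A t)) / (t - t0) + (g (G A t) - g (G A t0)) / (t - t0))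
        \<longlongrightarrow> d a * partial a g ?q + (\<Sum>b\<in>A. partial b g ?q * d b)) (at t0)"
      by (rule tendsto_add)
    moreover have "G (insert a A) t0 = G A t0" by (auto simp: G_def)
    ultimately show ?case
      using insert.hyps by (simp add: has_field_derivative_iff add_divide_distrib[symmetric] mult.commute)
  qed
  from this[OF subset_refl]
  have *: "((\<lambda>t. g (G S t)) has_real_derivative (\<Sum>b\<in>S. partial b g ?q * d b)) (at t0)" .
  have "\<forall>\<^sub>F t in nhds t0. g (G S t) = g (\<gamma> t)"
    using near ev
  proof eventually_elim
    case (elim t)
    have "G S t \<in> O'" using elim by (intro inO) (auto simp: G_def)
    moreover have "\<forall>b\<in>S. G S t b = \<gamma> t b" by (simp add: G_def)
    ultimately show ?case using dep elim(2) unfolding depends_only_def by blast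
  qed
  from DERIV_cong_ev[OF refl this refl] * show ?thesis by simp
qed

text \<open>
  Functions generated by smooth functions on \<open>W\<close> and by pullbacks of smooth functions on
  \<open>O'\<close> along \<open>G\<close>.  By the product and chain rules this family is closed under partial derivatives.
\<close>

inductive_set pullback_algebra for W O' S and G :: "('d \<Rightarrow> real) \<Rightarrow> 'c \<Rightarrow> real" where
  base: "smooth_on W g \<Longrightarrow> g \<in> pullback_algebra W O' S G"
| comp: "smooth_on O' g \<Longrightarrow> depends_only S O' g \<Longrightarrow> (\<lambda>p. g (G p)) \<in> pullback_algebra W O' S G"
| add: "g \<in> pullback_algebra W O' S G \<Longrightarrow> h \<in> pullback_algebra W O' S G \<Longrightarrow>
    (\<lambda>p. g p + h p) \<in> pullback_algebra W O' S G"
| mult: "g \<in> pullback_algebra W O' S G \<Longrightarrow> h \<in> pullback_algebra W O' S G \<Longrightarrow>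
    (\<lambda>p. g p * h p) \<in> pullback_algebra W O' S G"

lemma pullback_algebra_sum:
  assumes "open W" "\<And>i. i \<in> I \<Longrightarrow> g i \<in> pullback_algebra W O' S G"
  shows "(\<lambda>p. \<Sum>i\<in>I. g i p) \<in> pullback_algebra W O' S G"
  using assms(2)
proof (induction I rule: infinite_finite_induct)
  case (insert i I)
  then have "(\<lambda>p. g i p + (\<Sum>i\<in>I. g i p)) \<in> pullback_algebra W O' S G"
    by (intro pullback_algebra.add) auto
  then show ?case using insert by simp
qed (auto intro!: pullback_algebra.base smooth_on_const assms(1))

lemma smooth_on_pullback_algebra:
  fixes G :: "('d \<Rightarrow> real) \<Rightarrow> 'c \<Rightarrow> real"
  assumes W: "open W" and O: "open O'" and S: "finite S" and WO: "\<And>p. p \<in> W \<Longrightarrow> G p \<in> O'"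
    and G: "\<And>b. smooth_on W (\<lambda>p. G p b)"
    and h: "h \<in> pullback_algebra W O' S G"
  shows "smooth_on W h"
proof (rule smooth_on_coinduct[where F = "pullback_algebra W O' S G"])
  have contG: "continuous_on W G"
    using G smooth_on_continuous by (intro continuous_on_coordinatewise_then_product) blast
  show "\<exists>V T. open V \<and> p \<in> V \<and> V \<subseteq> W \<and> finite T \<and> depends_only T V h" if p: "p \<in> W" for p
    using h
  proof (induction)
    case (base g)
    then show ?case using smooth_on_local_support[OF _ p] by simp
  next
    case (comp g)
    have "\<forall>b. \<exists>V T. open V \<and> p \<in> V \<and> V \<subseteq> W \<and> finite T \<and> depends_only T V (\<lambda>p. G p b)"
      using smooth_on_local_support[OF G p] by simp
    then obtain V T where VT: "\<And>b. open (V b) \<and> p \<in> V b \<and> V b \<subseteq> W \<and> finite (T b) \<and> depends_only (T b) (V b) (\<lambda>p. G p b)"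
      by metis
    show ?case
    proof (intro exI conjI)
      show "open (W \<inter> (\<Inter>b\<in>S. V b))" using VT S W by auto
      show "finite (\<Union>b\<in>S. T b)" using VT S by auto
      show "depends_only (\<Union>b\<in>S. T b) (W \<inter> (\<Inter>b\<in>S. V b)) (\<lambda>p. g (G p))"
        unfolding depends_only_def
      proof (intro ballI impI)
        fix q r assume qr: "q \<in> W \<inter> (\<Inter>b\<in>S. V b)" "r \<in> W \<inter> (\<Inter>b\<in>S. V b)" "\<forall>c\<in>\<Union>b\<in>S. T b. q c = r c"
        have "G q b = G r b" if b: "b \<in> S" for b
          using VT[of b] qr b unfolding depends_only_def by (metis IntD2 INT_E UN_I)
        moreover have "G q \<in> O'" "G r \<in> O'" using WO qr by auto
        ultimately show "g (G q) = g (G r)" using comp(2) unfolding depends_only_def by metis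
      qed
    qed (use VT p in auto)
  next
    case (add g k)
    then obtain V1 T1 V2 T2 where "open V1" "p \<in> V1" "V1 \<subseteq> W" "finite T1" "depends_only T1 V1 g"
      "open V2" "p \<in> V2" "V2 \<subseteq> W" "finite T2" "depends_only T2 V2 k" by blast
    moreover from this have "depends_only (T1 \<union> T2) (V1 \<inter> V2) (\<lambda>p. g p + k p)"
      by (intro depends_only_binop)
    ultimately show ?case by (intro exI[of _ "V1 \<inter> V2"] exI[of _ "T1 \<union> T2"]) auto
  next
    case (mult g k)
    then obtain V1 T1 V2 T2 where "open V1" "p \<in> V1" "V1 \<subseteq> W" "finite T1" "depends_only T1 V1 g"
      "open V2" "p \<in> V2" "V2 \<subseteq> W" "finite T2" "depends_only T2 V2 k" by blast
    moreover from this have "depends_only (T1 \<union> T2) (V1 \<inter> V2) (\<lambda>p. g p * k p)"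
      by (intro depends_only_binop)
    ultimately show ?case by (intro exI[of _ "V1 \<inter> V2"] exI[of _ "T1 \<union> T2"]) auto
  qed
  fix g c assume g: "g \<in> pullback_algebra W O' S G"
  then show "continuous_on W g"
  proof induction
    case (comp g)
    then show ?case
      using continuous_on_compose2[OF smooth_on_continuous contG] WO by (simp add: image_subset_iff)
  qed (simp_all add: smooth_on_continuous continuous_on_add continuous_on_mult)
  from g show "\<exists>g'\<in>pullback_algebra W O' S G. \<forall>p\<in>W. ((\<lambda>t. g (p(c := t))) has_real_derivative g' p) (at (p c))"
  proof induction
    case (base g)
    show ?case
      using smooth_on_DERIV[OF base] pullback_algebra.base[OF smooth_on_partial[OF base W]]
      by (intro bexI ballI)
  next
    case (comp g)
    show ?case
    proof (intro bexI ballI)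
      show "(\<lambda>p. \<Sum>b\<in>S. partial b g (G p) * partial c (\<lambda>p. G p b) p) \<in> pullback_algebra W O' S G"
        by (intro pullback_algebra_sum pullback_algebra.mult pullback_algebra.base W pullback_algebra.comp
            smooth_on_partial O depends_only_partial G comp)
      fix p assume p: "p \<in> W"
      have "\<forall>\<^sub>F t in nhds (p c). p(c := t) \<in> W" using eventually_fun_upd_in W p by (metis fun_upd_triv)
      then have "((\<lambda>t. g (G (p(c := t)))) has_real_derivative
          (\<Sum>b\<in>S. partial b g (G (p(c := p c))) * partial c (\<lambda>p. G p b) p)) (at (p c))"
        using comp WO smooth_on_DERIV[OF G p]
        by (intro chain_rule_curve[OF O comp(1) S comp(2), where \<gamma> = "\<lambda>t. G (p(c := t))"]) (auto elim!: eventually_mono)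
      then show "((\<lambda>t. g (G (p(c := t)))) has_real_derivative
          (\<Sum>b\<in>S. partial b g (G p) * partial c (\<lambda>p. G p b) p)) (at (p c))" by simp
    qed
  next
    case (add g k)
    then obtain g' k' where gk: "g' \<in> pullback_algebra W O' S G" "k' \<in> pullback_algebra W O' S G"
      "\<forall>p\<in>W. ((\<lambda>t. g (p(c := t))) has_real_derivative g' p) (at (p c))"
      "\<forall>p\<in>W. ((\<lambda>t. k (p(c := t))) has_real_derivative k' p) (at (p c))" by blast
    have "((\<lambda>t. g (p(c := t)) + k (p(c := t))) has_real_derivative g' p + k' p) (at (p c))"
      if "p \<in> W" for p
      using DERIV_add[OF gk(3)[THEN bspec, OF that] gk(4)[THEN bspec, OF that]] .
    then show ?case
      using gk by (intro bexI[of _ "\<lambda>p. g' p + k' p"] pullback_algebra.add) (auto simp del: fun_upd_apply)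
  next
    case (mult g k)
    then obtain g' k' where gk: "g' \<in> pullback_algebra W O' S G" "k' \<in> pullback_algebra W O' S G"
      "\<forall>p\<in>W. ((\<lambda>t. g (p(c := t))) has_real_derivative g' p) (at (p c))"
      "\<forall>p\<in>W. ((\<lambda>t. k (p(c := t))) has_real_derivative k' p) (at (p c))" by blast
    have "((\<lambda>t. g (p(c := t)) * k (p(c := t))) has_real_derivative g' p * k p + k' p * g p) (at (p c))"
      if "p \<in> W" for p
      using DERIV_mult[of "\<lambda>t. g (p(c := t))" "g' p" "p c" UNIV "\<lambda>t. k (p(c := t))" "k' p"] gk that by simp
    then show ?case
      using gk mult by (intro bexI[of _ "\<lambda>p. g' p * k p + k' p * g p"] pullback_algebra.add pullback_algebra.mult)
        (auto simp del: fun_upd_apply)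
  qed
qed fact+

lemma
  assumes "open W" "smooth_on W g" "smooth_on W h"
  shows smooth_on_add: "smooth_on W (\<lambda>p. g p + h p)"
    and smooth_on_mult: "smooth_on W (\<lambda>p. g p * h p)"
proof -
  note * = smooth_on_pullback_algebra[of W UNIV "{}" "\<lambda>p. p", OF assms(1) open_UNIV finite.emptyI
      UNIV_I smooth_on_coordinate[OF assms(1)]]
  show "smooth_on W (\<lambda>p. g p + h p)"
    by (rule *) (intro pullback_algebra.add pullback_algebra.base assms(2,3))
  show "smooth_on W (\<lambda>p. g p * h p)"
    by (rule *) (intro pullback_algebra.mult pullback_algebra.base assms(2,3))
qed

lemma smooth_on_sum:
  assumes "open W" "\<And>i. i \<in> I \<Longrightarrow> smooth_on W (g i)"
  shows "smooth_on W (\<lambda>p. \<Sum>i\<in>I. g i p)"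
  using assms(2)
  by (induction I rule: infinite_finite_induct) (auto simp: assms(1) intro!: smooth_on_add)

lemma smooth_on_minus: "open W \<Longrightarrow> smooth_on W g \<Longrightarrow> smooth_on W (\<lambda>p. - g p)"
  using smooth_on_mult[of W "\<lambda>_. - 1" g] by simp

lemma smooth_on_diff: "open W \<Longrightarrow> smooth_on W g \<Longrightarrow> smooth_on W h \<Longrightarrow> smooth_on W (\<lambda>p. g p - h p)"
  using smooth_on_add[OF _ _ smooth_on_minus, of W g h] by simp

lemma open_preimage:
  fixes G :: "('d \<Rightarrow> real) \<Rightarrow> 'c \<Rightarrow> real"
  assumes "open W" "\<And>b. smooth_on W (\<lambda>p. G p b)" "open O'"
  shows "open {p \<in> W. G p \<in> O'}"
proof -
  have "continuous_on W G"
    using assms smooth_on_continuous by (intro continuous_on_coordinatewise_then_product) blast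
  then have "open (G -` O' \<inter> W)" using continuous_on_open_vimage[OF assms(1)] assms(3) by blast
  then show ?thesis by (simp add: vimage_def Int_def conj_commute)
qed

text \<open>
  On a neighbourhood where \<open>g\<close> depends on finitely many coordinates the pullback lies in such an algebra.
\<close>

lemma smooth_on_compose:
  fixes G :: "('d \<Rightarrow> real) \<Rightarrow> 'c \<Rightarrow> real"
  assumes W: "open W" and WO: "\<And>p. p \<in> W \<Longrightarrow> G p \<in> O'"
    and G: "\<And>b. smooth_on W (\<lambda>p. G p b)" and g: "smooth_on O' g"
  shows "smooth_on W (\<lambda>p. g (G p))"
proof (rule smooth_on_local)
  fix p assume p: "p \<in> W"
  obtain V S where VS: "open V" "G p \<in> V" "V \<subseteq> O'" "finite S" "depends_only S V g"
    using smooth_on_local_support[OF g WO[OF p]] by blast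
  let ?V = "{p \<in> W. G p \<in> V}"
  have oV: "open ?V" by (rule open_preimage[OF W G VS(1)])
  have "smooth_on ?V (\<lambda>p. g (G p))"
  proof (rule smooth_on_pullback_algebra[OF oV VS(1,4)])
    show "(\<lambda>p. g (G p)) \<in> pullback_algebra ?V V S G"
      using smooth_on_subset[OF g VS(1,3)] VS(5) by (rule pullback_algebra.comp)
    show "smooth_on ?V (\<lambda>p. G p b)" for b using smooth_on_subset[OF G oV] by blast
  qed auto
  then show "\<exists>V. open V \<and> p \<in> V \<and> V \<subseteq> W \<and> smooth_on V (\<lambda>p. g (G p))"
    using oV p VS by blast
qed

lemma chain_rule:
  fixes G :: "('d \<Rightarrow> real) \<Rightarrow> 'c \<Rightarrow> real"
  assumes W: "open W" "p \<in> W" and G: "\<And>b. smooth_on W (\<lambda>p. G p b)"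
    and O: "open O'" and WO: "\<And>p. p \<in> W \<Longrightarrow> G p \<in> O'" and g: "smooth_on O' g"
    and S: "finite S" "depends_only S O' g"
  shows "partial c (\<lambda>p. g (G p)) p = (\<Sum>b\<in>S. partial b g (G p) * partial c (\<lambda>p. G p b) p)"
proof -
  have "\<forall>\<^sub>F t in nhds (p c). p(c := t) \<in> W" using eventually_fun_upd_in W by (metis fun_upd_triv)
  then have "((\<lambda>t. g (G (p(c := t)))) has_real_derivative
      (\<Sum>b\<in>S. partial b g (G (p(c := p c))) * partial c (\<lambda>p. G p b) p)) (at (p c))"
    using WO smooth_on_DERIV[OF G W(2)]
    by (intro chain_rule_curve[OF O g S, where \<gamma> = "\<lambda>t. G (p(c := t))"]) (auto elim!: eventually_mono)
  then show ?thesis unfolding partial_def[of c "\<lambda>p. g (G p)"] by (simp add: DERIV_imp_deriv)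
qed

lemma
  assumes "smooth_on W g" "smooth_on W h" "p \<in> W"
  shows partial_add: "partial c (\<lambda>p. g p + h p) p = partial c g p + partial c h p"
    and partial_mult: "partial c (\<lambda>p. g p * h p) p = partial c g p * h p + g p * partial c h p"
proof -
  note D = smooth_on_DERIV[OF assms(1,3), of c] smooth_on_DERIV[OF assms(2,3), of c]
  from DERIV_add[OF D] show "partial c (\<lambda>p. g p + h p) p = partial c g p + partial c h p"
    unfolding partial_def[of c "\<lambda>p. g p + h p"] by (rule DERIV_imp_deriv)
  from DERIV_mult[OF D] show "partial c (\<lambda>p. g p * h p) p = partial c g p * h p + g p * partial c h p"
    unfolding partial_def[of c "\<lambda>p. g p * h p"] by (simp add: DERIV_imp_deriv mult.commute)
qed

lemma partial_const [simp]: "partial c (\<lambda>p. r) p = 0"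
  by (simp add: partial_def)

lemma partial_sum:
  assumes "open W" "\<And>i. i \<in> I \<Longrightarrow> smooth_on W (g i)" "p \<in> W"
  shows "partial c (\<lambda>p. \<Sum>i\<in>I. g i p) p = (\<Sum>i\<in>I. partial c (g i) p)"
  using assms(2)
proof (induction I rule: infinite_finite_induct)
  case (insert i I)
  have "smooth_on W (g i)" "smooth_on W (\<lambda>p. \<Sum>i\<in>I. g i p)"
    using insert by (auto intro!: smooth_on_sum[OF assms(1)])
  from partial_add[OF this assms(3)] insert show ?case by simp
qed auto

lemma partial_coordinate: "partial c (\<lambda>p. p b) p = (if b = c then 1 else 0)"
proof -
  have "((\<lambda>t. (p(c := t)) b) has_real_derivative (if b = c then 1 else 0)) (at (p c))" by auto
  then show ?thesis unfolding partial_def by (rule DERIV_imp_deriv)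
qed

text \<open>
  For Schwarz's theorem: the second difference of \<open>g\<close> over a small square equals the area of the square
  times a value of either mixed derivative, by applying the mean value theorem in the two orders.
\<close>

lemma second_difference_mean_value:
  fixes g :: "('c \<Rightarrow> real) \<Rightarrow> real"
  assumes "open W" "smooth_on W g" "b \<noteq> c" "0 < e"
    and sq: "\<And>s t. \<lbrakk>p b \<le> s; s \<le> p b + e; p c \<le> t; t \<le> p c + e\<rbrakk> \<Longrightarrow> p(b := s, c := t) \<in> W"
  shows "\<exists>s t. p b \<le> s \<and> s \<le> p b + e \<and> p c \<le> t \<and> t \<le> p c + e \<and>
    g (p(b := p b + e, c := p c + e)) - g (p(c := p c + e)) - g (p(b := p b + e)) + g p
     = e * e * partial c (partial b g) (p(b := s, c := t))"
proof -
  let ?H = "\<lambda>s. g (p(b := s, c := p c + e)) - g (p(b := s, c := p c))"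
  have D: "((\<lambda>s. g (p(b := s, c := t))) has_real_derivative partial b g (p(b := s, c := t))) (at s)"
    if "p b \<le> s" "s \<le> p b + e" "p c \<le> t" "t \<le> p c + e" for s t
    using smooth_on_DERIV_upd[OF assms(2), of "p(c := t)" b s] sq[OF that] assms(3)
    by (simp add: fun_upd_twist)
  have "\<exists>s. p b < s \<and> s < p b + e \<and> ?H (p b + e) - ?H (p b) =
      (p b + e - p b) * (partial b g (p(b := s, c := p c + e)) - partial b g (p(b := s, c := p c)))"
    using assms(4) by (intro MVT2 DERIV_diff D) auto
  then obtain s where s: "p b < s" "s < p b + e" "?H (p b + e) - ?H (p b) =
      e * (partial b g (p(b := s, c := p c + e)) - partial b g (p(b := s, c := p c)))" by auto
  have "\<exists>t. p c < t \<and> t < p c + e \<and> partial b g (p(b := s, c := p c + e)) - partial b g (p(b := s, c := p c))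
      = (p c + e - p c) * partial c (partial b g) (p(b := s, c := t))"
    using assms(4) s(1,2)
    by (intro MVT2 smooth_on_DERIV_upd[OF smooth_on_partial[OF assms(2,1)]] sq) auto
  then obtain t where t: "p c < t" "t < p c + e" "partial b g (p(b := s, c := p c + e)) - partial b g (p(b := s, c := p c))
      = e * partial c (partial b g) (p(b := s, c := t))" by auto
  have "g (p(b := p b + e, c := p c + e)) - g (p(c := p c + e)) - g (p(b := p b + e)) + g p
     = e * e * partial c (partial b g) (p(b := s, c := t))"
  proof -
    have "p(b := p b + e, c := p c) = p(b := p b + e)" using assms(3) by auto
    then have "g (p(b := p b + e, c := p c + e)) - g (p(c := p c + e)) - g (p(b := p b + e)) + g p
        = ?H (p b + e) - ?H (p b)" by simp
    then show ?thesis unfolding s(3) t(3) by simp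
  qed
  with s t show ?thesis by (intro exI[of _ s] exI[of _ t]) auto
qed

text \<open>As the square shrinks to \<open>p\<close>, both values tend to the mixed derivatives at \<open>p\<close>.\<close>

lemma partial_commute:
  fixes g :: "('c \<Rightarrow> real) \<Rightarrow> real"
  assumes W: "open W" and g: "smooth_on W g" and p: "p \<in> W"
  shows "partial b (partial c g) p = partial c (partial b g) p"
proof (cases "b = c")
  case False
  obtain T e0 where T: "finite T" "e0 > 0" "\<forall>r. (\<forall>b\<in>T. \<bar>r b - p b\<bar> < e0) \<longrightarrow> r \<in> W"
    using open_contains_box[OF W p] by blast
  define e where "e n = e0 / 2 / Suc n" for n
  have e: "0 < e n" "e n < e0" for n
    using T(2) by (auto simp: e_def field_simps intro!: add_pos_nonneg)
  have sq: "p(b := s, c := t) \<in> W"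
    if "p b \<le> s" "s \<le> p b + e n" "p c \<le> t" "t \<le> p c + e n" for s t n
    using that e[of n] by (intro T(3)[rule_format]) (auto simp: abs_if)
  have elim: "e \<longlonglongrightarrow> 0"
    unfolding e_def by (rule LIMSEQ_Suc[OF lim_const_over_n])
  have "\<exists>s t s' t'. p b \<le> s \<and> s \<le> p b + e n \<and> p c \<le> t \<and> t \<le> p c + e n \<and>
      p b \<le> s' \<and> s' \<le> p b + e n \<and> p c \<le> t' \<and> t' \<le> p c + e n \<and>
      partial c (partial b g) (p(b := s, c := t)) = partial b (partial c g) (p(b := s', c := t'))" for n
  proof -
    obtain s t where 1: "p b \<le> s" "s \<le> p b + e n" "p c \<le> t" "t \<le> p c + e n"
      "g (p(b := p b + e n, c := p c + e n)) - g (p(c := p c + e n)) - g (p(b := p b + e n)) + g p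
       = e n * e n * partial c (partial b g) (p(b := s, c := t))"
      using second_difference_mean_value[OF W g False e(1)[of n] sq[where n = n]] by blast
    have sq': "p(c := t, b := s) \<in> W"
      if "p c \<le> t" "t \<le> p c + e n" "p b \<le> s" "s \<le> p b + e n" for s t
      using sq[OF that(3,4,1,2)] False by (metis fun_upd_twist)
    obtain t' s' where 2: "p c \<le> t'" "t' \<le> p c + e n" "p b \<le> s'" "s' \<le> p b + e n"
      "g (p(c := p c + e n, b := p b + e n)) - g (p(b := p b + e n)) - g (p(c := p c + e n)) + g p
       = e n * e n * partial b (partial c g) (p(c := t', b := s'))"
      using second_difference_mean_value[OF W g False[symmetric] e(1)[of n] sq'] by blast
    have swap: "p(c := x, b := y) = p(b := y, c := x)" for x y using False by (rule fun_upd_twist[symmetric])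
    have "e n * e n * partial c (partial b g) (p(b := s, c := t)) =
        e n * e n * partial b (partial c g) (p(b := s', c := t'))"
      using 1(5) 2(5)[unfolded swap] by linarith
    then have "partial c (partial b g) (p(b := s, c := t)) = partial b (partial c g) (p(b := s', c := t'))"
      using e[of n] by simp
    then show ?thesis using 1 2 by blast
  qed
  then obtain s t s' t' where st: "\<And>n. p b \<le> s n \<and> s n \<le> p b + e n \<and> p c \<le> t n \<and> t n \<le> p c + e n \<and>
      p b \<le> s' n \<and> s' n \<le> p b + e n \<and> p c \<le> t' n \<and> t' n \<le> p c + e n \<and>
      partial c (partial b g) (p(b := s n, c := t n)) = partial b (partial c g) (p(b := s' n, c := t' n))"
    by metis
  have squeeze: "x \<longlonglongrightarrow> r" if "\<And>n. r \<le> x n \<and> x n \<le> r + e n" for x r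
  proof (rule tendsto_sandwich[of "\<lambda>_. r" x _ "\<lambda>n. r + e n" r])
    show "(\<lambda>n. r + e n) \<longlonglongrightarrow> r" using tendsto_add[OF tendsto_const elim, of r] by simp
  qed (use that in auto)
  have lim: "(\<lambda>n. p(b := x n, c := y n)) \<longlonglongrightarrow> p"
    if "\<And>n. p b \<le> x n \<and> x n \<le> p b + e n" "\<And>n. p c \<le> y n \<and> y n \<le> p c + e n" for x y
  proof (rule tendsto_coordinatewise)
    fix a show "(\<lambda>n. (p(b := x n, c := y n)) a) \<longlonglongrightarrow> p a"
      using squeeze[OF that(1)] squeeze[OF that(2)] by (cases "a = c"; cases "a = b") auto
  qed
  note cont = continuous_on_tendsto_compose[OF smooth_on_continuous[OF smooth_on_partial[OF smooth_on_partial[OF g W] W]] _ p]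
  have in_W: "p(b := s n, c := t n) \<in> W" "p(b := s' n, c := t' n) \<in> W" for n
    using st[of n] by (intro sq[where n = n]; simp)+
  have "(\<lambda>n. p(b := s n, c := t n)) \<longlonglongrightarrow> p" "(\<lambda>n. p(b := s' n, c := t' n)) \<longlonglongrightarrow> p"
    using st by (intro lim; simp)+
  from this[THEN cont]
  have lims: "(\<lambda>n. partial c (partial b g) (p(b := s n, c := t n))) \<longlonglongrightarrow> partial c (partial b g) p"
    "(\<lambda>n. partial b (partial c g) (p(b := s' n, c := t' n))) \<longlonglongrightarrow> partial b (partial c g) p"
    using in_W by simp_all
  have eq: "(\<lambda>n. partial c (partial b g) (p(b := s n, c := t n))) =
      (\<lambda>n. partial b (partial c g) (p(b := s' n, c := t' n)))"
    using st by simp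
  show ?thesis using LIMSEQ_unique[OF lims(1)[unfolded eq] lims(2)] by simp
qed simp

section \<open>The Lie derivative\<close>

lemma smooth_on_support:
  assumes "open W" "finite I" "\<And>i. i \<in> I \<Longrightarrow> smooth_on W (g i)" "p \<in> W"
  shows "\<exists>V S. open V \<and> p \<in> V \<and> V \<subseteq> W \<and> finite S \<and>
    (\<forall>i\<in>I. \<forall>q\<in>V. \<forall>c. c \<notin> S \<longrightarrow> partial c (g i) q = 0)"
  using assms(2,3)
proof (induction I)
  case empty
  show ?case using assms(1,4) by (intro exI[of _ W] exI[of _ "{}"]) simp
next
  case (insert i I)
  have "\<exists>V S. open V \<and> p \<in> V \<and> V \<subseteq> W \<and> finite S \<and>
      (\<forall>i\<in>I. \<forall>q\<in>V. \<forall>c. c \<notin> S \<longrightarrow> partial c (g i) q = 0)"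
    by (rule insert.IH) (use insert.prems in simp)
  then obtain V S where V: "open V" "p \<in> V" "V \<subseteq> W" "finite S"
      "\<forall>i\<in>I. \<forall>q\<in>V. \<forall>c. c \<notin> S \<longrightarrow> partial c (g i) q = 0" by blast
  have "smooth_on W (g i)" using insert.prems by simp
  from smooth_on_local_support[OF this assms(4)]
  obtain V' S' where V': "open V'" "p \<in> V'" "V' \<subseteq> W" "finite S'" "depends_only S' V' (g i)" by blast
  have "partial c (g i) q = 0" if "q \<in> V'" "c \<notin> S'" for q c
    using partial_eq_0_on[OF V'(5,1) that] .
  then have "\<forall>k\<in>insert i I. \<forall>q\<in>V \<inter> V'. \<forall>c. c \<notin> S \<union> S' \<longrightarrow> partial c (g k) q = 0"
    using V(5) by auto
  moreover have "open (V \<inter> V')" "p \<in> V \<inter> V'" "V \<inter> V' \<subseteq> W" "finite (S \<union> S')" using V V' by auto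
  ultimately show ?case by blast
qed

lemma smooth_on_support_single:
  assumes "open W" "smooth_on W h" "p \<in> W"
  shows "\<exists>V S. open V \<and> p \<in> V \<and> V \<subseteq> W \<and> finite S \<and> (\<forall>q\<in>V. \<forall>c. c \<notin> S \<longrightarrow> partial c h q = 0)"
  using smooth_on_support[of W "{()}" "\<lambda>_. h" p] assms by simp

lemma finite_partial_support:
  assumes "smooth_on W h" "open W" "p \<in> W"
  shows "finite {c. partial c h p \<noteq> 0}"
proof -
  obtain V S where "p \<in> V" and S: "finite S" and "\<forall>q\<in>V. \<forall>c. c \<notin> S \<longrightarrow> partial c h q = 0"
    using smooth_on_support_single[OF assms(2,1,3)] by blast
  then have "{c. partial c h p \<noteq> 0} \<subseteq> S" by blast
  then show ?thesis using S by (rule finite_subset)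
qed

lemma finite_order_bound:
  assumes "finite S"
  shows "\<exists>N::nat. \<forall>j \<alpha>. Inr (j, \<alpha>) \<in> S \<longrightarrow> \<alpha> < N"
proof -
  have "finite {\<alpha>. \<exists>j. Inr (j, \<alpha>) \<in> S}"
  proof (rule finite_subset)
    show "{\<alpha>. \<exists>j. Inr (j, \<alpha>) \<in> S} \<subseteq> (\<lambda>c. case c of Inl i \<Rightarrow> 0 | Inr (j, \<alpha>) \<Rightarrow> \<alpha>) ` S" by force
  qed (use assms in simp)
  then obtain N where "\<forall>\<alpha>\<in>{\<alpha>. \<exists>j. Inr (j, \<alpha>) \<in> S}. \<alpha> < N" using finite_nat_set_iff_bounded by blast
  then show ?thesis by blast
qed

text \<open>The components of \<open>f\<^sub>u\<close> without truncation, that is, for \<open>l\<^sub>u = \<infinity>\<close>.\<close>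

definition velocity ::
  "(real ^ 'n \<Rightarrow> real ^ 'm \<Rightarrow> real ^ 'n) \<Rightarrow> ('n::finite, 'm::finite) jet \<Rightarrow> 'n + 'm \<times> nat \<Rightarrow> real" where
  "velocity f p c = (case c of Inl i \<Rightarrow> f (state p) (input p) $ i | Inr (j, \<alpha>) \<Rightarrow> p (Inr (j, Suc \<alpha>)))"

text \<open>
  The sum defining \<open>lie\<close> is finite at every point where only finitely many partial derivatives
  are nonzero; this covers functions whose order is only locally bounded.
\<close>

lemma lie_eq_sum:
  fixes h :: "('n::finite, 'm::finite) jet \<Rightarrow> real"
  assumes S: "finite S" "\<And>c. c \<notin> S \<Longrightarrow> partial c h p = 0"
  shows "lie f h p = (\<Sum>c\<in>S. velocity f p c * partial c h p)"
proof -
  let ?A = "\<lambda>l. Inl ` (UNIV :: 'n set) \<union> Inr ` ((UNIV :: 'm set) \<times> {..<l})"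
  have upto: "lie_upto f l h p = (\<Sum>c\<in>?A l. velocity f p c * partial c h p)" for l
  proof -
    have "(\<Sum>c\<in>?A l. velocity f p c * partial c h p) =
        (\<Sum>c\<in>range Inl. velocity f p c * partial c h p) + (\<Sum>c\<in>Inr ` (UNIV \<times> {..<l}). velocity f p c * partial c h p)"
      by (rule sum.union_disjoint) auto
    also have "(\<Sum>c\<in>range Inl. velocity f p c * partial c h p) = (\<Sum>i\<in>UNIV. f (state p) (input p) $ i * partial (Inl i) h p)"
      by (simp add: sum.reindex velocity_def)
    also have "(\<Sum>c\<in>Inr ` (UNIV \<times> {..<l}). velocity f p c * partial c h p) =
        (\<Sum>j\<in>UNIV. \<Sum>\<alpha><l. p (Inr (j, Suc \<alpha>)) * partial (Inr (j, \<alpha>)) h p)"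
      by (simp add: sum.reindex velocity_def sum.cartesian_product split_def)
    finally show ?thesis unfolding lie_upto_def by simp
  qed
  obtain N where N: "\<forall>j \<alpha>. Inr (j, \<alpha>) \<in> S \<longrightarrow> \<alpha> < N"
    using finite_order_bound[OF S(1)] by blast
  have "lie_upto f l h p = (\<Sum>c\<in>S. velocity f p c * partial c h p)" if "N \<le> l" for l
    unfolding upto
  proof (rule sum.mono_neutral_right)
    show "S \<subseteq> ?A l"
    proof
      fix c assume c: "c \<in> S"
      show "c \<in> ?A l"
      proof (cases c)
        case (Inr b)
        then show ?thesis using c N that by (cases b) fastforce
      qed auto
    qed
  qed (use S in auto)
  then have "\<forall>\<^sub>F l in sequentially. lie_upto f l h p = (\<Sum>c\<in>S. velocity f p c * partial c h p)"
    by (rule eventually_sequentiallyI)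
  from tendsto_eventually[OF this] show ?thesis unfolding lie_def by (rule limI)
qed

lemma lie_cong:
  assumes "open W" "p \<in> W" "\<And>q. q \<in> W \<Longrightarrow> g q = h q"
  shows "lie f g p = lie f h p"
  unfolding lie_def lie_upto_def by (simp only: partial_cong[OF assms])

lemma lie_const [simp]: "lie f (\<lambda>p. r) p = 0"
  using lie_eq_sum[of "{}" "\<lambda>p. r"] by simp

lemma lie_coordinate: "lie f (\<lambda>p. p c) p = velocity f p c"
  using lie_eq_sum[of "{c}" "\<lambda>p. p c"] by (simp add: partial_coordinate)

lemma
  assumes "open W" "smooth_on W g" "smooth_on W h" "p \<in> W"
  shows lie_add: "lie f (\<lambda>p. g p + h p) p = lie f g p + lie f h p"
    and lie_mult: "lie f (\<lambda>p. g p * h p) p = lie f g p * h p + g p * lie f h p"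
proof -
  let ?S = "{c. partial c g p \<noteq> 0} \<union> {c. partial c h p \<noteq> 0}"
  have S: "finite ?S" using assms finite_partial_support by auto
  note gh = partial_add[OF assms(2-4)] partial_mult[OF assms(2-4)]
  have lie: "lie f k p = (\<Sum>c\<in>?S. velocity f p c * partial c k p)"
    if "\<And>c. c \<notin> ?S \<Longrightarrow> partial c k p = 0" for k
    by (rule lie_eq_sum[OF S that])
  show "lie f (\<lambda>p. g p + h p) p = lie f g p + lie f h p"
    using lie[of g] lie[of h] lie[of "\<lambda>p. g p + h p"] by (simp add: gh sum.distrib algebra_simps)
  show "lie f (\<lambda>p. g p * h p) p = lie f g p * h p + g p * lie f h p"
    using lie[of g] lie[of h] lie[of "\<lambda>p. g p * h p"]
    by (simp add: gh sum.distrib algebra_simps sum_distrib_left sum_distrib_right)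
qed

lemma lie_sum:
  assumes "open W" "\<And>i. i \<in> I \<Longrightarrow> smooth_on W (g i)" "p \<in> W"
  shows "lie f (\<lambda>p. \<Sum>i\<in>I. g i p) p = (\<Sum>i\<in>I. lie f (g i) p)"
  using assms(2)
proof (induction I rule: infinite_finite_induct)
  case (insert i I)
  have "smooth_on W (g i)" "smooth_on W (\<lambda>p. \<Sum>i\<in>I. g i p)"
    using insert by (auto intro!: smooth_on_sum[OF assms(1)])
  from lie_add[OF assms(1) this assms(3)] insert show ?case by simp
qed auto

locale control_system =
  fixes f :: "real ^ 'n::finite \<Rightarrow> real ^ 'm::finite \<Rightarrow> real ^ 'n"
    and \<phi> :: "real ^ 'n \<Rightarrow> real ^ 'm \<Rightarrow> real ^ 'm"
    and X :: "(real ^ 'n) set" and U :: "(real ^ 'm) set"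
  assumes open_X: "open X" and open_U: "open U"
    and smooth_f: "smooth_xu X U f" and smooth_\<phi>: "smooth_xu X U \<phi>"
begin

abbreviation "M \<equiv> jets_over X U"

abbreviation "\<Phi> \<equiv> output_deriv f \<phi>"

lemma open_M: "open M"
proof -
  have "continuous_on UNIV (state :: ('n, 'm) jet \<Rightarrow> _)" "continuous_on UNIV (input :: ('n, 'm) jet \<Rightarrow> _)"
    unfolding state_def input_def
    by (intro continuous_on_vec_lambda continuous_on_product_coordinates)+
  then have "open (state -` X :: ('n, 'm) jet set)" "open (input -` U :: ('n, 'm) jet set)"
    using open_X open_U by (auto simp: continuous_on_open_vimage)
  moreover have "M = state -` X \<inter> input -` U" by (auto simp: jets_over_def)
  ultimately show ?thesis by auto
qed

lemma smooth_on_velocity: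
  assumes "open W" "W \<subseteq> M"
  shows "smooth_on W (\<lambda>p. velocity f p c)"
proof (cases c)
  case (Inl i)
  have "smooth_on M (\<lambda>p. f (state p) (input p) $ i)" using smooth_f by (auto simp: smooth_xu_def)
  from smooth_on_subset[OF this assms] show ?thesis by (simp add: velocity_def Inl)
next
  case (Inr b)
  then show ?thesis using assms by (cases b) (simp add: velocity_def)
qed

lemma smooth_on_lie:
  assumes "open W" "W \<subseteq> M" "smooth_on W h"
  shows "smooth_on W (lie f h)"
proof (rule smooth_on_local)
  fix p assume "p \<in> W"
  from smooth_on_support_single[OF assms(1,3) this]
  obtain V S where V: "open V" "p \<in> V" "V \<subseteq> W" "finite S" "\<forall>q\<in>V. \<forall>c. c \<notin> S \<longrightarrow> partial c h q = 0"
    by blast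
  have "smooth_on V (\<lambda>p. \<Sum>c\<in>S. velocity f p c * partial c h p)"
    using V assms smooth_on_subset
    by (intro smooth_on_sum smooth_on_mult smooth_on_velocity smooth_on_partial) auto
  then have "smooth_on V (lie f h)"
    by (rule smooth_on_cong) (use V lie_eq_sum[OF V(4)] in auto)
  then show "\<exists>V. open V \<and> p \<in> V \<and> V \<subseteq> W \<and> smooth_on V (lie f h)" using V by blast
qed

lemma output_deriv_Suc: "\<Phi> j (Suc \<beta>) = lie f (\<Phi> j \<beta>)"
  by (simp add: output_deriv_def)

lemma smooth_on_output_deriv_M: "smooth_on M (\<Phi> j \<beta>)"
proof (induction \<beta>)
  case 0
  then show ?case using smooth_\<phi> by (simp add: output_deriv_def smooth_xu_def)
next
  case (Suc \<beta>)
  then show ?case unfolding output_deriv_Suc by (intro smooth_on_lie open_M) auto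
qed

lemma smooth_on_output_deriv: "open W \<Longrightarrow> W \<subseteq> M \<Longrightarrow> smooth_on W (\<Phi> j \<beta>)"
  using smooth_on_subset[OF smooth_on_output_deriv_M] .

lemma partial_lie:
  assumes V: "open V" "p \<in> V" "V \<subseteq> M" "finite S" "\<And>q c. q \<in> V \<Longrightarrow> c \<notin> S \<Longrightarrow> partial c g q = 0"
    and g: "smooth_on V g"
  shows "partial c (lie f g) p =
    lie f (partial c g) p + (\<Sum>b\<in>S. partial c (\<lambda>p. velocity f p b) p * partial b g p)"
proof -
  have sm: "smooth_on V (\<lambda>p. velocity f p b)" "smooth_on V (partial b g)" for b
    using V g by (auto intro: smooth_on_velocity smooth_on_partial)
  have "partial b (partial c g) p = 0" if "b \<notin> S" for b
  proof -
    have "partial c (partial b g) p = partial c (\<lambda>p. 0) p"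
      by (rule partial_cong[OF V(1,2)]) (use V(5) that in auto)
    then show ?thesis using partial_commute[OF V(1) g V(2)] by simp
  qed
  then have L: "lie f (partial c g) p = (\<Sum>b\<in>S. velocity f p b * partial b (partial c g) p)"
    by (rule lie_eq_sum[OF V(4)])
  have "partial c (lie f g) p = partial c (\<lambda>p. \<Sum>b\<in>S. velocity f p b * partial b g p) p"
    by (rule partial_cong[OF V(1,2)]) (use V in \<open>auto intro!: lie_eq_sum\<close>)
  also have "\<dots> = (\<Sum>b\<in>S. partial c (\<lambda>p. velocity f p b * partial b g p) p)"
    by (rule partial_sum[OF V(1) smooth_on_mult[OF V(1) sm] V(2)])
  also have "\<dots> = (\<Sum>b\<in>S. partial c (\<lambda>p. velocity f p b) p * partial b g p + velocity f p b * partial c (partial b g) p)"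
    by (intro sum.cong refl partial_mult[OF sm V(2)])
  also have "\<dots> = lie f (partial c g) p + (\<Sum>b\<in>S. partial c (\<lambda>p. velocity f p b) p * partial b g p)"
    unfolding L using partial_commute[OF V(1) g V(2)] by (simp add: sum.distrib)
  finally show ?thesis .
qed

text \<open>
  The Lie derivative of the one-form identity \<open>d h = (\<Sum>i\<in>I. a i * d (g i))\<close>.  Exchanging \<open>lie f\<close>
  with \<open>partial c\<close> produces correction terms from the derivatives of \<open>velocity\<close>; on both
  sides they are the same combination of partial derivatives, so they cancel.
\<close>

lemma lie_differential_expansion:
  assumes O: "open V" "V \<subseteq> M" and I: "finite I"
    and h: "smooth_on V h"
    and a: "\<And>i. i \<in> I \<Longrightarrow> smooth_on V (a i)" and g: "\<And>i. i \<in> I \<Longrightarrow> smooth_on V (g i)"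
    and rel: "\<And>p c. p \<in> V \<Longrightarrow> partial c h p = (\<Sum>i\<in>I. a i p * partial c (g i) p)"
    and p: "p \<in> V"
  shows "partial c (lie f h) p =
    (\<Sum>i\<in>I. lie f (a i) p * partial c (g i) p + a i p * partial c (lie f (g i)) p)"
proof -
  have "\<exists>V' S. open V' \<and> p \<in> V' \<and> V' \<subseteq> V \<and> finite S \<and>
      (\<forall>k\<in>insert None (Some ` I). \<forall>q\<in>V'. \<forall>c. c \<notin> S \<longrightarrow> partial c (case k of None \<Rightarrow> h | Some i \<Rightarrow> g i) q = 0)"
    by (rule smooth_on_support[OF O(1) _ _ p]) (use I h g in auto)
  then obtain V' S where V': "open V'" "p \<in> V'" "V' \<subseteq> V" "finite S"
      "\<And>q c. q \<in> V' \<Longrightarrow> c \<notin> S \<Longrightarrow> partial c h q = 0"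
      "\<And>i q c. i \<in> I \<Longrightarrow> q \<in> V' \<Longrightarrow> c \<notin> S \<Longrightarrow> partial c (g i) q = 0" by auto
  let ?d = "\<lambda>k. \<Sum>b\<in>S. partial c (\<lambda>p. velocity f p b) p * partial b k p"
  have V'M: "V' \<subseteq> M" using V'(3) O(2) by blast
  have pl: "partial c (lie f (g i)) p = lie f (partial c (g i)) p + ?d (g i)" if "i \<in> I" for i
    by (rule partial_lie[OF V'(1,2) V'M V'(4) V'(6)[OF that] smooth_on_subset[OF g[OF that] V'(1,3)]])
  have plh: "partial c (lie f h) p = lie f (partial c h) p + ?d h"
    by (rule partial_lie[OF V'(1,2) V'M V'(4) V'(5) smooth_on_subset[OF h V'(1,3)]])
  have "lie f (partial c h) p = lie f (\<lambda>p. \<Sum>i\<in>I. a i p * partial c (g i) p) p"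
    by (rule lie_cong[OF O(1) p rel])
  also have "\<dots> = (\<Sum>i\<in>I. lie f (\<lambda>p. a i p * partial c (g i) p) p)"
    using a g O by (intro lie_sum[OF O(1) _ p] smooth_on_mult smooth_on_partial) auto
  also have "\<dots> = (\<Sum>i\<in>I. lie f (a i) p * partial c (g i) p + a i p * lie f (partial c (g i)) p)"
    using a g O p by (intro sum.cong refl lie_mult[OF O(1)] smooth_on_partial) auto
  finally have 1: "lie f (partial c h) p =
      (\<Sum>i\<in>I. lie f (a i) p * partial c (g i) p + a i p * lie f (partial c (g i)) p)" .
  have "?d h = (\<Sum>b\<in>S. \<Sum>i\<in>I. a i p * (partial c (\<lambda>p. velocity f p b) p * partial b (g i) p))"
    by (simp add: rel[OF p] sum_distrib_left mult.left_commute)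
  also have "\<dots> = (\<Sum>i\<in>I. a i p * ?d (g i))"
    by (subst sum.swap) (simp add: sum_distrib_left)
  finally have 2: "?d h = (\<Sum>i\<in>I. a i p * ?d (g i))" .
  have "partial c (lie f h) p =
      (\<Sum>i\<in>I. lie f (a i) p * partial c (g i) p + a i p * lie f (partial c (g i)) p) + (\<Sum>i\<in>I. a i p * ?d (g i))"
    unfolding plh 1 2 ..
  also have "\<dots> = (\<Sum>i\<in>I. lie f (a i) p * partial c (g i) p + a i p * (lie f (partial c (g i)) p + ?d (g i)))"
    by (simp add: sum.distrib distrib_left)
  also have "\<dots> = (\<Sum>i\<in>I. lie f (a i) p * partial c (g i) p + a i p * partial c (lie f (g i)) p)"
    using pl by simp
  finally show ?thesis .
qed

end

section \<open>Coordinate charts\<close>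

text \<open>
  The derivations \<open>chart_partial W \<Psi> b\<close> are the frame dual to the coframe \<open>d \<Psi>\<^sub>b\<close> of a chart \<open>\<Psi>\<close>.
\<close>

definition chart_partial ::
  "('c \<Rightarrow> real) set \<Rightarrow> (('c \<Rightarrow> real) \<Rightarrow> ('c \<Rightarrow> real)) \<Rightarrow> 'c \<Rightarrow> (('c \<Rightarrow> real) \<Rightarrow> real) \<Rightarrow> ('c \<Rightarrow> real) \<Rightarrow> real" where
  "chart_partial W \<Psi> b h p = partial b (\<lambda>z. h (inv_into W \<Psi> z)) (\<Psi> p)"

locale coordinate_chart =
  fixes W :: "('c \<Rightarrow> real) set" and \<Psi> :: "('c \<Rightarrow> real) \<Rightarrow> ('c \<Rightarrow> real)"
  assumes chart: "coord_chart W \<Psi>"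
begin

abbreviation "D \<equiv> chart_partial W \<Psi>"

lemma open_W: "open W" and inj_\<Psi>: "inj_on \<Psi> W" and open_image: "open (\<Psi> ` W)"
  and smooth_\<Psi>: "smooth_on W (\<lambda>p. \<Psi> p c)" and smooth_inv: "smooth_on (\<Psi> ` W) (\<lambda>z. inv_into W \<Psi> z c)"
  using chart by (simp_all add: coord_chart_def)

lemma inv_\<Psi>: "p \<in> W \<Longrightarrow> inv_into W \<Psi> (\<Psi> p) = p"
  using inj_\<Psi> by simp

lemma \<Psi>_inv: "z \<in> \<Psi> ` W \<Longrightarrow> \<Psi> (inv_into W \<Psi> z) = z"
  by (simp add: f_inv_into_f)

lemma inv_in_W: "z \<in> \<Psi> ` W \<Longrightarrow> inv_into W \<Psi> z \<in> W"
  by (rule inv_into_into)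

lemma smooth_on_chart_expression:
  assumes "smooth_on W h"
  shows "smooth_on (\<Psi> ` W) (\<lambda>z. h (inv_into W \<Psi> z))"
  by (rule smooth_on_compose[OF open_image inv_in_W smooth_inv assms])

lemma smooth_on_chart_partial:
  assumes "smooth_on W h"
  shows "smooth_on W (D b h)"
  unfolding chart_partial_def
  by (rule smooth_on_compose[OF open_W _ smooth_\<Psi> smooth_on_partial[OF smooth_on_chart_expression[OF assms] open_image]])
     (rule imageI)

lemma chart_partial_support:
  assumes "finite I" "\<And>i. i \<in> I \<Longrightarrow> smooth_on W (h i)" "p \<in> W"
  shows "\<exists>V S. open V \<and> p \<in> V \<and> V \<subseteq> W \<and> finite S \<and> (\<forall>i\<in>I. \<forall>q\<in>V. \<forall>b. b \<notin> S \<longrightarrow> D b (h i) q = 0)"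
proof -
  have "\<exists>V S. open V \<and> \<Psi> p \<in> V \<and> V \<subseteq> \<Psi> ` W \<and> finite S \<and>
      (\<forall>i\<in>I. \<forall>q\<in>V. \<forall>b. b \<notin> S \<longrightarrow> partial b (\<lambda>z. h i (inv_into W \<Psi> z)) q = 0)"
    by (rule smooth_on_support[OF open_image assms(1) smooth_on_chart_expression imageI])
       (use assms in auto)
  then obtain V S where V: "open V" "\<Psi> p \<in> V" "finite S"
      "\<forall>i\<in>I. \<forall>q\<in>V. \<forall>b. b \<notin> S \<longrightarrow> partial b (\<lambda>z. h i (inv_into W \<Psi> z)) q = 0" by blast
  have "open {q \<in> W. \<Psi> q \<in> V}" by (rule open_preimage[OF open_W smooth_\<Psi> V(1)])
  moreover have "\<forall>i\<in>I. \<forall>q\<in>{q \<in> W. \<Psi> q \<in> V}. \<forall>b. b \<notin> S \<longrightarrow> D b (h i) q = 0"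
    using V(4) by (simp add: chart_partial_def)
  moreover have "p \<in> {q \<in> W. \<Psi> q \<in> V}" "{q \<in> W. \<Psi> q \<in> V} \<subseteq> W" using V(2) assms(3) by auto
  ultimately show ?thesis using V(3) by blast
qed

lemma finite_chart_partial_support:
  assumes "smooth_on W h" "p \<in> W"
  shows "finite {b. D b h p \<noteq> 0}"
  unfolding chart_partial_def
  by (rule finite_partial_support[OF smooth_on_chart_expression[OF assms(1)] open_image imageI[OF assms(2)]])

text \<open>The chain rule for \<open>h = (h \<circ> \<Psi>\<inverse>) \<circ> \<Psi>\<close> gives the coefficients of \<open>d h\<close> in the coframe \<open>d \<Psi>\<^sub>b\<close>.\<close>

lemma differential_expansion:
  assumes h: "smooth_on W h" and p: "p \<in> W" and S: "finite S" "\<And>b. b \<notin> S \<Longrightarrow> D b h p = 0"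
  shows "partial c h p = (\<Sum>b\<in>S. D b h p * partial c (\<lambda>q. \<Psi> q b) p)"
proof -
  let ?H = "\<lambda>z. h (inv_into W \<Psi> z)"
  have "\<Psi> p \<in> \<Psi> ` W" using p by (rule imageI)
  from smooth_on_local_support[OF smooth_on_chart_expression[OF h] this]
  obtain V T where V: "open V" "\<Psi> p \<in> V" "V \<subseteq> \<Psi> ` W" "finite T" "depends_only T V ?H" by blast
  let ?W = "{q \<in> W. \<Psi> q \<in> V}"
  have oW: "open ?W" by (rule open_preimage[OF open_W smooth_\<Psi> V(1)])
  have pW: "p \<in> ?W" using p V by simp
  have "smooth_on ?W (\<lambda>q. \<Psi> q b)" for b
    using smooth_on_subset[OF smooth_\<Psi> oW] by blast
  from chain_rule[OF oW pW this V(1) _ smooth_on_subset[OF smooth_on_chart_expression[OF h] V(1,3)] V(4,5)]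
  have "partial c (\<lambda>q. ?H (\<Psi> q)) p = (\<Sum>b\<in>T. D b h p * partial c (\<lambda>q. \<Psi> q b) p)"
    unfolding chart_partial_def by simp
  also have "\<dots> = (\<Sum>b\<in>S \<union> T. D b h p * partial c (\<lambda>q. \<Psi> q b) p)"
  proof (rule sum.mono_neutral_left)
    have "D b h p = 0" if "b \<notin> T" for b
      using partial_eq_0_on[OF V(5,1,2) that] by (simp add: chart_partial_def)
    then show "\<forall>b\<in>S \<union> T - T. D b h p * partial c (\<lambda>q. \<Psi> q b) p = 0" by simp
  qed (use S V in auto)
  also have "\<dots> = (\<Sum>b\<in>S. D b h p * partial c (\<lambda>q. \<Psi> q b) p)"
    by (rule sum.mono_neutral_right) (use S V in auto)
  also have "partial c (\<lambda>q. ?H (\<Psi> q)) p = partial c h p"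
    by (rule partial_cong[OF open_W p]) (simp add: inv_\<Psi>)
  finally show ?thesis .
qed

text \<open>The chain rule for \<open>h \<circ> \<Psi>\<inverse>\<close> shows that \<open>D b\<close> is a vector field.\<close>

lemma chart_partial_eq_sum:
  assumes h: "smooth_on W h" and p: "p \<in> W" and S: "finite S" "\<And>c. c \<notin> S \<Longrightarrow> partial c h p = 0"
  shows "D b h p = (\<Sum>c\<in>S. partial c h p * D b (\<lambda>q. q c) p)"
proof -
  from smooth_on_local_support[OF h p]
  obtain V T where V: "open V" "p \<in> V" "V \<subseteq> W" "finite T" "depends_only T V h" by blast
  let ?Z = "{z \<in> \<Psi> ` W. inv_into W \<Psi> z \<in> V}"
  have oZ: "open ?Z" by (rule open_preimage[OF open_image smooth_inv V(1)])
  have pZ: "\<Psi> p \<in> ?Z" using p V inv_\<Psi> by simp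
  have "smooth_on ?Z (\<lambda>z. inv_into W \<Psi> z c)" for c
    using smooth_on_subset[OF smooth_inv oZ] by blast
  from chain_rule[OF oZ pZ this V(1) _ smooth_on_subset[OF h V(1,3)] V(4,5)]
  have "D b h p = (\<Sum>c\<in>T. partial c h p * D b (\<lambda>q. q c) p)"
    unfolding chart_partial_def using p by (simp add: inv_\<Psi>)
  also have "\<dots> = (\<Sum>c\<in>S \<union> T. partial c h p * D b (\<lambda>q. q c) p)"
  proof (rule sum.mono_neutral_left)
    have "partial c h p = 0" if "c \<notin> T" for c
      using partial_eq_0_on[OF V(5,1,2) that] .
    then show "\<forall>c\<in>S \<union> T - T. partial c h p * D b (\<lambda>q. q c) p = 0" by simp
  qed (use S V in auto)
  also have "\<dots> = (\<Sum>c\<in>S. partial c h p * D b (\<lambda>q. q c) p)"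
    by (rule sum.mono_neutral_right) (use S V in auto)
  finally show ?thesis .
qed

lemma chart_partial_coordinate:
  assumes "p \<in> W"
  shows "D b (\<lambda>q. \<Psi> q b') p = (if b' = b then 1 else 0)"
proof -
  have "D b (\<lambda>q. \<Psi> q b') p = partial b (\<lambda>z. z b') (\<Psi> p)"
    unfolding chart_partial_def
    by (rule partial_cong[OF open_image imageI[OF assms]]) (simp add: \<Psi>_inv)
  then show ?thesis by (simp add: partial_coordinate)
qed

text \<open>Being a vector field, \<open>D b\<close> may be applied to linear relations between differentials.\<close>

lemma chart_partial_linear:
  assumes I: "finite I" and h: "smooth_on W h" and g: "\<And>i. i \<in> I \<Longrightarrow> smooth_on W (g i)" and p: "p \<in> W"
    and rel: "\<And>c. partial c h p = (\<Sum>i\<in>I. y i * partial c (g i) p)"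
  shows "D b h p = (\<Sum>i\<in>I. y i * D b (g i) p)"
proof -
  let ?S = "{c. partial c h p \<noteq> 0} \<union> (\<Union>i\<in>I. {c. partial c (g i) p \<noteq> 0})"
  have S: "finite ?S"
    using I finite_partial_support[OF h open_W p] finite_partial_support[OF g open_W p] by auto
  have "D b h p = (\<Sum>c\<in>?S. partial c h p * D b (\<lambda>q. q c) p)"
    by (rule chart_partial_eq_sum[OF h p S]) auto
  also have "\<dots> = (\<Sum>c\<in>?S. \<Sum>i\<in>I. y i * (partial c (g i) p * D b (\<lambda>q. q c) p))"
    by (simp add: rel sum_distrib_right mult.assoc)
  also have "\<dots> = (\<Sum>i\<in>I. y i * (\<Sum>c\<in>?S. partial c (g i) p * D b (\<lambda>q. q c) p))"
    by (subst sum.swap) (simp add: sum_distrib_left)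
  also have "\<dots> = (\<Sum>i\<in>I. y i * D b (g i) p)"
  proof (rule sum.cong[OF refl])
    fix i assume i: "i \<in> I"
    have "D b (g i) p = (\<Sum>c\<in>?S. partial c (g i) p * D b (\<lambda>q. q c) p)"
      by (rule chart_partial_eq_sum[OF g[OF i] p S]) (use i in auto)
    then show "y i * (\<Sum>c\<in>?S. partial c (g i) p * D b (\<lambda>q. q c) p) = y i * D b (g i) p" by simp
  qed
  finally show ?thesis .
qed

lemma chart_partial_const [simp]: "D b (\<lambda>p. r) p = 0"
  by (simp add: chart_partial_def)

lemma chart_partial_relation:
  assumes "finite I" "\<And>i. i \<in> I \<Longrightarrow> smooth_on W (g i)" "p \<in> W"
    and "\<And>c. (\<Sum>i\<in>I. y i * partial c (g i) p) = 0"
  shows "(\<Sum>i\<in>I. y i * D b (g i) p) = 0"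
  using chart_partial_linear[of I "\<lambda>p. 0" g p y b] assms open_W by simp

end

section \<open>Elimination\<close>

lemma open_nonzero:
  assumes "open W" "smooth_on W h"
  shows "open {p \<in> W. h p \<noteq> 0}"
proof -
  have "open (h -` (- {0}) \<inter> W)"
    using continuous_on_open_vimage[OF assms(1)] smooth_on_continuous[OF assms(2)] by blast
  moreover have "h -` (- {0}) \<inter> W = {p \<in> W. h p \<noteq> 0}" by auto
  ultimately show ?thesis by simp
qed

text \<open>
  More rows than columns force a relation between the rows.  Elimination without
  division keeps the coefficients smooth; the pivot is nonzero after shrinking the open set.
\<close>

lemma smooth_row_relation:
  fixes A :: "'i \<Rightarrow> 'j \<Rightarrow> ('c \<Rightarrow> real) \<Rightarrow> real"
  assumes "finite J" "finite I" "card J < card I" "open W" "W \<noteq> {}"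
    and "\<And>i j. i \<in> I \<Longrightarrow> j \<in> J \<Longrightarrow> smooth_on W (A i j)"
  shows "\<exists>V a. open V \<and> V \<subseteq> W \<and> (\<forall>i\<in>I. smooth_on V (a i)) \<and> (\<exists>i\<in>I. \<exists>p\<in>V. a i p \<noteq> 0) \<and>
    (\<forall>p\<in>V. \<forall>j\<in>J. (\<Sum>i\<in>I. a i p * A i j p) = 0)"
  using assms
proof (induction J arbitrary: I A W rule: finite_induct)
  case empty
  then obtain i where "i \<in> I" by fastforce
  then show ?case using empty by (intro exI[of _ W] exI[of _ "\<lambda>_ _. 1"]) auto
next
  case (insert j0 J)
  note W = \<open>open W\<close>
  show ?case
  proof (cases "\<forall>i\<in>I. \<forall>p\<in>W. A i j0 p = 0")
    case True
    have "\<exists>V a. open V \<and> V \<subseteq> W \<and> (\<forall>i\<in>I. smooth_on V (a i)) \<and> (\<exists>i\<in>I. \<exists>p\<in>V. a i p \<noteq> 0) \<and>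
        (\<forall>p\<in>V. \<forall>j\<in>J. (\<Sum>i\<in>I. a i p * A i j p) = 0)"
      using insert.prems insert.hyps by (intro insert.IH) auto
    then obtain V a where V: "open V" "V \<subseteq> W" "\<forall>i\<in>I. smooth_on V (a i)" "\<exists>i\<in>I. \<exists>p\<in>V. a i p \<noteq> 0"
        "\<forall>p\<in>V. \<forall>j\<in>J. (\<Sum>i\<in>I. a i p * A i j p) = 0" by blast
    have "\<forall>p\<in>V. (\<Sum>i\<in>I. a i p * A i j0 p) = 0"
      using True V(2) by (intro ballI sum.neutral) auto
    then have "\<forall>p\<in>V. \<forall>j\<in>insert j0 J. (\<Sum>i\<in>I. a i p * A i j p) = 0" using V(5) by simp
    with V(1-4) show ?thesis by blast
  next
    case False
    then obtain i0 p0 where 0: "i0 \<in> I" "p0 \<in> W" "A i0 j0 p0 \<noteq> 0" by blast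
    let ?W = "{p \<in> W. A i0 j0 p \<noteq> 0}" and ?I = "I - {i0}"
    \<comment> \<open>Column \<open>j0\<close> is cleared with the pivot \<open>A i0 j0\<close>, after multiplying the other rows by it.\<close>
    let ?A = "\<lambda>i j p. A i0 j0 p * A i j p - A i j0 p * A i0 j p"
    have sm: "smooth_on W (A i j)" if "i \<in> I" "j \<in> insert j0 J" for i j using insert.prems that by blast
    have oW: "open ?W" using open_nonzero[OF W sm] 0 by simp
    have smW: "smooth_on ?W (A i j)" if "i \<in> I" "j \<in> insert j0 J" for i j
      using smooth_on_subset[OF sm[OF that] oW] by blast
    have "\<exists>V a. open V \<and> V \<subseteq> ?W \<and> (\<forall>i\<in>?I. smooth_on V (a i)) \<and> (\<exists>i\<in>?I. \<exists>p\<in>V. a i p \<noteq> 0) \<and>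
        (\<forall>p\<in>V. \<forall>j\<in>J. (\<Sum>i\<in>?I. a i p * ?A i j p) = 0)"
    proof (rule insert.IH)
      show "card J < card ?I" using insert.prems insert.hyps 0 by simp
      show "smooth_on ?W (?A i j)" if "i \<in> ?I" "j \<in> J" for i j
        using that 0 by (intro smooth_on_diff smooth_on_mult oW smW) auto
    qed (use insert.prems 0 oW in auto)
    then obtain V a where V: "open V" "V \<subseteq> ?W" "\<forall>i\<in>?I. smooth_on V (a i)" "\<exists>i\<in>?I. \<exists>p\<in>V. a i p \<noteq> 0"
        "\<forall>p\<in>V. \<forall>j\<in>J. (\<Sum>i\<in>?I. a i p * ?A i j p) = 0" by blast
    define a' where "a' i p = (if i = i0 then - (\<Sum>k\<in>?I. a k p * A k j0 p) else a i p * A i0 j0 p)" for i p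
    have smV: "smooth_on V (A i j)" if "i \<in> I" "j \<in> insert j0 J" for i j
      using smooth_on_subset[OF smW[OF that] V(1,2)] .
    have split: "(\<Sum>i\<in>I. a' i p * A i j p) = (\<Sum>i\<in>?I. a i p * ?A i j p)" for p j
    proof -
      have "(\<Sum>i\<in>I. a' i p * A i j p) = a' i0 p * A i0 j p + (\<Sum>i\<in>?I. a' i p * A i j p)"
        using insert.prems 0 by (simp add: sum.remove)
      also have "(\<Sum>i\<in>?I. a' i p * A i j p) = (\<Sum>i\<in>?I. a i p * A i0 j0 p * A i j p)"
        by (rule sum.cong) (auto simp: a'_def)
      also have "a' i0 p * A i0 j p = (\<Sum>i\<in>?I. - (a i p * A i j0 p * A i0 j p))"
        by (simp add: a'_def sum_distrib_right sum_negf)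
      finally show ?thesis by (simp add: sum.distrib[symmetric] algebra_simps)
    qed
    show ?thesis
    proof (intro exI[of _ V] exI[of _ a'] conjI ballI)
      show "smooth_on V (a' i)" if "i \<in> I" for i
      proof (cases "i = i0")
        case True
        have "smooth_on V (\<lambda>p. - (\<Sum>k\<in>?I. a k p * A k j0 p))"
          using V(3) by (intro smooth_on_minus smooth_on_sum smooth_on_mult V(1) smV) auto
        moreover have "a' i0 = (\<lambda>p. - (\<Sum>k\<in>?I. a k p * A k j0 p))" by (auto simp: a'_def)
        ultimately show ?thesis using True by simp
      next
        case False
        have "smooth_on V (\<lambda>p. a i p * A i0 j0 p)"
          using V(3) that False 0 by (intro smooth_on_mult V(1) smV) auto
        moreover have "a' i = (\<lambda>p. a i p * A i0 j0 p)" using False by (auto simp: a'_def)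
        ultimately show ?thesis by simp
      qed
      from V(4) obtain i p where ip: "i \<in> ?I" "p \<in> V" "a i p \<noteq> 0" by blast
      moreover have "A i0 j0 p \<noteq> 0" using ip V(2) by blast
      ultimately have "i \<in> I" "a' i p \<noteq> 0" by (auto simp: a'_def)
      then show "\<exists>i\<in>I. \<exists>p\<in>V. a' i p \<noteq> 0" using ip(2) by blast
      show "(\<Sum>i\<in>I. a' i p * A i j p) = 0" if "p \<in> V" "j \<in> insert j0 J" for p j
      proof (cases "j = j0")
        case True
        then show ?thesis unfolding split by (simp add: mult.commute)
      next
        case False
        then show ?thesis unfolding split using V(5) that by simp
      qed
    qed (use V in auto)
  qed
qed

lemma row_relation:
  fixes A :: "'i \<Rightarrow> 'j \<Rightarrow> real"
  assumes "finite J" "finite I" "card J < card I"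
  shows "\<exists>a. (\<exists>i\<in>I. a i \<noteq> 0) \<and> (\<forall>j\<in>J. (\<Sum>i\<in>I. a i * A i j) = 0)"
proof -
  have "\<exists>V a. open V \<and> V \<subseteq> UNIV \<and> (\<forall>i\<in>I. smooth_on V (a i)) \<and> (\<exists>i\<in>I. \<exists>p\<in>V. a i p \<noteq> 0) \<and>
    (\<forall>p\<in>V. \<forall>j\<in>J. (\<Sum>i\<in>I. a i p * (\<lambda>_ :: unit \<Rightarrow> real. A i j) p) = 0)"
    by (rule smooth_row_relation) (use assms in auto)
  then obtain V and a :: "'i \<Rightarrow> (unit \<Rightarrow> real) \<Rightarrow> real" and i p where
    "i \<in> I" "p \<in> V" "a i p \<noteq> 0" "\<forall>p\<in>V. \<forall>j\<in>J. (\<Sum>i\<in>I. a i p * A i j) = 0" by blast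
  then show ?thesis by (intro exI[of _ "\<lambda>i. a i p"]) blast
qed

text \<open>
  Here \<open>N\<close> is a left inverse of \<open>A\<close>.  Index sets are arbitrary, since rows will be indexed by
  derivatives of outputs or by inputs, and columns by states or by outputs.
\<close>

lemma left_inverse_annihilates:
  fixes A :: "'i \<Rightarrow> 'j \<Rightarrow> real"
  assumes "finite J"
    and N: "\<And>j j'. j \<in> J \<Longrightarrow> j' \<in> J \<Longrightarrow> (\<Sum>i\<in>I. N j i * A i j') = (if j' = j then 1 else 0)"
    and w: "\<And>i. i \<in> I \<Longrightarrow> (\<Sum>j\<in>J. w j * A i j) = 0" and j: "j \<in> J"
  shows "w j = 0"
proof -
  have "w j = (\<Sum>j'\<in>J. w j' * (if j' = j then 1 else 0))" 
    using j assms(1) by (simp add: if_distrib[of "\<lambda>x. _ * x"] cong: if_cong)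
  also have "\<dots> = (\<Sum>j'\<in>J. \<Sum>i\<in>I. N j i * (w j' * A i j'))"
  proof (rule sum.cong[OF refl])
    fix j' assume "j' \<in> J"
    then have "w j' * (if j' = j then 1 else 0) = w j' * (\<Sum>i\<in>I. N j i * A i j')" using N[OF j] by simp
    also have "\<dots> = (\<Sum>i\<in>I. N j i * (w j' * A i j'))" by (simp add: sum_distrib_left mult.left_commute)
    finally show "w j' * (if j' = j then 1 else 0) = (\<Sum>i\<in>I. N j i * (w j' * A i j'))" .
  qed
  also have "\<dots> = (\<Sum>i\<in>I. N j i * (\<Sum>j'\<in>J. w j' * A i j'))"
    by (subst sum.swap) (simp add: sum_distrib_left)
  also have "\<dots> = 0" using w by simp
  finally show ?thesis .
qed

lemma left_inverse_card_le:
  fixes A :: "'i \<Rightarrow> 'j \<Rightarrow> real"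
  assumes "finite I" "finite J"
    and N: "\<And>j j'. j \<in> J \<Longrightarrow> j' \<in> J \<Longrightarrow> (\<Sum>i\<in>I. N j i * A i j') = (if j' = j then 1 else 0)"
  shows "card J \<le> card I"
proof (rule ccontr)
  assume "\<not> card J \<le> card I"
  then obtain w where w: "\<exists>j\<in>J. w j \<noteq> 0" "\<forall>i\<in>I. (\<Sum>j\<in>J. w j * A i j) = 0"
    using row_relation[OF assms(1,2), of "\<lambda>j i. A i j"] by auto
  have "w j = 0" if "j \<in> J" for j
    using left_inverse_annihilates[OF assms(2) N _ that, of w] w(2) by blast
  then show False using w(1) by blast
qed

text \<open>
  Without the row \<open>i0\<close> there are fewer rows than columns, hence a kernel vector \<open>w\<close>.  If \<open>y i0 \<noteq> 0\<close>,
  the relation \<open>y\<close> makes \<open>w\<close> a kernel vector for the row \<open>i0\<close> as well, against left invertibility.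
\<close>

lemma left_inverse_rows_independent:
  fixes A :: "'i \<Rightarrow> 'j \<Rightarrow> real"
  assumes I: "finite I" and J: "finite J" and le: "card I \<le> card J"
    and N: "\<And>j j'. j \<in> J \<Longrightarrow> j' \<in> J \<Longrightarrow> (\<Sum>i\<in>I. N j i * A i j') = (if j' = j then 1 else 0)"
    and y: "\<And>j. j \<in> J \<Longrightarrow> (\<Sum>i\<in>I. y i * A i j) = 0" and i0: "i0 \<in> I"
  shows "y i0 = 0"
proof (rule ccontr)
  assume y0: "y i0 \<noteq> 0"
  have "card (I - {i0}) < card J" using card_Diff1_less[OF I i0] le by linarith
  then obtain w where w: "\<exists>j\<in>J. w j \<noteq> 0" "\<forall>i\<in>I - {i0}. (\<Sum>j\<in>J. w j * A i j) = 0"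
    using row_relation[of "I - {i0}" J "\<lambda>j i. A i j"] I J by auto
  have "y i0 * (\<Sum>j\<in>J. w j * A i0 j) = (\<Sum>i\<in>I. y i * (\<Sum>j\<in>J. w j * A i j))"
    using w(2) i0 I by (simp add: sum.remove[of I i0])
  also have "\<dots> = (\<Sum>j\<in>J. w j * (\<Sum>i\<in>I. y i * A i j))"
    unfolding sum_distrib_left by (subst sum.swap) (simp add: mult.left_commute)
  also have "\<dots> = 0" using y by simp
  finally have "(\<Sum>j\<in>J. w j * A i0 j) = 0" using y0 by simp
  then have "(\<Sum>j\<in>J. w j * A i j) = 0" if "i \<in> I" for i using w(2) that by (cases "i = i0") auto
  from left_inverse_annihilates[OF J N this] w(1) show False by blast
qed

section \<open>The frames of the input-replacement procedure\<close>

lemma step_coords_components: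
  "(\<lambda>q. step_coords f \<phi> \<tau> q (Inl i)) = (\<lambda>q. q (Inl i))"
  "\<tau> j = None \<Longrightarrow> (\<lambda>q. step_coords f \<phi> \<tau> q (Inr (j, \<alpha>))) = (\<lambda>q. q (Inr (j, \<alpha>)))"
  "\<tau> j = Some (c, k) \<Longrightarrow> (\<lambda>q. step_coords f \<phi> \<tau> q (Inr (j, \<alpha>))) = output_deriv f \<phi> c (k + \<alpha>)"
  by (auto simp: step_coords_def)

lemma rest_inputs_eq: "rest_inputs \<tau> = {j. \<tau> j = None}"
  unfolding rest_inputs_def dom_def by (rule set_eqI) (simp only: Compl_iff mem_Collect_eq not_not)

lemma coord_chart_id:
  assumes "open W"
  shows "coord_chart W (\<lambda>p. p)"
proof -
  have "inv_into W (\<lambda>p. p) z = z" if "z \<in> W" for z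
    using f_inv_into_f[of z "\<lambda>p. p" W] that by simp
  then have "smooth_on W (\<lambda>z. inv_into W (\<lambda>p. p) z c)" for c
    by (intro smooth_on_cong[OF smooth_on_coordinate[OF assms, of c] assms]) simp
  then show ?thesis using assms by (simp add: coord_chart_def)
qed

locale replacement_procedure = control_system f \<phi> X U
  for f :: "real ^ 'n::finite \<Rightarrow> real ^ 'm::finite \<Rightarrow> real ^ 'n"
    and \<phi> :: "real ^ 'n \<Rightarrow> real ^ 'm \<Rightarrow> real ^ 'm" and X U +
  fixes W :: "('n, 'm) jet set" and s :: nat and \<tau> :: "nat \<Rightarrow> 'm \<Rightarrow> ('m \<times> nat) option"
    and K :: "nat \<Rightarrow> 'm \<Rightarrow> nat" and m :: "nat \<Rightarrow> nat" and C :: "nat \<Rightarrow> 'm set" and \<kappa> :: "'m \<Rightarrow> nat"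
  assumes open_W: "open W" and W_M: "W \<subseteq> M"
    and run: "procedure_run f \<phi> W s \<tau> K m C"
    and \<kappa>: "\<And>i c. 1 \<le> i \<Longrightarrow> i \<le> s \<Longrightarrow> c \<in> C i \<Longrightarrow> \<kappa> c = K i c"
begin

abbreviation "\<Psi> i \<equiv> step_coords f \<phi> (\<tau> i)"

text \<open>
  In the coordinates after step \<open>i\<close>, \<open>D i (Inr (j, \<alpha>))\<close> is the derivative by \<open>u\<^sup>j\<^bsub>[\<alpha>]\<^esub>\<close> if \<open>u\<^sup>j\<close> belongs to
  \<open>u\<^bsub>rest\<^esub>\<close>, and otherwise by the derivative of order \<open>\<alpha>\<close> of the component of \<open>v\<close> that has replaced \<open>u\<^sup>j\<close>.
\<close>

abbreviation "D i \<equiv> chart_partial W (\<Psi> i)"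

abbreviation "u j \<alpha> \<equiv> \<lambda>q :: ('n, 'm) jet. q (Inr (j, \<alpha>))"

lemma step: "i < s \<Longrightarrow> procedure_step f \<phi> W (\<tau> i) (K (Suc i)) (m (Suc i)) (C (Suc i)) (\<tau> (Suc i))"
  using run unfolding procedure_run_def by (metis Suc_leI atLeastAtMost_iff diff_Suc_1 le_add1 plus_1_eq_Suc)

lemma \<tau>_0: "\<tau> 0 = (\<lambda>_. None)"
  using run by (simp add: procedure_run_def)

lemma chart_step: "i \<le> s \<Longrightarrow> coord_chart W (\<Psi> i)"
proof (cases i)
  case 0
  have "step_coords f \<phi> (\<lambda>_. None) p = p" for p
    by (rule ext) (auto simp: step_coords_def split: sum.split)
  then have "\<Psi> 0 = (\<lambda>p. p)" unfolding \<tau>_0 by auto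
  then show ?thesis using coord_chart_id[OF open_W] 0 by simp
next
  case (Suc i')
  assume "i \<le> s"
  then show ?thesis using step[of i'] Suc by (simp add: procedure_step_def)
qed

lemma frame: "i \<le> s \<Longrightarrow> coordinate_chart W (\<Psi> i)"
  using chart_step by (rule coordinate_chart.intro)

lemma smooth_u: "smooth_on W (u j \<alpha>)"
  using open_W by simp

lemma smooth_x: "smooth_on W (\<lambda>q. q (Inl k))"
  using open_W by simp

lemmas smooth_\<Phi> = smooth_on_output_deriv[OF open_W W_M]

lemma smooth_frame: "smooth_on W (\<lambda>q. \<Psi> i q b)" if "i \<le> s"
  using coordinate_chart.smooth_\<Psi>[OF frame[OF that]] .

lemma D_state:
  assumes "i \<le> s" "p \<in> W"
  shows "D i b (\<lambda>q. q (Inl k)) p = (if b = Inl k then 1 else 0)"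
  using coordinate_chart.chart_partial_coordinate[OF frame[OF assms(1)] assms(2), of b "Inl k"]
  by (auto simp: step_coords_components)

lemma D_rest_input:
  assumes "i \<le> s" "p \<in> W" "\<tau> i j = None"
  shows "D i b (u j \<alpha>) p = (if b = Inr (j, \<alpha>) then 1 else 0)"
  using coordinate_chart.chart_partial_coordinate[OF frame[OF assms(1)] assms(2), of b "Inr (j, \<alpha>)"]
  by (auto simp: step_coords_components(2)[of "\<tau> i", OF assms(3)])

lemma D_replaced:
  assumes "i \<le> s" "p \<in> W" "\<tau> i j = Some (c, k)"
  shows "D i b (\<Phi> c (k + \<alpha>)) p = (if b = Inr (j, \<alpha>) then 1 else 0)"
  using coordinate_chart.chart_partial_coordinate[OF frame[OF assms(1)] assms(2), of b "Inr (j, \<alpha>)"]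
  by (auto simp: step_coords_components(3)[of "\<tau> i", OF assms(3)])

text \<open>
  Change of frames: \<open>d h\<close> is expanded in the coframe after step \<open>i\<close> and evaluated on the frame after
  step \<open>i'\<close>.
\<close>

lemma D_change_frame:
  assumes "i \<le> s" "i' \<le> s" "smooth_on W h" "p \<in> W"
  shows "D i' b' h p = (\<Sum>b\<in>{b. D i b h p \<noteq> 0}. D i b h p * D i' b' (\<lambda>q. \<Psi> i q b) p)"
proof (rule coordinate_chart.chart_partial_linear[OF frame[OF assms(2)] _ assms(3) smooth_frame[OF assms(1)] assms(4)])
  show fin: "finite {b. D i b h p \<noteq> 0}"
    by (rule coordinate_chart.finite_chart_partial_support[OF frame[OF assms(1)] assms(3,4)])
  show "partial c h p = (\<Sum>b\<in>{b. D i b h p \<noteq> 0}. D i b h p * partial c (\<lambda>q. \<Psi> i q b) p)" for c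
    by (rule coordinate_chart.differential_expansion[OF frame[OF assms(1)] assms(3,4) fin]) simp
qed

lemma replaced_output:
  "i \<le> s \<Longrightarrow> \<tau> i j = Some (c, k) \<Longrightarrow> k = \<kappa> c"
proof (induction i arbitrary: j)
  case 0
  then show ?case by (simp add: \<tau>_0)
next
  case (Suc i)
  from step[of i] Suc.prems obtain B \<sigma> where B: "bij_betw \<sigma> B (C (Suc i))"
      "\<tau> (Suc i) = (\<lambda>j. if j \<in> B then Some (\<sigma> j, K (Suc i) (\<sigma> j)) else \<tau> i j)"
    unfolding procedure_step_def by auto
  show ?case
  proof (cases "j \<in> B")
    case True
    then have "c \<in> C (Suc i)" "k = K (Suc i) c" using B Suc.prems by (auto simp: bij_betw_def)
    then show ?thesis using \<kappa>[of "Suc i" c] Suc.prems by simp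
  next
    case False
    then show ?thesis using Suc B(2) by simp
  qed
qed

lemma replaced_in_step:
  "i \<le> s \<Longrightarrow> \<tau> i j = Some (c, k) \<Longrightarrow> \<exists>i'<s. c \<in> C (Suc i')"
proof (induction i arbitrary: j)
  case 0
  then show ?case by (simp add: \<tau>_0)
next
  case (Suc i)
  from step[of i] Suc.prems obtain B \<sigma> where B: "bij_betw \<sigma> B (C (Suc i))"
      "\<tau> (Suc i) = (\<lambda>j. if j \<in> B then Some (\<sigma> j, K (Suc i) (\<sigma> j)) else \<tau> i j)"
    unfolding procedure_step_def by auto
  show ?case
  proof (cases "j \<in> B")
    case True
    then have "c \<in> C (Suc i)" using B Suc.prems by (auto simp: bij_betw_def)
    then show ?thesis using Suc.prems(1) by (intro exI[of _ i]) simp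
  next
    case False
    then show ?thesis using Suc B(2) by simp
  qed
qed

text \<open>Functions of \<open>(x, u)\<close> inherit from the inputs their independence of a frame direction.\<close>

lemma D_xu_eq_0:
  assumes i: "i \<le> s" and p: "p \<in> W" and h: "smooth_on W (\<lambda>q. g (state q) (input q))"
    and u: "\<And>l. D i (Inr b) (u l 0) p = 0"
  shows "D i (Inr b) (\<lambda>q. g (state q) (input q)) p = 0"
proof -
  let ?S = "range Inl \<union> range (\<lambda>l. Inr (l, 0)) :: ('n + 'm \<times> nat) set"
  have dep: "depends_only ?S UNIV (\<lambda>q. g (state q) (input q))"
    unfolding depends_only_def
  proof (intro ballI impI)
    fix q r :: "('n, 'm) jet" assume "\<forall>c\<in>?S. q c = r c"
    then have "state q = state r" "input q = input r" by (auto simp: state_def input_def)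
    then show "g (state q) (input q) = g (state r) (input r)" by simp
  qed
  have "D i (Inr b) (\<lambda>q. g (state q) (input q)) p =
      (\<Sum>c\<in>?S. partial c (\<lambda>q. g (state q) (input q)) p * D i (Inr b) (\<lambda>q. q c) p)"
    by (rule coordinate_chart.chart_partial_eq_sum[OF frame[OF i] h p])
       (auto intro!: partial_eq_0[OF dep])
  also have "\<dots> = 0"
    using u D_state[OF i p] by (intro sum.neutral) auto
  finally show ?thesis .
qed

text \<open>
  In the frame of a step the field \<open>f\<^sub>u\<close> acts as before: it sends \<open>v\<^bsub>[\<alpha>]\<^esub>\<close> to \<open>v\<^bsub>[\<alpha>+1]\<^esub>\<close>, and \<open>u\<^bsub>rest\<^esub>\<close>
  can only enter through \<open>f(x, u)\<close>, undifferentiated.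
\<close>

lemma D_lie_eq_0:
  assumes i: "i \<le> s" and j: "\<tau> i j = None" and \<alpha>: "1 \<le> \<alpha>" and p: "p \<in> W"
    and u: "\<And>l. D i (Inr (j, \<alpha>)) (u l 0) p = 0"
    and h: "smooth_on W h"
    and D0: "\<And>q l \<gamma>. q \<in> W \<Longrightarrow> \<tau> i l = None \<Longrightarrow> D i (Inr (l, \<gamma>)) h q = 0"
  shows "D i (Inr (j, \<alpha>)) (lie f h) p = 0"
proof -
  interpret chart: coordinate_chart W "\<Psi> i" using frame[OF i] .
  have "\<exists>V S. open V \<and> p \<in> V \<and> V \<subseteq> W \<and> finite S \<and> (\<forall>k\<in>{()}. \<forall>q\<in>V. \<forall>b. b \<notin> S \<longrightarrow> D i b h q = 0)"
    by (rule chart.chart_partial_support) (use h p in auto)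
  then obtain V S where V: "open V" "p \<in> V" "V \<subseteq> W" "finite S" "\<And>q b. q \<in> V \<Longrightarrow> b \<notin> S \<Longrightarrow> D i b h q = 0"
    by auto
  have VM: "V \<subseteq> M" using V(3) W_M by blast
  have "partial c (lie f h) p = (\<Sum>b\<in>S. lie f (D i b h) p * partial c (\<lambda>q. \<Psi> i q b) p +
      D i b h p * partial c (lie f (\<lambda>q. \<Psi> i q b)) p)" for c
  proof (rule lie_differential_expansion[OF V(1) VM V(4) _ _ _ _ V(2)])
    show "smooth_on V h" "smooth_on V (D i b h)" "smooth_on V (\<lambda>q. \<Psi> i q b)" for b
      by (rule smooth_on_subset[OF _ V(1,3)], rule h chart.smooth_on_chart_partial[OF h] chart.smooth_\<Psi>)+
    fix q c assume q: "q \<in> V"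
    then show "partial c h q = (\<Sum>b\<in>S. D i b h q * partial c (\<lambda>q. \<Psi> i q b) q)"
      using V by (intro chart.differential_expansion[OF h]) auto
  qed
  then have exp: "partial c (lie f h) p = (\<Sum>k\<in>S <+> S.
      case_sum (\<lambda>b. lie f (D i b h) p) (\<lambda>b. D i b h p) k *
      partial c (case_sum (\<lambda>b q. \<Psi> i q b) (\<lambda>b. lie f (\<lambda>q. \<Psi> i q b)) k) p)" for c
    by (simp add: sum.Plus[OF V(4,4)] sum.distrib)
  have sm: "smooth_on W (case_sum (\<lambda>b q. \<Psi> i q b) (\<lambda>b. lie f (\<lambda>q. \<Psi> i q b)) k)" for k
    by (cases k) (auto intro: chart.smooth_\<Psi> smooth_on_lie[OF open_W W_M])
  have "D i (Inr (j, \<alpha>)) (lie f h) p = (\<Sum>k\<in>S <+> S.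
      case_sum (\<lambda>b. lie f (D i b h) p) (\<lambda>b. D i b h p) k *
      D i (Inr (j, \<alpha>)) (case_sum (\<lambda>b q. \<Psi> i q b) (\<lambda>b. lie f (\<lambda>q. \<Psi> i q b)) k) p)"
    by (rule chart.chart_partial_linear[OF _ smooth_on_lie[OF open_W W_M h] sm p exp]) (use V(4) in simp)
  also have "\<dots> = (\<Sum>b\<in>S. lie f (D i b h) p * D i (Inr (j, \<alpha>)) (\<lambda>q. \<Psi> i q b) p +
      D i b h p * D i (Inr (j, \<alpha>)) (lie f (\<lambda>q. \<Psi> i q b)) p)"
    by (simp add: sum.Plus[OF V(4,4)] sum.distrib)
  also have "\<dots> = 0"
  proof (rule sum.neutral, rule ballI)
    fix b
    show "lie f (D i b h) p * D i (Inr (j, \<alpha>)) (\<lambda>q. \<Psi> i q b) p +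
        D i b h p * D i (Inr (j, \<alpha>)) (lie f (\<lambda>q. \<Psi> i q b)) p = 0"
    proof (cases b)
      case (Inl k)
      have "lie f (\<lambda>q. q (Inl k)) = (\<lambda>q. f (state q) (input q) $ k)"
        by (rule ext) (simp add: lie_coordinate velocity_def)
      moreover have "smooth_on W (\<lambda>q. f (state q) (input q) $ k)"
        using smooth_on_velocity[OF open_W W_M, of "Inl k"] by (simp add: velocity_def)
      from D_xu_eq_0[OF i p this u] have "D i (Inr (j, \<alpha>)) (\<lambda>q. f (state q) (input q) $ k) p = 0" .
      ultimately show ?thesis using D_state[OF i p] by (simp add: Inl step_coords_components)
    next
      case (Inr l\<gamma>)
      obtain l \<gamma> where b: "b = Inr (l, \<gamma>)" using Inr by (cases l\<gamma>) auto
      show ?thesis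
      proof (cases "\<tau> i l")
        case None
        then have "D i b h p = 0" "lie f (D i b h) p = 0"
          using D0[OF _ None] p lie_cong[OF open_W p, of "D i b h" "\<lambda>q. 0" f] by (auto simp: b)
        then show ?thesis by simp
      next
        case (Some ck)
        obtain c k where ck: "\<tau> i l = Some (c, k)" using Some by (cases ck) auto
        have "l \<noteq> j" using ck j by auto
        then have "D i (Inr (j, \<alpha>)) (\<Phi> c (k + \<gamma>')) p = 0" for \<gamma>'
          using D_replaced[OF i p ck, of "Inr (j, \<alpha>)" \<gamma>'] by simp
        from this[of \<gamma>] this[of "Suc \<gamma>"] show ?thesis
          unfolding b step_coords_components(3)[of "\<tau> i", OF ck] by (simp add: output_deriv_Suc)
      qed
    qed
  qed
  finally show ?thesis .
qed

lemma input_partial_eq_D: "input_partial f \<phi> W (\<tau> i) g j p = D i (Inr (j, 0)) g p"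
  by (simp add: input_partial_def chart_partial_def o_def)

text \<open>
  The invariant of the procedure: expressed in the coordinates after step \<open>i\<close>, the original inputs
  do not depend on the time derivatives of \<open>u\<^bsub>rest\<^esub>\<close>, though they may depend on \<open>u\<^bsub>rest\<^esub>\<close> itself.
\<close>

definition inputs_undifferentiated :: "nat \<Rightarrow> bool" where
  "inputs_undifferentiated i \<longleftrightarrow>
     (\<forall>j \<alpha> l. \<forall>p\<in>W. \<tau> i j = None \<longrightarrow> 1 \<le> \<alpha> \<longrightarrow> D i (Inr (j, \<alpha>)) (u l 0) p = 0)"

text \<open>
  By the choice of \<open>K\<close>, derivatives of \<open>\<phi>\<^sup>c\<close> of order below \<open>k\<^sup>c\<close> do not involve \<open>u\<^bsub>rest\<^esub>\<close> itself.
  Its time derivatives cannot enter before \<open>u\<^bsub>rest\<^esub>\<close> does, and at order \<open>k\<^sup>c\<close> they are still absent.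
\<close>

lemma output_before_K:
  assumes i: "i < s" and T: "inputs_undifferentiated i" and c: "c \<in> rest_outputs (\<tau> i)"
  shows "\<beta> \<le> K (Suc i) c \<Longrightarrow> p \<in> W \<Longrightarrow> \<tau> i j = None \<Longrightarrow> 1 \<le> \<alpha> \<or> \<beta> < K (Suc i) c \<Longrightarrow>
    D i (Inr (j, \<alpha>)) (\<Phi> c \<beta>) p = 0"
proof -
  have i': "i \<le> s" using i by simp
  have T': "D i (Inr (j, \<alpha>)) (u l 0) p = 0" if "p \<in> W" "\<tau> i j = None" "1 \<le> \<alpha>" for p j \<alpha> l
    using T that unfolding inputs_undifferentiated_def by blast
  have "\<not> depends_on_rest_inputs f \<phi> W (\<tau> i) (\<Phi> c \<beta>)" if "\<beta> < K (Suc i) c" for \<beta>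
    using step[OF i] c that unfolding procedure_step_def by blast
  then have 0: "D i (Inr (j, 0)) (\<Phi> c \<beta>) p = 0" if "\<beta> < K (Suc i) c" "p \<in> W" "\<tau> i j = None" for \<beta> p j
    using that unfolding depends_on_rest_inputs_def input_partial_eq_D rest_inputs_def by blast
  have *: "D i (Inr (j, \<alpha>)) (\<Phi> c \<beta>) p = 0" if "\<beta> \<le> K (Suc i) c" "p \<in> W" "\<tau> i j = None" "1 \<le> \<alpha>" for \<beta> p j \<alpha>
    using that
  proof (induction \<beta> arbitrary: p j \<alpha>)
    case 0
    have "D i (Inr (j, \<alpha>)) (\<lambda>q. \<phi> (state q) (input q) $ c) p = 0"
      using 0 smooth_\<Phi>[of c 0] by (intro D_xu_eq_0[OF i'] T') (auto simp: output_deriv_def)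
    then show ?case by (simp add: output_deriv_def)
  next
    case (Suc \<beta>)
    show ?case
      unfolding output_deriv_Suc
    proof (rule D_lie_eq_0[OF i' Suc.prems(3,4,2) _ smooth_\<Phi>])
      show "D i (Inr (j, \<alpha>)) (u l 0) p = 0" for l by (rule T'[OF Suc.prems(2-4)])
      show "D i (Inr (l, \<gamma>)) (\<Phi> c \<beta>) q = 0" if "q \<in> W" "\<tau> i l = None" for q l \<gamma>
        using 0[of \<beta> q l] Suc.IH[of q l \<gamma>] that Suc.prems(1) by (cases "\<gamma> = 0") auto
    qed
  qed
  show "\<beta> \<le> K (Suc i) c \<Longrightarrow> p \<in> W \<Longrightarrow> \<tau> i j = None \<Longrightarrow> 1 \<le> \<alpha> \<or> \<beta> < K (Suc i) c \<Longrightarrow>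
    D i (Inr (j, \<alpha>)) (\<Phi> c \<beta>) p = 0"
    using *[of \<beta> p j \<alpha>] 0[of \<beta> p j] by (cases "\<alpha> = 0") auto
qed

text \<open>
  For a direction that belonged to \<open>u\<^bsub>rest\<^esub>\<close> before step \<open>i + 1\<close>, only the old inputs in \<open>u\<^bsub>rest\<^esub>\<close>
  change along it: \<open>x\<close> and the earlier \<open>v\<close> are coordinates both before and after the step.
\<close>

lemma D_next_frame:
  assumes i: "Suc i \<le> s" and p: "p \<in> W" and j: "\<tau> i j = None" and h: "smooth_on W h"
    and h1: "\<And>l \<gamma>. \<tau> i l = None \<Longrightarrow> 1 \<le> \<gamma> \<Longrightarrow> D i (Inr (l, \<gamma>)) h p = 0"
  shows "D (Suc i) (Inr (j, \<alpha>)) h p =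
    (\<Sum>l | \<tau> i l = None. D i (Inr (l, 0)) h p * D (Suc i) (Inr (j, \<alpha>)) (u l 0) p)"
proof -
  have i': "i \<le> s" using i by simp
  let ?b = "Inr (j, \<alpha>)"
  let ?S = "{b. D i b h p \<noteq> 0}" and ?L = "(\<lambda>l. Inr (l, 0)) ` {l. \<tau> i l = None}"
  let ?g = "\<lambda>b. D i b h p * D (Suc i) ?b (\<lambda>q. \<Psi> i q b) p"
  have fin: "finite ?S"
    by (rule coordinate_chart.finite_chart_partial_support[OF frame[OF i'] h p])
  have zero: "?g b = 0" if "b \<notin> ?L" for b
  proof (cases b)
    case (Inl k)
    then show ?thesis using D_state[OF i p] by (simp add: step_coords_components)
  next
    case (Inr l\<gamma>)
    obtain l \<gamma> where b: "b = Inr (l, \<gamma>)" using Inr by (cases l\<gamma>) auto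
    show ?thesis
    proof (cases "\<tau> i l")
      case None
      then have "\<gamma> \<noteq> 0" using that b by auto
      then show ?thesis using h1[OF None] b by simp
    next
      case (Some ck)
      obtain c k where ck: "\<tau> i l = Some (c, k)" using Some by (cases ck) auto
      have "l \<noteq> j" using ck j by auto
      have "\<tau> (Suc i) l = Some (c, k)"
        using step[of i] i ck unfolding procedure_step_def rest_inputs_def by auto
      from D_replaced[OF i p this, of ?b \<gamma>] show ?thesis
        using \<open>l \<noteq> j\<close> unfolding b step_coords_components(3)[of "\<tau> i", OF ck] by simp
    qed
  qed
  have "D (Suc i) ?b h p = sum ?g ?S"
    by (rule D_change_frame[OF i' i h p])
  also have "\<dots> = sum ?g (?S \<union> ?L)"
    by (rule sum.mono_neutral_left) (use fin in auto)
  also have "\<dots> = sum ?g ?L"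
    by (rule sum.mono_neutral_right) (use fin zero in auto)
  also have "\<dots> = (\<Sum>l | \<tau> i l = None. D i (Inr (l, 0)) h p * D (Suc i) ?b (u l 0) p)"
    by (simp add: sum.reindex inj_on_def step_coords_components)
  finally show ?thesis .
qed

text \<open>
  The Jacobian matrix of the chosen \<open>\<phi>\<^sub>i\<^bsub>[\<kappa>\<^sub>i]\<^esub>\<close> with respect to the replaced inputs is
  invertible, because both systems of functions are coordinates: its inverse
  is the matrix of the derivatives of the replaced inputs by the new \<open>v\<close>.  Along a time derivative of
  the new \<open>u\<^bsub>rest\<^esub>\<close> the new coordinates \<open>\<phi>\<^sub>i\<^bsub>[\<kappa>\<^sub>i]\<^esub>\<close> are constant, so by invertibility the replaced inputs are too.
\<close>

lemma inputs_undifferentiated_Suc: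
  assumes i: "Suc i \<le> s" and T: "inputs_undifferentiated i"
  shows "inputs_undifferentiated (Suc i)"
  unfolding inputs_undifferentiated_def
proof (intro allI ballI impI)
  fix j \<alpha> l0 p assume p: "p \<in> W" and j: "\<tau> (Suc i) j = None" and \<alpha>: "1 \<le> (\<alpha>::nat)"
  let ?k = "K (Suc i)" and ?C = "C (Suc i)"
  have i': "i \<le> s" "i < s" using i by auto
  from step[OF i'(2)] obtain B \<sigma> where B: "B \<subseteq> {l. \<tau> i l = None}" "bij_betw \<sigma> B ?C"
      "\<tau> (Suc i) = (\<lambda>j. if j \<in> B then Some (\<sigma> j, ?k (\<sigma> j)) else \<tau> i j)" and C: "?C \<subseteq> rest_outputs (\<tau> i)"
    unfolding procedure_step_def rest_inputs_eq by auto
  have none: "\<tau> i l = None \<longleftrightarrow> l \<in> B \<or> \<tau> (Suc i) l = None" for l using B(1,3) by auto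
  have new: "D (Suc i) b (\<Phi> (\<sigma> l) (?k (\<sigma> l))) p = (if b = Inr (l, 0) then 1 else 0)" if "l \<in> B" for b l
    using D_replaced[OF i p, of l "\<sigma> l" "?k (\<sigma> l)" b 0] B(3) that by simp
  \<comment> \<open>\<open>A\<close> is the Jacobian matrix of the chosen outputs, \<open>Z\<close> will be its inverse.\<close>
  define A where "A l c = D i (Inr (l, 0)) (\<Phi> c (?k c)) p" for l c
  define Z where "Z c l = D (Suc i) (Inr (inv_into B \<sigma> c, 0)) (u l 0) p" for c l
  have expand: "D (Suc i) (Inr (l', \<gamma>)) (\<Phi> c (?k c)) p = (\<Sum>l\<in>B. A l c * D (Suc i) (Inr (l', \<gamma>)) (u l 0) p)"
    if c: "c \<in> ?C" and l': "\<tau> i l' = None" "l' \<in> B \<or> 1 \<le> \<gamma>" for c l' \<gamma>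
  proof -
    have "D (Suc i) (Inr (l', \<gamma>)) (\<Phi> c (?k c)) p =
        (\<Sum>l | \<tau> i l = None. D i (Inr (l, 0)) (\<Phi> c (?k c)) p * D (Suc i) (Inr (l', \<gamma>)) (u l 0) p)"
      by (rule D_next_frame[OF i p l'(1) smooth_\<Phi>])
         (use output_before_K[OF i'(2) T, of c "?k c" p] c C p in auto)
    also have "\<dots> = (\<Sum>l\<in>B. A l c * D (Suc i) (Inr (l', \<gamma>)) (u l 0) p)"
      unfolding A_def
    proof (rule sum.mono_neutral_right)
      show "\<forall>l\<in>{l. \<tau> i l = None} - B. D i (Inr (l, 0)) (\<Phi> c (?k c)) p * D (Suc i) (Inr (l', \<gamma>)) (u l 0) p = 0"
      proof
        fix l assume l: "l \<in> {l. \<tau> i l = None} - B"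
        then have "\<tau> (Suc i) l = None" using none[of l] by blast
        from D_rest_input[OF i p this, of "Inr (l', \<gamma>)" 0]
        have "D (Suc i) (Inr (l', \<gamma>)) (u l 0) p = 0" using l l'(2) by auto
        then show "D i (Inr (l, 0)) (\<Phi> c (?k c)) p * D (Suc i) (Inr (l', \<gamma>)) (u l 0) p = 0" by simp
      qed
    qed (use B in auto)
    finally show ?thesis .
  qed
  have uB: "D (Suc i) (Inr (j, \<alpha>)) (u l 0) p = 0" if "l \<in> B" for l
  proof (rule left_inverse_rows_independent[of B ?C Z A "\<lambda>l. D (Suc i) (Inr (j, \<alpha>)) (u l 0) p" l])
    show "card B \<le> card ?C" using bij_betw_same_card[OF B(2)] by simp
    fix c assume c: "c \<in> ?C"
    then have l: "inv_into B \<sigma> c \<in> B" "\<sigma> (inv_into B \<sigma> c) = c"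
      using B(2) by (auto simp: bij_betw_def inv_into_into f_inv_into_f)
    have "\<tau> i j = None" using none j by simp
    then have "(\<Sum>l\<in>B. A l c * D (Suc i) (Inr (j, \<alpha>)) (u l 0) p) = D (Suc i) (Inr (j, \<alpha>)) (\<Phi> c (?k c)) p"
      using expand[OF c, of j \<alpha>] \<alpha> by simp
    also have "\<dots> = 0" using new[OF l(1), of "Inr (j, \<alpha>)"] \<alpha> l(2) by simp
    finally show "(\<Sum>l\<in>B. D (Suc i) (Inr (j, \<alpha>)) (u l 0) p * A l c) = 0" by (simp add: mult.commute)
    fix c' assume c': "c' \<in> ?C"
    then have l': "inv_into B \<sigma> c' \<in> B" "\<sigma> (inv_into B \<sigma> c') = c'"
      using B(2) by (auto simp: bij_betw_def inv_into_into f_inv_into_f)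
    have "\<tau> i (inv_into B \<sigma> c) = None" using l(1) none by blast
    from expand[OF c' this, of 0] l(1)
    have "(\<Sum>l\<in>B. A l c' * Z c l) = D (Suc i) (Inr (inv_into B \<sigma> c, 0)) (\<Phi> c' (?k c')) p"
      unfolding Z_def by simp
    also have "\<dots> = (if inv_into B \<sigma> c = inv_into B \<sigma> c' then 1 else 0)"
      using new[OF l'(1), of "Inr (inv_into B \<sigma> c, 0)"] unfolding l'(2) by simp
    also have "inv_into B \<sigma> c = inv_into B \<sigma> c' \<longleftrightarrow> c' = c" using l(2) l'(2) by metis
    finally show "(\<Sum>l\<in>B. Z c l * A l c') = (if c' = c then 1 else 0)" by (simp add: mult.commute)
  qed (use that in auto)
  have rest: "D (Suc i) (Inr (j, \<alpha>)) (u l 0) p = 0" if "\<tau> i l = None" for l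
  proof (cases "l \<in> B")
    case False
    then have "\<tau> (Suc i) l = None" using none that by blast
    from D_rest_input[OF i p this, of "Inr (j, \<alpha>)" 0] show ?thesis using \<alpha> by simp
  qed (rule uB)
  have "\<tau> i j = None" using none j by simp
  from D_next_frame[OF i p this smooth_u]
  have "D (Suc i) (Inr (j, \<alpha>)) (u l0 0) p =
      (\<Sum>l | \<tau> i l = None. D i (Inr (l, 0)) (u l0 0) p * D (Suc i) (Inr (j, \<alpha>)) (u l 0) p)"
    using T p unfolding inputs_undifferentiated_def by blast
  also have "\<dots> = 0" using rest by (intro sum.neutral) auto
  finally show "D (Suc i) (Inr (j, \<alpha>)) (u l0 0) p = 0" .
qed

lemma inputs_undifferentiated: "i \<le> s \<Longrightarrow> inputs_undifferentiated i"
proof (induction i)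
  case 0
  show ?case
    unfolding inputs_undifferentiated_def
  proof (intro allI ballI impI)
    fix j \<alpha> l p assume "p \<in> W" "1 \<le> (\<alpha>::nat)"
    then show "D 0 (Inr (j, \<alpha>)) (u l 0) p = 0"
      using D_rest_input[of 0 p l "Inr (j, \<alpha>)" 0] by (simp add: \<tau>_0)
  qed
next
  case (Suc i)
  then show ?case by (simp add: inputs_undifferentiated_Suc)
qed

text \<open>In the last step \<open>m\<^sub>s\<close> is the number of the remaining outputs, so all of them are chosen.\<close>

lemma all_outputs_replaced: "\<exists>j. \<tau> s j = Some (c, \<kappa> c)"
proof -
  have s1: "1 \<le> s" using run by (simp add: procedure_run_def)
  then obtain i where i: "s = Suc i" by (cases s) auto
  from step[of i] i obtain B \<sigma> where B: "bij_betw \<sigma> B (C s)"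
      "\<tau> s = (\<lambda>j. if j \<in> B then Some (\<sigma> j, K s (\<sigma> j)) else \<tau> i j)"
    and B0: "B \<subseteq> rest_inputs (\<tau> i)"
    and C: "C s \<subseteq> rest_outputs (\<tau> i)" "card (C s) = m s"
    unfolding procedure_step_def by auto
  have "\<forall>i\<in>{1..s}. m i = card (rest_outputs (\<tau> (i - 1))) \<longleftrightarrow> i = s"
    using run by (simp add: procedure_run_def)
  then have "m s = card (rest_outputs (\<tau> (s - 1)))" using s1 by auto
  then have "m s = card (rest_outputs (\<tau> i))" using i by simp
  then have Ceq: "C s = rest_outputs (\<tau> i)" using C by (metis card_subset_eq finite_code)
  have "\<exists>j k. \<tau> s j = Some (c, k)"
  proof (cases "c \<in> rest_outputs (\<tau> i)")
    case True
    then have "c \<in> \<sigma> ` B" using B(1) Ceq by (simp add: bij_betw_def)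
    then obtain j where "j \<in> B" "\<sigma> j = c" by blast
    then show ?thesis using B(2) by auto
  next
    case False
    then obtain j k where jk: "\<tau> i j = Some (c, k)" by (auto simp: rest_outputs_def ran_def)
    then have "j \<notin> B" using B0 by (auto simp: rest_inputs_def)
    then have "\<tau> s j = Some (c, k)" using B(2) jk by simp
    then show ?thesis by blast
  qed
  then obtain j k where "\<tau> s j = Some (c, k)" by blast
  with replaced_output[OF order_refl this] show ?thesis by blast
qed

lemma chosen_step: "\<exists>i<s. c \<in> C (Suc i)"
  using all_outputs_replaced[of c] replaced_in_step[OF order_refl] by blast

definition input_of :: "'m \<Rightarrow> 'm" where
  "input_of c = (SOME j. \<tau> s j = Some (c, \<kappa> c))"

lemma \<tau>_input_of: "\<tau> s (input_of c) = Some (c, \<kappa> c)"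
  unfolding input_of_def using all_outputs_replaced[of c] by (rule someI_ex)

lemma bij_input_of: "bij input_of"
proof -
  have "inj input_of"
  proof (rule injI)
    fix c c' assume eq: "input_of c = input_of c'"
    have "Some (c, \<kappa> c) = Some (c', \<kappa> c')"
      using \<tau>_input_of[of c] \<tau>_input_of[of c'] unfolding eq by (rule trans[OF sym])
    then show "c = c'" by simp
  qed
  then show ?thesis by (simp add: bij_def finite_UNIV_inj_surj)
qed

end

section \<open>Counting differentials\<close>

context replacement_procedure
begin

abbreviation "E \<equiv> D s"

text \<open>
  The final coordinates are \<open>x\<close> and all \<open>\<phi>\<^sup>c\<^bsub>[\<beta>]\<^esub>\<close> with \<open>\<beta> \<ge> \<kappa>\<^sup>c\<close>.  The remaining derivatives of the outputs,
  indexed by \<open>rows\<close>, are compared with \<open>x\<close> modulo these: \<open>entry\<close> is the matrix of the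
  differentials \<open>d \<phi>\<^sup>c\<^bsub>[\<beta>]\<^esub>\<close>, \<open>\<beta> < \<kappa>\<^sup>c\<close>, in terms of \<open>d x\<close>.
\<close>

definition rows :: "('m \<times> nat) set" where
  "rows = (SIGMA c:UNIV. {..<\<kappa> c})"

definition entry :: "('m \<times> nat) \<Rightarrow> 'n \<Rightarrow> ('n, 'm) jet \<Rightarrow> real" where
  "entry r k p = E (Inl k) (\<Phi> (fst r) (snd r)) p"

lemma finite_rows: "finite rows"
  by (simp add: rows_def)

lemma in_rows: "r \<in> rows \<longleftrightarrow> snd r < \<kappa> (fst r)"
  by (cases r) (simp add: rows_def)

lemma card_rows: "card rows = (\<Sum>c\<in>UNIV. \<kappa> c)"
  by (simp add: rows_def)

lemma E_output:
  assumes "p \<in> W" "\<kappa> c \<le> \<beta>"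
  shows "E b (\<Phi> c \<beta>) p = (if b = Inr (input_of c, \<beta> - \<kappa> c) then 1 else 0)"
  using D_replaced[OF order_refl assms(1) \<tau>_input_of, of b c "\<beta> - \<kappa> c"] assms(2) by simp

lemma E_state: "p \<in> W \<Longrightarrow> E b (\<lambda>q. q (Inl k)) p = (if b = Inl k then 1 else 0)"
  by (rule D_state) simp

lemma entry_eq_0: "p \<in> W \<Longrightarrow> r \<notin> rows \<Longrightarrow> entry r k p = 0"
  using E_output[of p "fst r" "snd r" "Inl k"] by (simp add: entry_def in_rows)

text \<open>
  The differentials in question are part of the coframe of the final chart, so a relation is
  evaluated on the dual frame to isolate any one coefficient.
\<close>

lemma differentials_independent:
  assumes V: "open V" "V \<subseteq> W" "p \<in> V" and I: "I \<subseteq> range Inl \<union> Inr ` {(j, \<beta>). \<kappa> j \<le> \<beta>}" "finite I"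
    and rel: "\<And>c. (\<Sum>i\<in>I. y i * (case i of Inl k \<Rightarrow> differential (\<lambda>p. p (Inl k))
       | Inr (j, \<beta>) \<Rightarrow> differential (\<Phi> j \<beta>)) p c) = 0"
    and i0: "i0 \<in> I"
  shows "y i0 = 0"
proof -
  define g where "g i = (case i of Inl k \<Rightarrow> (\<lambda>p. p (Inl k)) | Inr (j, \<beta>) \<Rightarrow> \<Phi> j \<beta>)" for i :: "'n + 'm \<times> nat"
  define b where "b i = (case i of Inl k \<Rightarrow> Inl k | Inr (j, \<beta>) \<Rightarrow> Inr (input_of j, \<beta> - \<kappa> j))" for i :: "'n + 'm \<times> nat"
  have p: "p \<in> W" using V by blast
  have inj_b: "inj_on b (range Inl \<union> Inr ` {(j, \<beta>). \<kappa> j \<le> \<beta>})"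
    by (auto simp: inj_on_def b_def inj_eq[OF bij_is_inj[OF bij_input_of]])
  have form: "(case i of Inl k \<Rightarrow> differential (\<lambda>p. p (Inl k)) | Inr (j, \<beta>) \<Rightarrow> differential (\<Phi> j \<beta>)) p c = partial c (g i) p" for i c
    by (auto simp: g_def differential_def split: sum.split)
  have "(\<Sum>i\<in>I. y i * E (b i0) (g i) p) = 0"
  proof (rule coordinate_chart.chart_partial_relation[OF frame[OF order_refl] I(2) _ p])
    show "smooth_on W (g i)" for i
      by (auto simp: g_def smooth_x smooth_\<Phi> split: sum.split)
    show "(\<Sum>i\<in>I. y i * partial c (g i) p) = 0" for c using rel[of c] by (simp add: form)
  qed
  moreover have "E (b i0) (g i) p = (if i = i0 then 1 else 0)" if i: "i \<in> I" for i
  proof -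
    have "E (b i0) (g i) p = (if b i0 = b i then 1 else 0)"
      using i I(1) E_state[OF p] E_output[OF p] by (auto simp: g_def b_def)
    moreover have "b i0 = b i \<longleftrightarrow> i = i0"
      using inj_on_eq_iff[OF inj_b, of i0 i] i i0 I(1) by blast
    ultimately show ?thesis by simp
  qed
  ultimately have "(\<Sum>i\<in>I. y i * (if i = i0 then 1 else 0)) = 0" by simp
  then show ?thesis using i0 I(2) by (simp add: if_distrib[of "\<lambda>x. _ * x"] cong: if_cong)
qed

end

locale flat_run = replacement_procedure f \<phi> X U W s \<tau> K m C \<kappa>
  for f :: "real ^ 'n::finite \<Rightarrow> real ^ 'm::finite \<Rightarrow> real ^ 'n"
    and \<phi> :: "real ^ 'n \<Rightarrow> real ^ 'm \<Rightarrow> real ^ 'm" and X U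
    and W :: "('n, 'm) jet set" and s :: nat and \<tau> :: "nat \<Rightarrow> 'm \<Rightarrow> ('m \<times> nat) option"
    and K :: "nat \<Rightarrow> 'm \<Rightarrow> nat" and m :: "nat \<Rightarrow> nat" and C :: "nat \<Rightarrow> 'm set" and \<kappa> :: "'m \<Rightarrow> nat" +
  fixes R :: "'m \<Rightarrow> nat"
  assumes flat: "flat_index f \<phi> W R" and W_nonempty: "W \<noteq> {}"
begin

text \<open>Flatness puts \<open>d x\<close> into the span of \<open>d \<phi>\<^bsub>[0,R-1]\<^esub>\<close>.\<close>

lemma state_differential:
  assumes p: "p \<in> W"
  shows "\<exists>y. \<forall>c. partial c (\<lambda>q. q (Inl k)) p =
    (\<Sum>r\<in>(SIGMA c:UNIV. {..<R c}). y r * partial c (\<Phi> (fst r) (snd r)) p)"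
proof -
  let ?F = "SIGMA c:UNIV. {..<R c}" and ?G = "\<lambda>p. \<lambda>(j, \<beta>). \<Phi> j \<beta> p"
  from flat[unfolded flat_index_def, THEN bspec, OF p]
  obtain V Y Fx Fu where "open V \<and> p \<in> V \<and> V \<subseteq> W \<and> open Y \<and> (\<forall>p\<in>V. ?G p \<in> Y) \<and>
        (\<forall>i. smooth_on Y (\<lambda>y. Fx y $ i)) \<and> depends_only {(j, \<beta>). \<beta> < R j} Y Fx \<and>
        (\<forall>i. smooth_on Y (\<lambda>y. Fu y $ i)) \<and> depends_only {(j, \<beta>). \<beta> \<le> R j} Y Fu \<and>
        (\<forall>p\<in>V. state p = Fx (?G p) \<and> input p = Fu (?G p))"
    by (elim exE)
  then have V: "open V" "p \<in> V" "V \<subseteq> W" "open Y" "\<And>q. q \<in> V \<Longrightarrow> ?G q \<in> Y"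
      "\<And>i. smooth_on Y (\<lambda>y. Fx y $ i)" "depends_only {(j, \<beta>). \<beta> < R j} Y Fx"
      "\<And>q. q \<in> V \<Longrightarrow> state q = Fx (?G q)"
    by simp_all
  have F: "{(j, \<beta>). \<beta> < R j} = ?F" by auto
  have "depends_only ?F Y (\<lambda>y. Fx y $ k)"
    using V(7) unfolding F depends_only_def by metis
  moreover have "smooth_on V (\<lambda>q. ?G q r)" for r
    using smooth_on_subset[OF smooth_\<Phi> V(1,3)] by (cases r) simp
  ultimately have "partial c (\<lambda>q. Fx (?G q) $ k) p =
      (\<Sum>r\<in>?F. partial r (\<lambda>y. Fx y $ k) (?G p) * partial c (\<lambda>q. ?G q r) p)" for c
    using V(5) by (intro chain_rule[OF V(1,2) _ V(4) _ V(6)]) auto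
  moreover have "partial c (\<lambda>q. Fx (?G q) $ k) p = partial c (\<lambda>q. q (Inl k)) p" for c
  proof (rule partial_cong[OF V(1,2)])
    fix q assume "q \<in> V"
    then have "Fx (?G q) $ k = state q $ k" using V(8) by simp
    then show "Fx (?G q) $ k = q (Inl k)" by (simp add: state_def)
  qed
  moreover have "(\<lambda>q. ?G q r) = \<Phi> (fst r) (snd r)" for r by (auto simp: split_def)
  ultimately show ?thesis by (intro exI[of _ "\<lambda>r. partial r (\<lambda>y. Fx y $ k) (?G p)"]) simp
qed

text \<open>
  Hence modulo the final \<open>d v\<close> the rows span \<open>d x\<close>, even with coefficients that vanish
  on \<open>\<phi>\<^sup>c\<^bsub>[\<beta>]\<^esub>\<close> for \<open>\<beta> \<ge> r\<^sup>c\<close>.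
\<close>

lemma entry_left_inverse:
  assumes p: "p \<in> W"
  shows "\<exists>N. (\<forall>k k'. (\<Sum>r\<in>rows. N k r * entry r k' p) = (if k' = k then 1 else 0)) \<and>
    (\<forall>k r. R (fst r) \<le> snd r \<longrightarrow> N k r = 0)"
proof -
  let ?F = "SIGMA c:UNIV. {..<R c}"
  have "\<forall>k. \<exists>y. \<forall>c. partial c (\<lambda>q. q (Inl k)) p = (\<Sum>r\<in>?F. y r * partial c (\<Phi> (fst r) (snd r)) p)"
    using state_differential[OF p] by (rule allI)
  from choice[OF this] obtain y where "\<forall>k c. partial c (\<lambda>q. q (Inl k)) p =
      (\<Sum>r\<in>?F. y k r * partial c (\<Phi> (fst r) (snd r)) p)" by (elim exE)
  then have y: "\<And>k c. partial c (\<lambda>q. q (Inl k)) p =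
      (\<Sum>r\<in>?F. y k r * partial c (\<Phi> (fst r) (snd r)) p)" by (elim allE)
  define N where "N k r = (if r \<in> ?F then y k r else 0)" for k r
  have "(\<Sum>r\<in>rows. N k r * entry r k' p) = (if k' = k then 1 else 0)" for k k'
  proof -
    have "E (Inl k') (\<lambda>q. q (Inl k)) p = (\<Sum>r\<in>?F. y k r * E (Inl k') (\<Phi> (fst r) (snd r)) p)"
      by (rule coordinate_chart.chart_partial_linear[OF frame[OF order_refl] _ smooth_x smooth_\<Phi> p y]) simp
    also have "\<dots> = (\<Sum>r\<in>?F. N k r * entry r k' p)"
      by (rule sum.cong) (auto simp: N_def entry_def)
    also have "\<dots> = (\<Sum>r\<in>?F \<union> rows. N k r * entry r k' p)"
      by (rule sum.mono_neutral_left) (auto simp: N_def finite_rows)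
    also have "\<dots> = (\<Sum>r\<in>rows. N k r * entry r k' p)"
      by (rule sum.mono_neutral_right) (auto simp: finite_rows entry_eq_0[OF p])
    finally show ?thesis using E_state[OF p, of "Inl k'" k] by auto
  qed
  moreover have "N k r = 0" if "R (fst r) \<le> snd r" for k r
    using that by (cases r) (simp add: N_def)
  ultimately show ?thesis by blast
qed

lemma CARD_le_sum_\<kappa>: "CARD('n) \<le> (\<Sum>c\<in>UNIV. \<kappa> c)"
proof -
  obtain p where p: "p \<in> W" using W_nonempty by blast
  obtain N where N: "\<forall>k k'. (\<Sum>r\<in>rows. N k r * entry r k' p) = (if k' = k then 1 else 0)"
    using entry_left_inverse[OF p] by (elim exE conjE)
  have "card (UNIV :: 'n set) \<le> card rows"
    by (rule left_inverse_card_le[of _ _ N "\<lambda>r k. entry r k p"]) (auto simp: finite_rows N)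
  then show ?thesis by (simp add: card_rows)
qed

text \<open>
  Suppose \<open>r\<^sup>c < \<kappa>\<^sup>c\<close>.  Before the output \<open>c\<close> is chosen, \<open>\<phi>\<^sup>c\<^bsub>[r\<^sup>c]\<^esub>\<close> depends only on \<open>x\<close> and on the outputs
  already introduced, so modulo the final \<open>v\<close> its differential is a combination of \<open>d x\<close>, hence of
  the differentials of \<open>\<phi>\<^bsub>[0,R-1]\<^esub>\<close>, among which it does not occur.  But at most \<open>n\<close> rows that span \<open>d x\<close>
  have no relation.
\<close>

lemma \<kappa>_le_R:
  assumes le: "(\<Sum>c\<in>UNIV. \<kappa> c) \<le> CARD('n)"
  shows "\<kappa> c \<le> R c"
proof (rule ccontr)
  assume "\<not> \<kappa> c \<le> R c"
  then have lt: "R c < \<kappa> c" by simp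
  obtain p where p: "p \<in> W" using W_nonempty by blast
  obtain N where N: "\<forall>k k'. (\<Sum>r\<in>rows. N k r * entry r k' p) = (if k' = k then 1 else 0)"
      "\<forall>k r. R (fst r) \<le> snd r \<longrightarrow> N k r = 0"
    using entry_left_inverse[OF p] by (elim exE conjE)
  obtain i where i: "i < s" "c \<in> C (Suc i)"
    using chosen_step[of c] by blast
  have i': "i \<le> s" using i by simp
  have crest: "c \<in> rest_outputs (\<tau> i)" using step[OF i(1)] i(2) unfolding procedure_step_def by blast
  have Kc: "K (Suc i) c = \<kappa> c" using \<kappa>[of "Suc i" c] i by simp
  have D0: "D i (Inr (j, \<alpha>)) (\<Phi> c (R c)) p = 0" if "\<tau> i j = None" for j \<alpha>
    using output_before_K[OF i(1) inputs_undifferentiated[OF i'] crest _ p that] lt Kc by simp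
  let ?S = "{b. D i b (\<Phi> c (R c)) p \<noteq> 0}"
  have fin: "finite ?S"
    by (rule coordinate_chart.finite_chart_partial_support[OF frame[OF i'] smooth_\<Phi> p])
  define w where "w k = D i (Inl k) (\<Phi> c (R c)) p" for k
  have row: "entry (c, R c) k p = w k" for k
  proof -
    have "entry (c, R c) k p = (\<Sum>b\<in>?S. D i b (\<Phi> c (R c)) p * E (Inl k) (\<lambda>q. \<Psi> i q b) p)"
      using D_change_frame[OF i' order_refl smooth_\<Phi> p, of "Inl k" c "R c"] by (simp add: entry_def)
    also have "\<dots> = (\<Sum>b\<in>?S. if b = Inl k then w k else 0)"
    proof (rule sum.cong[OF refl])
      fix b assume b: "b \<in> ?S"
      show "D i b (\<Phi> c (R c)) p * E (Inl k) (\<lambda>q. \<Psi> i q b) p = (if b = Inl k then w k else 0)"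
      proof (cases b)
        case (Inl k')
        then show ?thesis using E_state[OF p, of "Inl k" k'] by (simp add: step_coords_components w_def)
      next
        case (Inr l\<gamma>)
        obtain l \<gamma> where l\<gamma>: "b = Inr (l, \<gamma>)" using Inr by (cases l\<gamma>) auto
        have "\<tau> i l \<noteq> None"
        proof
          assume "\<tau> i l = None"
          from D0[OF this, of \<gamma>] show False using b l\<gamma> by simp
        qed
        then obtain c'k' where "\<tau> i l = Some c'k'" by blast
        then obtain c' k' where ck: "\<tau> i l = Some (c', k')" by (cases c'k') simp
        have "E (Inl k) (\<Phi> c' (k' + \<gamma>)) p = 0"
          using replaced_output[OF i' ck] E_output[OF p, of c' "k' + \<gamma>" "Inl k"] by simp
        then show ?thesis unfolding l\<gamma> step_coords_components(3)[of "\<tau> i", OF ck] by simp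
      qed
    qed
    also have "\<dots> = w k" using fin by (simp add: w_def)
    finally show ?thesis .
  qed
  \<comment> \<open>The row of \<open>\<phi>\<^sup>c\<^bsub>[r\<^sup>c]\<^esub>\<close> equals \<open>w\<close>; subtracting \<open>w\<close> written through the rows in \<open>\<phi>\<^bsub>[0,R-1]\<^esub>\<close> gives a relation.\<close>
  define y where "y r = (if r = (c, R c) then 1 else 0) - (\<Sum>k\<in>UNIV. w k * N k r)" for r
  have c_row: "(c, R c) \<in> rows" using lt by (simp add: in_rows)
  have "y (c, R c) = 0"
  proof (rule left_inverse_rows_independent[of rows UNIV N "\<lambda>r k. entry r k p" y])
    show "card rows \<le> card (UNIV :: 'n set)" using le by (simp add: card_rows)
    fix k' :: 'n
    have "(\<Sum>r\<in>rows. y r * entry r k' p) = (\<Sum>r\<in>rows. if r = (c, R c) then entry r k' p else 0) -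
        (\<Sum>r\<in>rows. \<Sum>k\<in>UNIV. w k * (N k r * entry r k' p))"
      unfolding y_def left_diff_distrib sum_subtractf sum_distrib_right
      by (intro arg_cong2[of _ _ _ _ "(-)"] sum.cong refl) (auto simp: mult.assoc)
    also have "(\<Sum>r\<in>rows. if r = (c, R c) then entry r k' p else 0) = w k'"
      using c_row finite_rows by (simp add: row)
    also have "(\<Sum>r\<in>rows. \<Sum>k\<in>UNIV. w k * (N k r * entry r k' p)) =
        (\<Sum>k\<in>UNIV. w k * (\<Sum>r\<in>rows. N k r * entry r k' p))"
      by (subst sum.swap) (simp add: sum_distrib_left)
    also have "\<dots> = w k'" using N(1) by (simp add: if_distrib[of "\<lambda>x. _ * x"] cong: if_cong)
    finally show "(\<Sum>r\<in>rows. y r * entry r k' p) = 0" by simp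
  qed (use N(1) c_row finite_rows in auto)
  moreover have "y (c, R c) = 1" using N(2) by (simp add: y_def)
  ultimately show False by simp
qed

end

section \<open>Differential independence of the outputs\<close>

context replacement_procedure
begin

text \<open>
  The order of \<open>\<phi>\<^sup>c\<^bsub>[\<beta>]\<^esub>\<close> is \<open>\<beta> - \<kappa>\<^sup>c\<close>, so that order 0 is attained exactly by the \<open>v\<close> of the final chart.
  Adding \<open>offset\<close>, an upper bound for all \<open>\<kappa>\<^sup>c\<close>, makes it a natural number.
\<close>

definition offset :: nat where
  "offset = (\<Sum>c\<in>UNIV. \<kappa> c)"

definition order_le :: "nat \<Rightarrow> ('m \<times> nat) set" where
  "order_le e = {r. snd r + offset \<le> \<kappa> (fst r) + e}"

abbreviation "\<Phi>' r \<equiv> \<Phi> (fst r) (snd r)"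

definition relation_on :: "('n, 'm) jet set \<Rightarrow> nat \<Rightarrow> ('m \<times> nat \<Rightarrow> ('n, 'm) jet \<Rightarrow> real) \<Rightarrow> bool" where
  "relation_on V e a \<longleftrightarrow> open V \<and> (\<forall>r\<in>order_le e. smooth_on V (a r)) \<and>
     (\<forall>p\<in>V. \<forall>c. (\<Sum>r\<in>order_le e. a r p * partial c (\<Phi>' r) p) = 0)"

definition has_relation_of_order :: "('n, 'm) jet set \<Rightarrow> nat \<Rightarrow> bool" where
  "has_relation_of_order V\<^sub>0 e \<longleftrightarrow> (\<exists>V a. V \<subseteq> V\<^sub>0 \<and> relation_on V e a \<and>
     (\<exists>p\<in>V. \<exists>r. snd r + offset = \<kappa> (fst r) + e \<and> a r p \<noteq> 0))"

lemma \<kappa>_le_offset: "\<kappa> c \<le> offset"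
  unfolding offset_def by (rule member_le_sum) auto

lemma finite_order_le: "finite (order_le e)"
proof (rule finite_subset)
  show "order_le e \<subseteq> UNIV \<times> {..offset + e}"
  proof
    fix r assume "r \<in> order_le e"
    then have "snd r \<le> offset + e" using \<kappa>_le_offset[of "fst r"] by (simp add: order_le_def)
    then show "r \<in> UNIV \<times> {..offset + e}" by (cases r) simp
  qed
qed simp

text \<open>
  Top orders whose coefficients vanish identically on \<open>V\<close> are dropped until a coefficient survives.
\<close>

lemma relation_has_order:
  "relation_on V e a \<Longrightarrow> V \<subseteq> V\<^sub>0 \<Longrightarrow> p \<in> V \<Longrightarrow> r \<in> order_le e \<Longrightarrow> a r p \<noteq> 0 \<Longrightarrow>
    \<exists>e'. has_relation_of_order V\<^sub>0 e'"
proof (induction e arbitrary: r)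
  case 0
  then have "snd r + offset = \<kappa> (fst r) + 0" using \<kappa>_le_offset[of "fst r"] by (simp add: order_le_def)
  then show ?case using 0 unfolding has_relation_of_order_def by blast
next
  case (Suc e)
  show ?case
  proof (cases "\<exists>q\<in>V. \<exists>r'. snd r' + offset = \<kappa> (fst r') + Suc e \<and> a r' q \<noteq> 0")
    case True
    then have "has_relation_of_order V\<^sub>0 (Suc e)" using Suc.prems unfolding has_relation_of_order_def by blast
    then show ?thesis by blast
  next
    case False
    have sub: "order_le e \<subseteq> order_le (Suc e)" by (auto simp: order_le_def)
    have zero: "a r' q = 0" if "r' \<in> order_le (Suc e) - order_le e" "q \<in> V" for r' q
    proof -
      have "snd r' + offset = \<kappa> (fst r') + Suc e" using that(1) by (auto simp: order_le_def)
      then show ?thesis using False that(2) by blast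
    qed
    have "(\<Sum>r\<in>order_le e. a r q * partial c (\<Phi>' r) q) = 0" if "q \<in> V" for q c
    proof -
      have "(\<Sum>r\<in>order_le e. a r q * partial c (\<Phi>' r) q) = (\<Sum>r\<in>order_le (Suc e). a r q * partial c (\<Phi>' r) q)"
        by (rule sum.mono_neutral_left[OF finite_order_le sub]) (use zero that in auto)
      then show ?thesis using Suc.prems(1) that unfolding relation_on_def by simp
    qed
    then have "relation_on V e a" using Suc.prems(1) sub unfolding relation_on_def by blast
    moreover have "r \<in> order_le e" using zero[of r p] Suc.prems by blast
    ultimately show ?thesis using Suc.IH Suc.prems by blast
  qed
qed

text \<open>Differentiating a relation along \<open>f\<^sub>u\<close> shifts its leading coefficients by one order.\<close>

lemma has_relation_of_order_Suc:
  assumes "has_relation_of_order V\<^sub>0 e" "V\<^sub>0 \<subseteq> W"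
  shows "has_relation_of_order V\<^sub>0 (Suc e)"
proof -
  obtain V a p r where V: "V \<subseteq> V\<^sub>0" "relation_on V e a" and p: "p \<in> V"
      and r: "snd r + offset = \<kappa> (fst r) + e" "a r p \<noteq> 0"
    using assms(1) unfolding has_relation_of_order_def by blast
  have oV: "open V" and sm: "\<And>r. r \<in> order_le e \<Longrightarrow> smooth_on V (a r)"
      and rel: "\<And>p c. p \<in> V \<Longrightarrow> 0 = (\<Sum>r\<in>order_le e. a r p * partial c (\<Phi>' r) p)"
    using V(2) unfolding relation_on_def by simp_all
  have VW: "V \<subseteq> W" "V \<subseteq> M" using V(1) assms(2) W_M by auto
  let ?h = "\<lambda>r :: 'm \<times> nat. (fst r, Suc (snd r))"
  define b where "b r p = (if r \<in> ?h ` order_le e then a (fst r, snd r - 1) p else 0)" for r p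
  define a' where "a' r p = (if r \<in> order_le e then lie f (a r) p else 0) + b r p" for r p
  have sub: "order_le e \<subseteq> order_le (Suc e)" "?h ` order_le e \<subseteq> order_le (Suc e)"
    by (auto simp: order_le_def)
  have "relation_on V (Suc e) a'"
    unfolding relation_on_def
  proof (intro conjI ballI allI)
    fix r
    have "smooth_on V (\<lambda>p. if r \<in> order_le e then lie f (a r) p else 0)"
      using smooth_on_lie[OF oV VW(2) sm] oV by (cases "r \<in> order_le e") auto
    moreover have "smooth_on V (b r)"
    proof (cases "r \<in> ?h ` order_le e")
      case True
      then have "(fst r, snd r - 1) \<in> order_le e" by auto
      moreover have "b r = a (fst r, snd r - 1)" using True by (simp add: b_def fun_eq_iff)
      ultimately show ?thesis using sm by simp
    next
      case False
      then have "b r = (\<lambda>p. 0)" by (simp add: b_def fun_eq_iff)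
      then show ?thesis using oV by simp
    qed
    ultimately have "smooth_on V (\<lambda>p. (if r \<in> order_le e then lie f (a r) p else 0) + b r p)"
      by (rule smooth_on_add[OF oV])
    then show "smooth_on V (a' r)" unfolding a'_def .
  next
    fix q c assume q: "q \<in> V"
    have "(\<Sum>r\<in>order_le (Suc e). b r q * partial c (\<Phi>' r) q) = (\<Sum>r\<in>?h ` order_le e. b r q * partial c (\<Phi>' r) q)"
      by (rule sum.mono_neutral_right[OF finite_order_le sub(2)]) (simp add: b_def)
    also have "\<dots> = (\<Sum>r\<in>order_le e. b (?h r) q * partial c (\<Phi>' (?h r)) q)"
      by (subst sum.reindex) (auto simp: inj_on_def)
    also have "\<dots> = (\<Sum>r\<in>order_le e. a r q * partial c (lie f (\<Phi>' r)) q)"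
      by (rule sum.cong) (auto simp: b_def output_deriv_Suc)
    finally have 1: "(\<Sum>r\<in>order_le (Suc e). b r q * partial c (\<Phi>' r) q) =
      (\<Sum>r\<in>order_le e. a r q * partial c (lie f (\<Phi>' r)) q)" .
    have 2: "(\<Sum>r\<in>order_le (Suc e). (if r \<in> order_le e then lie f (a r) q else 0) * partial c (\<Phi>' r) q) =
        (\<Sum>r\<in>order_le e. lie f (a r) q * partial c (\<Phi>' r) q)"
      by (rule sum.mono_neutral_cong_right[OF finite_order_le sub(1)]) auto
    have "(\<Sum>r\<in>order_le (Suc e). a' r q * partial c (\<Phi>' r) q) =
        (\<Sum>r\<in>order_le e. lie f (a r) q * partial c (\<Phi>' r) q + a r q * partial c (lie f (\<Phi>' r)) q)"
      by (simp add: a'_def distrib_right sum.distrib 1 2)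
    also have "\<dots> = partial c (lie f (\<lambda>p. 0)) q"
      by (rule lie_differential_expansion[OF oV VW(2) finite_order_le _ sm _ _ q, symmetric])
         (use oV rel smooth_on_output_deriv[OF oV VW(2)] in simp_all)
    also have "\<dots> = 0" by (simp add: partial_def)
    finally show "(\<Sum>r\<in>order_le (Suc e). a' r q * partial c (\<Phi>' r) q) = 0" .
  qed (rule oV)
  moreover have "?h r \<notin> order_le e" "r \<in> order_le e" using r(1) by (auto simp: order_le_def)
  then have "a' (?h r) p \<noteq> 0" using r(2) by (auto simp: a'_def b_def)
  moreover have "snd (?h r) + offset = \<kappa> (fst (?h r)) + Suc e" using r(1) by simp
  ultimately show ?thesis unfolding has_relation_of_order_def using V(1) p by blast
qed

text \<open>
  Orders are bounded: the leading coefficient is the component of the relation along a direction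
  \<open>v\<^bsub>[\<alpha>]\<^esub>\<close> of the final frame on which the finitely many outputs below \<open>\<kappa>\<close> do not depend.
\<close>

lemma no_relation_of_large_order:
  assumes V0: "V\<^sub>0 \<subseteq> W"
    and S: "\<And>r q b. r \<in> rows \<Longrightarrow> q \<in> V\<^sub>0 \<Longrightarrow> b \<notin> S \<Longrightarrow> E b (\<Phi>' r) q = 0"
    and N: "\<And>j \<alpha>. Inr (j, \<alpha>) \<in> S \<Longrightarrow> \<alpha> < N" and e: "offset + N \<le> e"
  shows "\<not> has_relation_of_order V\<^sub>0 e"
proof
  assume "has_relation_of_order V\<^sub>0 e"
  then obtain V a p r where V: "V \<subseteq> V\<^sub>0" "relation_on V e a" and p: "p \<in> V"
      and r: "snd r + offset = \<kappa> (fst r) + e" "a r p \<noteq> 0"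
    unfolding has_relation_of_order_def by blast
  have pW: "p \<in> W" "p \<in> V\<^sub>0" using p V(1) V0 by auto
  have rk: "\<kappa> (fst r) \<le> snd r" "N \<le> snd r - \<kappa> (fst r)" using r(1) e by auto
  let ?b = "Inr (input_of (fst r), snd r - \<kappa> (fst r))"
  have bS: "?b \<notin> S" using N[of "input_of (fst r)" "snd r - \<kappa> (fst r)"] rk(2) by auto
  have "(\<Sum>r'\<in>order_le e. a r' p * E ?b (\<Phi>' r') p) = 0"
    by (rule coordinate_chart.chart_partial_relation[OF frame[OF order_refl] finite_order_le smooth_\<Phi> pW(1)])
       (use V(2) p in \<open>simp add: relation_on_def\<close>)
  moreover have "E ?b (\<Phi>' r') p = (if r' = r then 1 else 0)" for r'
  proof (cases "r' \<in> rows")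
    case True
    then have "r' \<noteq> r" using rk(1) by (auto simp: in_rows)
    then show ?thesis using S[OF True pW(2) bS] by simp
  next
    case False
    then have k: "\<kappa> (fst r') \<le> snd r'" by (simp add: in_rows)
    have "?b = Inr (input_of (fst r'), snd r' - \<kappa> (fst r')) \<longleftrightarrow> r' = r"
      using rk(1) k inj_eq[OF bij_is_inj[OF bij_input_of]] by (cases r; cases r') auto
    then show ?thesis using E_output[OF pW(1) k, of ?b] by simp
  qed
  ultimately have "(\<Sum>r'\<in>order_le e. a r' p * (if r' = r then 1 else 0)) = 0" by simp
  moreover have "r \<in> order_le e" using r(1) by (simp add: order_le_def)
  ultimately have "a r p = 0"
    using finite_order_le by (simp add: if_distrib[of "\<lambda>x. _ * x"] cong: if_cong)
  then show False using r(2) by simp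
qed

text \<open>
  If there are more outputs below \<open>\<kappa>\<close> than states, elimination of \<open>d x\<close> from their expansions in the
  final frame leaves a relation between differentials of outputs.
\<close>

lemma relation_from_excess:
  assumes gt: "CARD('n) < (\<Sum>c\<in>UNIV. \<kappa> c)" and V0: "open V\<^sub>0" "V\<^sub>0 \<subseteq> W" "V\<^sub>0 \<noteq> {}"
    and S: "\<And>r q b. r \<in> rows \<Longrightarrow> q \<in> V\<^sub>0 \<Longrightarrow> b \<notin> S \<Longrightarrow> E b (\<Phi>' r) q = 0"
    and N: "\<And>j \<alpha>. Inr (j, \<alpha>) \<in> S \<Longrightarrow> \<alpha> < N"
  shows "\<exists>e. has_relation_of_order V\<^sub>0 e"
proof -
  interpret final: coordinate_chart W "\<Psi> s" by (rule frame) simp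
  have entry: "entry r k = E (Inl k) (\<Phi>' r)" for r k by (rule ext) (simp add: entry_def)
  have sm: "smooth_on V (E b (\<Phi>' r))" if "open V" "V \<subseteq> W" for V b r
    by (rule smooth_on_subset[OF final.smooth_on_chart_partial[OF smooth_\<Phi>] that])
  have "\<exists>V a. open V \<and> V \<subseteq> V\<^sub>0 \<and> (\<forall>r\<in>rows. smooth_on V (a r)) \<and> (\<exists>r\<in>rows. \<exists>p\<in>V. a r p \<noteq> 0) \<and>
    (\<forall>p\<in>V. \<forall>k\<in>UNIV. (\<Sum>r\<in>rows. a r p * entry r k p) = 0)"
    by (rule smooth_row_relation)
       (use gt V0 sm in \<open>auto simp: finite_rows card_rows entry\<close>)
  then obtain V a p0 r0 where V: "open V" "V \<subseteq> V\<^sub>0" "\<And>r. r \<in> rows \<Longrightarrow> smooth_on V (a r)"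
      and r0: "r0 \<in> rows" "p0 \<in> V" "a r0 p0 \<noteq> 0"
      and rel: "\<And>p k. p \<in> V \<Longrightarrow> (\<Sum>r\<in>rows. a r p * entry r k p) = 0"
    by blast
  have VW: "V \<subseteq> W" using V(2) V0(2) by blast
  define e where "e = offset + N"
  define Q where "Q = order_le e - rows"
  define \<beta> where "\<beta> r = (Inr (input_of (fst r), snd r - \<kappa> (fst r)) :: 'n + 'm \<times> nat)" for r
  define a' where "a' r p = (if r \<in> rows then a r p else - (\<Sum>r'\<in>rows. a r' p * E (\<beta> r) (\<Phi>' r') p))" for r p
  have rows_sub: "rows \<subseteq> order_le e" by (auto simp: in_rows order_le_def e_def)
  have finQ: "finite Q" by (simp add: Q_def finite_order_le)
  have inj: "inj_on \<beta> Q"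
    by (auto simp: inj_on_def \<beta>_def Q_def in_rows inj_eq[OF bij_is_inj[OF bij_input_of]])
  have frame_Q: "(\<lambda>q. \<Psi> s q (\<beta> r)) = \<Phi>' r" if "r \<in> Q" for r
  proof -
    have "\<kappa> (fst r) \<le> snd r" using that by (simp add: Q_def in_rows)
    then show ?thesis unfolding \<beta>_def step_coords_components(3)[of "\<tau> s", OF \<tau>_input_of] by simp
  qed
  have expand: "partial c (\<Phi>' r) p = (\<Sum>k\<in>UNIV. entry r k p * partial c (\<lambda>q. q (Inl k)) p) +
      (\<Sum>q\<in>Q. E (\<beta> q) (\<Phi>' r) p * partial c (\<Phi>' q) p)" if r: "r \<in> rows" and p: "p \<in> V" for r p c
  proof -
    let ?g = "\<lambda>b. E b (\<Phi>' r) p * partial c (\<lambda>q. \<Psi> s q b) p"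
    have "partial c (\<Phi>' r) p = sum ?g (range Inl \<union> \<beta> ` Q)"
    proof (rule final.differential_expansion[OF smooth_\<Phi>])
      show "p \<in> W" using p VW by blast
      fix b assume b: "b \<notin> range Inl \<union> \<beta> ` Q"
      have "b \<notin> S"
      proof
        assume bS: "b \<in> S"
        obtain l \<alpha> where l: "b = Inr (l, \<alpha>)" using b by (cases b) auto
        obtain c' where c': "l = input_of c'" using bij_input_of by (metis bij_pointE)
        have "\<alpha> < N" using N bS l by simp
        then have "(c', \<kappa> c' + \<alpha>) \<in> Q" by (simp add: Q_def in_rows order_le_def e_def)
        moreover have "\<beta> (c', \<kappa> c' + \<alpha>) = b" by (simp add: \<beta>_def l c')
        ultimately show False using b by blast
      qed
      then show "E b (\<Phi>' r) p = 0" using S[OF r] p V(2) by blast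
    qed (use finQ in simp)
    also have "\<dots> = sum ?g (range Inl) + sum ?g (\<beta> ` Q)"
      by (rule sum.union_disjoint) (use finQ in \<open>auto simp: \<beta>_def\<close>)
    also have "sum ?g (range Inl) = (\<Sum>k\<in>UNIV. entry r k p * partial c (\<lambda>q. q (Inl k)) p)"
      by (simp add: sum.reindex entry step_coords_components)
    also have "sum ?g (\<beta> ` Q) = (\<Sum>q\<in>Q. E (\<beta> q) (\<Phi>' r) p * partial c (\<Phi>' q) p)"
      using frame_Q by (simp add: sum.reindex[OF inj])
    finally show ?thesis .
  qed
  have "relation_on V e a'"
    unfolding relation_on_def
  proof (intro conjI ballI allI)
    fix r
    show "smooth_on V (a' r)"
    proof (cases "r \<in> rows")
      case True
      then have "a' r = a r" by (simp add: a'_def fun_eq_iff)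
      then show ?thesis using V(3)[OF True] by simp
    next
      case False
      then have "a' r = (\<lambda>p. - (\<Sum>r'\<in>rows. a r' p * E (\<beta> r) (\<Phi>' r') p))" by (simp add: a'_def fun_eq_iff)
      moreover have "smooth_on V (\<lambda>p. - (\<Sum>r'\<in>rows. a r' p * E (\<beta> r) (\<Phi>' r') p))"
        by (intro smooth_on_minus smooth_on_sum smooth_on_mult V(1,3) sm VW)
      ultimately show ?thesis by simp
    qed
  next
    fix p c assume p: "p \<in> V"
    have "(\<Sum>r\<in>order_le e. a' r p * partial c (\<Phi>' r) p) =
        (\<Sum>r\<in>rows. a' r p * partial c (\<Phi>' r) p) + (\<Sum>r\<in>Q. a' r p * partial c (\<Phi>' r) p)"
      unfolding Q_def using sum.subset_diff[OF rows_sub finite_order_le] by (simp add: add.commute)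
    also have "(\<Sum>r\<in>Q. a' r p * partial c (\<Phi>' r) p) =
        (\<Sum>q\<in>Q. - (\<Sum>r\<in>rows. a r p * (E (\<beta> q) (\<Phi>' r) p * partial c (\<Phi>' q) p)))"
      by (rule sum.cong) (auto simp: a'_def Q_def sum_distrib_right mult.assoc)
    also have "(\<Sum>r\<in>rows. a' r p * partial c (\<Phi>' r) p) = (\<Sum>r\<in>rows. a r p * partial c (\<Phi>' r) p)"
      by (rule sum.cong) (auto simp: a'_def)
    also have "\<dots> = (\<Sum>r\<in>rows. \<Sum>k\<in>UNIV. a r p * (entry r k p * partial c (\<lambda>q. q (Inl k)) p)) +
        (\<Sum>r\<in>rows. \<Sum>q\<in>Q. a r p * (E (\<beta> q) (\<Phi>' r) p * partial c (\<Phi>' q) p))"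
      using expand[OF _ p] by (simp add: distrib_left sum.distrib sum_distrib_left)
    also have "(\<Sum>r\<in>rows. \<Sum>k\<in>UNIV. a r p * (entry r k p * partial c (\<lambda>q. q (Inl k)) p)) =
        (\<Sum>k\<in>UNIV. (\<Sum>r\<in>rows. a r p * entry r k p) * partial c (\<lambda>q. q (Inl k)) p)"
      by (subst sum.swap) (simp add: sum_distrib_right mult.assoc)
    also have "\<dots> = 0" using rel[OF p] by simp
    also have "(\<Sum>r\<in>rows. \<Sum>q\<in>Q. a r p * (E (\<beta> q) (\<Phi>' r) p * partial c (\<Phi>' q) p)) =
        (\<Sum>q\<in>Q. \<Sum>r\<in>rows. a r p * (E (\<beta> q) (\<Phi>' r) p * partial c (\<Phi>' q) p))"
      by (rule sum.swap)
    finally show "(\<Sum>r\<in>order_le e. a' r p * partial c (\<Phi>' r) p) = 0" by (simp add: sum_negf)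
  qed (rule V(1))
  moreover have "a' r0 p0 \<noteq> 0" using r0 by (simp add: a'_def)
  ultimately show ?thesis using relation_has_order[OF _ V(2) r0(2)] rows_sub r0(1) by blast
qed

text \<open>
  An excess of rows yields one relation, and repeated differentiation of it relations of all larger
  orders, while the orders are bounded.
\<close>

lemma sum_\<kappa>_le_CARD:
  assumes "W \<noteq> {}"
  shows "(\<Sum>c\<in>UNIV. \<kappa> c) \<le> CARD('n)"
proof (rule ccontr)
  assume "\<not> (\<Sum>c\<in>UNIV. \<kappa> c) \<le> CARD('n)"
  then have gt: "CARD('n) < (\<Sum>c\<in>UNIV. \<kappa> c)" by simp
  obtain p0 where p0: "p0 \<in> W" using assms by blast
  have "\<exists>V S. open V \<and> p0 \<in> V \<and> V \<subseteq> W \<and> finite S \<and> (\<forall>r\<in>rows. \<forall>q\<in>V. \<forall>b. b \<notin> S \<longrightarrow> E b (\<Phi>' r) q = 0)"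
    by (rule coordinate_chart.chart_partial_support[OF frame[OF order_refl] finite_rows smooth_\<Phi> p0])
  then obtain V S where V: "open V" "p0 \<in> V" "V \<subseteq> W" "finite S"
      and S: "\<forall>r\<in>rows. \<forall>q\<in>V. \<forall>b. b \<notin> S \<longrightarrow> E b (\<Phi>' r) q = 0" by (elim exE conjE)
  have S': "E b (\<Phi>' r) q = 0" if "r \<in> rows" "q \<in> V" "b \<notin> S" for r q b
    using S that by simp
  obtain N where "\<forall>j \<alpha>. Inr (j, \<alpha>) \<in> S \<longrightarrow> \<alpha> < N" using finite_order_bound[OF V(4)] by (elim exE)
  then have N: "\<alpha> < N" if "Inr (j, \<alpha>) \<in> S" for j \<alpha> using that by simp
  have ne: "V \<noteq> {}" using V(2) by blast
  have "\<exists>e. has_relation_of_order V e" by (rule relation_from_excess[OF gt V(1,3) ne S' N])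
  then obtain e where "has_relation_of_order V e" by (elim exE)
  then have "has_relation_of_order V (e + k)" for k
    by (induction k) (simp_all add: has_relation_of_order_Suc[OF _ V(3)])
  moreover have "\<not> has_relation_of_order V (e + (offset + N))"
    by (rule no_relation_of_large_order[OF V(3) S' N]) simp_all
  ultimately show False by blast
qed

end

section \<open>The multi-index of the procedure\<close>

theorem theorem3p7:
  fixes f :: "real ^ 'n::finite \<Rightarrow> real ^ 'm::finite \<Rightarrow> real ^ 'n"
    and \<phi> :: "real ^ 'n \<Rightarrow> real ^ 'm \<Rightarrow> real ^ 'm"
    and X :: "(real ^ 'n) set" and U :: "(real ^ 'm) set"
    and W :: "('n, 'm) jet set"
    and R \<kappa> :: "'m \<Rightarrow> nat"
    and s :: nat
    and \<tau> :: "nat \<Rightarrow> 'm \<Rightarrow> ('m \<times> nat) option"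
    and K :: "nat \<Rightarrow> 'm \<Rightarrow> nat"
    and m :: "nat \<Rightarrow> nat"
    and C :: "nat \<Rightarrow> 'm set"
  assumes "open X" and "open U"
    and "smooth_xu X U f" and "smooth_xu X U \<phi>"
    and "open W" and "W \<noteq> {}" and "W \<subseteq> jets_over X U"
    and "flat_output f \<phi> W R"
    and "procedure_run f \<phi> W s \<tau> K m C"
    and "\<forall>i\<in>{1..s}. \<forall>c\<in>C i. \<kappa> c = K i c"
  shows "(\<Sum>j\<in>UNIV. \<kappa> j) = CARD('n) \<and> \<kappa> \<le> R \<and>
    forms_independent W (range Inl \<union> Inr ` {(j, \<beta>). \<kappa> j \<le> \<beta> \<and> \<beta> < R j})
      (\<lambda>l. case l of
         Inl i \<Rightarrow> differential (\<lambda>p. p (Inl i))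
       | Inr (j, \<beta>) \<Rightarrow> differential (output_deriv f \<phi> j \<beta>))"
proof -
  interpret flat_run f \<phi> X U W s \<tau> K m C \<kappa> R
    by unfold_locales (use assms in \<open>simp_all add: flat_output_def\<close>)
  let ?I = "range Inl \<union> Inr ` {(j, \<beta>). \<kappa> j \<le> \<beta> \<and> \<beta> < R j} :: ('n + 'm \<times> nat) set"
  have sum: "(\<Sum>j\<in>UNIV. \<kappa> j) = CARD('n)"
    using CARD_le_sum_\<kappa> sum_\<kappa>_le_CARD[OF assms(6)] by (rule antisym[rotated])
  moreover have "\<kappa> \<le> R"
    using \<kappa>_le_R sum by (simp add: le_fun_def)
  moreover have "finite ?I"
  proof -
    have "{(j, \<beta>). \<kappa> j \<le> \<beta> \<and> \<beta> < R j} = (SIGMA j:UNIV. {\<kappa> j..<R j})" by auto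
    then show ?thesis by simp
  qed
  then have "forms_independent W ?I
      (\<lambda>l. case l of
         Inl i \<Rightarrow> differential (\<lambda>p. p (Inl i))
       | Inr (j, \<beta>) \<Rightarrow> differential (output_deriv f \<phi> j \<beta>))"
    unfolding forms_independent_def
  proof (intro conjI allI impI ballI)
    fix V a i p
    assume "open V \<and> V \<subseteq> W \<and> (\<forall>i\<in>?I. smooth_on V (a i)) \<and> (\<forall>p\<in>V. \<forall>c. (\<Sum>i\<in>?I. a i p *
      (case i of Inl i \<Rightarrow> differential (\<lambda>p. p (Inl i)) | Inr (j, \<beta>) \<Rightarrow> differential (output_deriv f \<phi> j \<beta>)) p c) = 0)"
      and i: "i \<in> ?I" and p: "p \<in> V"
    then have V: "open V" "V \<subseteq> W" and rel: "\<And>c. (\<Sum>i\<in>?I. a i p *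
      (case i of Inl i \<Rightarrow> differential (\<lambda>p. p (Inl i)) | Inr (j, \<beta>) \<Rightarrow> differential (output_deriv f \<phi> j \<beta>)) p c) = 0"
      by simp_all
    have "?I \<subseteq> range Inl \<union> Inr ` {(j, \<beta>). \<kappa> j \<le> \<beta>}" by auto
    from differentials_independent[OF V p this \<open>finite ?I\<close> rel i] show "a i p = 0" .
  qed
  ultimately show ?thesis by blast
qed

end
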